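(* Let $l\in\mathbb{C}$, $l\neq 0$. The vertex algebra $M(l)$ is quasi-conformal.
   Context: $\mathbb{N}=\{0,1,2,\dots\}$, $\mathbb{Z}_+=\{1,2,\dots\}$. $\mathfrak{h}$ is a finite-dimensional abelian Lie algebra over $\mathbb{C}$ with a nondegenerate symmetric bilinear form $\langle\cdot,\cdot\rangle$ and an orthonormal basis $u^{(1)},\dots,u^{(d)}$. $\mathfrak{h}[t]=\mathfrak{h}\otimes\mathbb{C}[t]$ is the (abelian) current algebra; $xt^j$ means $x\otimes t^j$. The affinization is $\widehat{\mathfrak{h}[t]}=\mathfrak{h}[t]\otimes\mathbb{C}[s,s^{-1}]\oplus\mathbb{C}\mathbf{k}$ with $\mathbf{k}$ central and $[xt^i\otimes s^m,yt^j\otimes s^n]=m\langle x,y\rangle\delta_{m+n,0}\delta_{i,j}\mathbf{k}$. For $a\in\mathfrak{h}[t]$, $a(n)$ denotes the action of $a\otimes s^n$, and $a(z)=\sum_{n\in\mathbb{Z}}a(n)z^{-n-1}$. $M(l)=U(\widehat{\mathfrak{h}[t]})\otimes_{U(\mathfrak{h}[t]\otimes\mathbb{C}[s]\oplus\mathbb{C}\mathbf{k})}\mathbb{C}\mathbf{1}$ is the induced module where $\mathfrak{h}[t]\otimes\mathbb{C}[s]$ annihilates $\mathbf{1}$ and $\mathbf{k}$ acts as $l$. Normal ordering $:\ :$ places operators $a(n)$ with $n\geq 0$ to the right of those with $n<0$. $M(l)$ is a vertex algebra with vacuum $\mathbf{1}$ and $$Y(a_1(-n_1)\cdots a_k(-n_k)\mathbf{1},z)=\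 :\tfrac{1}{(n_1-1)!}\big(\tfrac{d}{dz}\big)^{n_1-1}a_1(z)\cdots\tfrac{1}{(n_k-1)!}\big(\tfrac{d}{dz}\big)^{n_k-1}a_k(z):$$ for $a_i\in\mathfrak{h}[t]$, $n_i\in\mathbb{Z}_+$. For $n\geq -1$, $L(n)=\frac{1}{2l}\sum_{i=1}^d\sum_{j\in\mathbb{N}}\sum_{m\in\mathbb{Z}}:(u^{(i)}t^j)(n-m)(u^{(i)}t^j)(m):$ on $M(l)$. A vertex algebra $V$ is quasi-conformal if it carries operators $L(n)$, $n\geq -1$, such that for $m,n\geq -1$, $[L(m),L(n)]=(m-n)L(m+n)$, and for $v\in V$, $n\ge -1$, $[L(n),Y(v,x)]=\sum_{m=-1}^n\binom{n+1}{m+1}x^{n-m}Y(L(m)v,x)$. Here $M(l)$ is taken with the operators $L(n)$ displayed above. *)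

theory Defs
  imports
    Complex_Main
    "HOL-Computational_Algebra.Polynomial"
    "HOL-Library.Poly_Mapping"
    "HOL-Library.Groups_Big_Fun"
    "HOL-Library.Product_Plus"
begin

section \<open>Vertex algebras\<close>

text \<open>
  A state-field map is given by its modes: \<open>Y v n w\<close> is \<open>v\<^sub>n w\<close>, where
  \<open>Y(v,z) = \<Sum>n. v\<^sub>n z^(-n-1)\<close>.  The axioms are: \<open>Y(v,z)w\<close> is bilinear in \<open>v, w\<close> and has
  only finitely many negative powers of \<open>z\<close>; vacuum and creation; translation covariance
  \<open>[T, Y(v,z)] = d/dz Y(v,z)\<close> for \<open>T v = v\<^sub>-\<^sub>2 \<one>\<close>; and locality
  \<open>(z - x)^N [Y(u,z), Y(v,x)] = 0\<close>, stated as the vanishing of the coefficient of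
  \<open>z^(-m-1) x^(-n-1)\<close> for all \<open>m, n\<close>.
\<close>

definition vertex_algebra ::
  "(complex \<Rightarrow> 'v \<Rightarrow> 'v) \<Rightarrow> 'v \<Rightarrow> ('v \<Rightarrow> int \<Rightarrow> 'v \<Rightarrow> 'v::ab_group_add) \<Rightarrow> bool" where
  "vertex_algebra sc vac Y \<longleftrightarrow>
     vector_space sc \<and>
     (\<forall>n w. Vector_Spaces.linear sc sc (\<lambda>v. Y v n w)) \<and>
     (\<forall>v n. Vector_Spaces.linear sc sc (Y v n)) \<and>
     (\<forall>v w. \<exists>N. \<forall>n\<ge>N. Y v n w = 0) \<and>
     (\<forall>n w. Y vac n w = (if n = -1 then w else 0)) \<and>
     (\<forall>v. Y v (-1) vac = v \<and> (\<forall>n\<ge>0. Y v n vac = 0)) \<and>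
     (\<forall>v n w. Y (Y v n w) (-2) vac - Y v n (Y w (-2) vac) = sc (- of_int n) (Y v (n - 1) w)) \<and>
     (\<forall>u v. \<exists>N::nat. \<forall>m n w.
        (\<Sum>i\<le>N. sc ((-1) ^ i * of_nat (N choose i))
           (Y u (m + int (N - i)) (Y v (n + int i) w) -
            Y v (n + int i) (Y u (m + int (N - i)) w))) = 0)"

text \<open>
  The last condition is the coefficient of \<open>x^(-k-1)\<close> in
  \<open>[L(n), Y(v,x)] = \<Sum>m=-1..n. binom(n+1, m+1) x^(n-m) Y(L(m) v, x)\<close>.
  The values of \<open>L\<close> below \<open>-1\<close> are irrelevant: in the bracket relation, \<open>m + n < -1\<close>
  occurs only for \<open>m = n = -1\<close>, where the coefficient \<open>m - n\<close> vanishes.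
\<close>

definition quasi_conformal ::
  "(complex \<Rightarrow> 'v \<Rightarrow> 'v) \<Rightarrow> 'v \<Rightarrow> ('v \<Rightarrow> int \<Rightarrow> 'v \<Rightarrow> 'v::ab_group_add) \<Rightarrow>
    (int \<Rightarrow> 'v \<Rightarrow> 'v) \<Rightarrow> bool" where
  "quasi_conformal sc vac Y L \<longleftrightarrow>
     vertex_algebra sc vac Y \<and>
     (\<forall>n\<ge>-1. Vector_Spaces.linear sc sc (L n)) \<and>
     (\<forall>m\<ge>-1. \<forall>n\<ge>-1. \<forall>w. L m (L n w) - L n (L m w) = sc (of_int (m - n)) (L (m + n) w)) \<and>
     (\<forall>n\<ge>-1. \<forall>v k w.
        L n (Y v k w) - Y v k (L n w) =
        (\<Sum>m\<in>{-1..n}. sc (of_nat (nat (n + 1) choose nat (m + 1))) (Y (L m v) (k + n - m) w)))"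

section \<open>Induced modules over Lie algebras\<close>

text \<open>
  Let \<open>g\<close> be a Lie algebra with scalar multiplication \<open>sg\<close> and bracket \<open>br\<close>, let \<open>B\<close> be a
  subalgebra, and let \<open>W\<close> be a \<open>B\<close>-module with scalar multiplication \<open>sw\<close> and action \<open>bact\<close>.
  The tensor product of \<open>U(g)\<close> and \<open>W\<close> over \<open>U(B)\<close> is presented as the free vector space on
  symbols \<open>(x\<^sub>1 \<dots> x\<^sub>k, w)\<close>, standing for \<open>x\<^sub>1 \<cdots> x\<^sub>k \<otimes> w\<close>, modulo multilinearity, the
  relations \<open>x y - y x = [x,y]\<close> of \<open>U(g)\<close>, and \<open>p b \<otimes> w = p \<otimes> b w\<close> for \<open>b \<in> B\<close>
  (which suffices since \<open>B\<close> generates \<open>U(B)\<close>).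
\<close>

abbreviation pure_tensor :: "'g list \<Rightarrow> 'w \<Rightarrow> ('g list \<times> 'w) \<Rightarrow>\<^sub>0 complex" where
  "pure_tensor p w \<equiv> Poly_Mapping.single (p, w) 1"

definition free_scale :: "complex \<Rightarrow> ('a \<Rightarrow>\<^sub>0 complex) \<Rightarrow> 'a \<Rightarrow>\<^sub>0 complex" where
  "free_scale c = Poly_Mapping.map ((*) c)"

definition induced_relations ::
  "(complex \<Rightarrow> 'g \<Rightarrow> 'g::ab_group_add) \<Rightarrow> ('g \<Rightarrow> 'g \<Rightarrow> 'g) \<Rightarrow> 'g set \<Rightarrow>
   (complex \<Rightarrow> 'w \<Rightarrow> 'w::ab_group_add) \<Rightarrow> ('g \<Rightarrow> 'w \<Rightarrow> 'w) \<Rightarrow>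
   (('g list \<times> 'w) \<Rightarrow>\<^sub>0 complex) set" where
  "induced_relations sg br B sw bact =
     {pure_tensor (p @ [x + y] @ q) w - pure_tensor (p @ [x] @ q) w
        - pure_tensor (p @ [y] @ q) w | p q x y w. True} \<union>
     {pure_tensor (p @ [sg c x] @ q) w - free_scale c (pure_tensor (p @ [x] @ q) w)
        | p q c x w. True} \<union>
     {pure_tensor p (v + w) - pure_tensor p v - pure_tensor p w | p v w. True} \<union>
     {pure_tensor p (sw c w) - free_scale c (pure_tensor p w) | p c w. True} \<union>
     {pure_tensor (p @ [x, y] @ q) w - pure_tensor (p @ [y, x] @ q) w
        - pure_tensor (p @ [br x y] @ q) w | p q x y w. True} \<union>
     {pure_tensor (p @ [b]) w - pure_tensor p (bact b w) | p b w. b \<in> B}"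

text \<open>
  \<open>is_induced_module sg br B sw bact sv act \<iota>\<close> says that the space \<open>'v\<close>, with action \<open>act\<close> of
  \<open>g\<close> and map \<open>\<iota> : W \<rightarrow> V\<close>, \<open>w \<mapsto> 1 \<otimes> w\<close>, is this quotient (up to isomorphism): the linear
  map sending \<open>(x\<^sub>1 \<dots> x\<^sub>k, w)\<close> to \<open>x\<^sub>1 (\<dots> (x\<^sub>k (\<iota> w)))\<close> is onto, and its kernel is the span
  of the relations.  The quotient is characterised rather than constructed, because
  it depends on the terms \<open>sg, br, \<dots>\<close> and so cannot be introduced as a type.
\<close>

definition tensor_eval ::
  "(complex \<Rightarrow> 'v \<Rightarrow> 'v::ab_group_add) \<Rightarrow> ('g \<Rightarrow> 'v \<Rightarrow> 'v) \<Rightarrow> ('w \<Rightarrow> 'v) \<Rightarrow>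
   (('g list \<times> 'w) \<Rightarrow>\<^sub>0 complex) \<Rightarrow> 'v" where
  "tensor_eval sv act \<iota> f =
     (\<Sum>(p, w)\<in>Poly_Mapping.keys f. sv (Poly_Mapping.lookup f (p, w)) (foldr act p (\<iota> w)))"

definition is_induced_module ::
  "(complex \<Rightarrow> 'g \<Rightarrow> 'g::ab_group_add) \<Rightarrow> ('g \<Rightarrow> 'g \<Rightarrow> 'g) \<Rightarrow> 'g set \<Rightarrow>
   (complex \<Rightarrow> 'w \<Rightarrow> 'w::ab_group_add) \<Rightarrow> ('g \<Rightarrow> 'w \<Rightarrow> 'w) \<Rightarrow>
   (complex \<Rightarrow> 'v \<Rightarrow> 'v::ab_group_add) \<Rightarrow> ('g \<Rightarrow> 'v \<Rightarrow> 'v) \<Rightarrow> ('w \<Rightarrow> 'v) \<Rightarrow> bool" where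
  "is_induced_module sg br B sw bact sv act \<iota> \<longleftrightarrow>
     vector_space sv \<and>
     (\<forall>x. Vector_Spaces.linear sv sv (act x)) \<and>
     range (tensor_eval sv act \<iota>) = UNIV \<and>
     {f. tensor_eval sv act \<iota> f = 0} =
       module.span free_scale (induced_relations sg br B sw bact)"

section \<open>The affinization of the current algebra and its module \<open>M(l)\<close>\<close>

definition orthonormal_basis_for ::
  "(complex \<Rightarrow> 'h \<Rightarrow> 'h::ab_group_add) \<Rightarrow> ('h \<Rightarrow> 'h \<Rightarrow> complex) \<Rightarrow> nat \<Rightarrow> (nat \<Rightarrow> 'h) \<Rightarrow> bool" where
  "orthonormal_basis_for sh form d u \<longleftrightarrow>
     inj_on u {1..d} \<and>
     \<not> module.dependent sh (u ` {1..d}) \<and>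
     module.span sh (u ` {1..d}) = UNIV \<and>
     (\<forall>i\<in>{1..d}. \<forall>j\<in>{1..d}. form (u i) (u j) = (if i = j then 1 else 0))"

definition nondegenerate_symmetric_form ::
  "(complex \<Rightarrow> 'h \<Rightarrow> 'h::ab_group_add) \<Rightarrow> ('h \<Rightarrow> 'h \<Rightarrow> complex) \<Rightarrow> bool" where
  "nondegenerate_symmetric_form sh form \<longleftrightarrow>
     (\<forall>x. Vector_Spaces.linear sh (*) (form x)) \<and>
     (\<forall>x y. form x y = form y x) \<and>
     (\<forall>x. (\<forall>y. form x y = 0) \<longrightarrow> x = 0)"

text \<open>
  \<open>h[t]\<close> is \<open>'h poly\<close>, with \<open>x t^j\<close> being \<open>monom x j\<close>.  A pair \<open>(f, c)\<close> in the affinization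
  is \<open>(\<Sum>n. f(n) \<otimes> s^n) + c \<^bold>k\<close>; the bracket is the bilinear extension of
  \<open>[x t^i \<otimes> s^m, y t^j \<otimes> s^n] = m \<langle>x,y\<rangle> \<delta>\<^bsub>m+n,0\<^esub> \<delta>\<^bsub>i,j\<^esub> \<^bold>k\<close>.
\<close>

type_synonym 'h affine = "(int \<Rightarrow>\<^sub>0 'h poly) \<times> complex"

definition affine_scale ::
  "(complex \<Rightarrow> 'h \<Rightarrow> 'h::ab_group_add) \<Rightarrow> complex \<Rightarrow> 'h affine \<Rightarrow> 'h affine" where
  "affine_scale sh c = map_prod (Poly_Mapping.map (map_poly (sh c))) ((*) c)"

definition affine_bracket ::
  "('h \<Rightarrow> 'h \<Rightarrow> complex) \<Rightarrow> 'h affine \<Rightarrow> 'h affine \<Rightarrow> 'h::ab_group_add affine" where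
  "affine_bracket form X Y =
     (0, \<Sum>m\<in>Poly_Mapping.keys (fst X). of_int m *
           (\<Sum>j\<le>degree (Poly_Mapping.lookup (fst X) m).
              form (coeff (Poly_Mapping.lookup (fst X) m) j)
                   (coeff (Poly_Mapping.lookup (fst Y) (- m)) j)))"

definition affine_nonneg :: "'h::ab_group_add affine set" where
  "affine_nonneg = {X. \<forall>m<0. Poly_Mapping.lookup (fst X) m = 0}"

definition is_M ::
  "(complex \<Rightarrow> 'h \<Rightarrow> 'h::ab_group_add) \<Rightarrow> ('h \<Rightarrow> 'h \<Rightarrow> complex) \<Rightarrow> complex \<Rightarrow>
   (complex \<Rightarrow> 'v \<Rightarrow> 'v::ab_group_add) \<Rightarrow> ('h affine \<Rightarrow> 'v \<Rightarrow> 'v) \<Rightarrow> 'v \<Rightarrow> bool" where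
  "is_M sh form l sv act vac \<longleftrightarrow>
     is_induced_module (affine_scale sh) (affine_bracket form) affine_nonneg
       (*) (\<lambda>X (z::complex). l * snd X * z)
       sv act (\<lambda>z. sv z vac)"

definition mode :: "('h::ab_group_add affine \<Rightarrow> 'v \<Rightarrow> 'v) \<Rightarrow> 'h poly \<Rightarrow> int \<Rightarrow> 'v \<Rightarrow> 'v" where
  "mode act a n = act (Poly_Mapping.single n a, 0)"

definition normal_ordered ::
  "('h::ab_group_add affine \<Rightarrow> 'v \<Rightarrow> 'v) \<Rightarrow> ('h poly \<times> int) list \<Rightarrow> 'v \<Rightarrow> 'v" where
  "normal_ordered act ops =
     foldr (\<lambda>(a, n). mode act a n)
       (filter (\<lambda>(a, n). n < 0) ops @ filter (\<lambda>(a, n). n \<ge> 0) ops)"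

text \<open>
  The coefficient of \<open>z^q\<close> in the normally ordered product of the fields
  \<open>1/(n-1)! (d/dz)^(n-1) a(z)\<close>, for \<open>(a, n)\<close> in the list \<open>xs\<close>, applied to \<open>w\<close>.  In a
  single such field the coefficient of \<open>z^p\<close> is \<open>binom(p+n-1, n-1) a(-p-n)\<close>; the sum is
  over all ways of writing \<open>q\<close> as a sum of exponents \<open>p\<close>, one for each factor, and only
  finitely many terms are nonzero on a given \<open>w\<close>.
\<close>

definition normal_ordered_field ::
  "(complex \<Rightarrow> 'v \<Rightarrow> 'v::ab_group_add) \<Rightarrow> ('h::ab_group_add affine \<Rightarrow> 'v \<Rightarrow> 'v) \<Rightarrow>
   ('h poly \<times> nat) list \<Rightarrow> int \<Rightarrow> 'v \<Rightarrow> 'v" where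
  "normal_ordered_field sv act xs q w =
     Sum_any (\<lambda>ps :: int list.
       if length ps = length xs \<and> sum_list ps = q
       then sv (prod_list (map2 (\<lambda>(a, n) p. of_int (p + int n - 1) gchoose (n - 1)) xs ps))
              (normal_ordered act (map2 (\<lambda>(a, n) p. (a, - p - int n)) xs ps) w)
       else 0)"

text \<open>
  The state-field map of \<open>M(l)\<close>, in modes: the unique map linear in the state and given
  by the normally ordered products on the vectors \<open>a\<^sub>1(-n\<^sub>1) \<dots> a\<^sub>k(-n\<^sub>k) \<one>\<close>, which span.
\<close>

definition M_Y ::
  "(complex \<Rightarrow> 'v \<Rightarrow> 'v::ab_group_add) \<Rightarrow> ('h::ab_group_add affine \<Rightarrow> 'v \<Rightarrow> 'v) \<Rightarrow> 'v \<Rightarrow>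
   'v \<Rightarrow> int \<Rightarrow> 'v \<Rightarrow> 'v" where
  "M_Y sv act vac =
     (THE Y. (\<forall>n w. Vector_Spaces.linear sv sv (\<lambda>v. Y v n w)) \<and>
        (\<forall>xs n w. (\<forall>(a, k)\<in>set xs. k \<ge> 1) \<longrightarrow>
           Y (foldr (\<lambda>(a, k). mode act a (- int k)) xs vac) n w =
           normal_ordered_field sv act xs (- n - 1) w))"

text \<open>On a given vector, and for \<open>n \<ge> -1\<close>, only finitely many \<open>j\<close> and \<open>m\<close> contribute.\<close>

definition M_L ::
  "complex \<Rightarrow> nat \<Rightarrow> (nat \<Rightarrow> 'h) \<Rightarrow>
   (complex \<Rightarrow> 'v \<Rightarrow> 'v::ab_group_add) \<Rightarrow> ('h::ab_group_add affine \<Rightarrow> 'v \<Rightarrow> 'v) \<Rightarrow>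
   int \<Rightarrow> 'v \<Rightarrow> 'v" where
  "M_L l d u sv act n w =
     sv (1 / (2 * l))
       (\<Sum>i\<in>{1..d}. Sum_any (\<lambda>j :: nat. Sum_any (\<lambda>m :: int.
          normal_ordered act [(monom (u i) j, n - m), (monom (u i) j, m)] w)))"

end

theory Submission
  imports Defs "HOL-Computational_Algebra.Formal_Power_Series" "HOL-Library.Function_Algebras"
begin

text \<open>
  The affinization acts on the space of all fields on \<open>M(l)\<close>: the mode \<open>a(n)\<close> sends \<open>A(z)\<close> to the
  \<open>n\<close>-th product of \<open>a(z)\<close> and \<open>A(z)\<close>.  The universal property of the induced module then yields a
  unique module map \<open>Y\<close> from \<open>M(l)\<close> to fields that sends the vacuum to the identity field, and on
  monomials \<open>Y\<close> is the normally ordered product.  So \<open>Y(a(n) v)\<close> is the \<open>n\<close>-th product of \<open>a(z)\<close>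
  and \<open>Y(v,z)\<close>, and the creation axiom, the commutator formula of \<open>a(m)\<close> with \<open>Y(v,z)\<close>, locality
  (Dong's lemma) and \<open>[L(n), Y(v,z)]\<close> all follow by induction on \<open>v\<close>.  About \<open>L(n)\<close> only
  \<open>[L(n), a(k)] = -k a(n+k)\<close> and \<open>L(n) \<one> = 0\<close> are used.  For instance,
  \<open>[L(m), L(n)] - (m - n) L(m+n)\<close> kills the vacuum and commutes with all modes, hence is zero;
  and \<open>L(-1) v = v\<^sub>-\<^sub>2 \<one>\<close> because \<open>Y(L(-1) v, z) = d/dz Y(v, z)\<close>.
\<close>

section \<open>Expansions of products of fields\<close>

text \<open>The natural candidate for a conformal vector, the sum of (u^(i) t^j)(-1)^2 applied to
  the vacuum, runs over all j and, for d > 0, is not an element of M(l). So the properties of L(n)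
  cannot be read off from the modes of that state; they have to come from the brackets with the
  generators.

  M(l) is known only through a presentation, so no basis of monomials is at hand. That
  \<open>Y\<close> is well defined rests on the bracket relation for n-th products, and that a(z) is
  a field rests on generation from the vacuum.

  Formal calculus is done coefficientwise: (y - z)^k A(y) B(z) is a family of operators with indices
  k, p, q. Keeping p next to q makes n-th products (p = 0) and locality (all p and q, large k) cases
  of one object, in which multiplication by y - z is a recursion in k. Identities between signed
  binomial coefficients then take the place of delta functions. On a fixed vector every sum is
  finite and its range can be enlarged freely; most of the bounds below serve to give several sums a
  common range.\<close>

definition neg_one_pow :: "int \<Rightarrow> complex" where
  "neg_one_pow k = (if even k then 1 else -1)"

lemma neg_one_pow_simps [simp]: "neg_one_pow 0 = 1" "neg_one_pow (k + 1) = - neg_one_pow k" "neg_one_pow k * neg_one_pow k = 1" "neg_one_pow (k - 1) = - neg_one_pow k"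
  "neg_one_pow k * (neg_one_pow k * x) = x"
  by (auto simp: neg_one_pow_def)

lemma neg_one_pow_add: "neg_one_pow (k + m) = neg_one_pow k * neg_one_pow m"
  by (auto simp: neg_one_pow_def)

lemma neg_one_pow_of_nat: "neg_one_pow (int n) = (-1) ^ n"
  by (simp add: neg_one_pow_def)

text \<open>The coefficient of y^(k-j) z^j in (y - z)^k, expanded in nonnegative powers of
  z.\<close>

definition signed_binomial :: "int \<Rightarrow> nat \<Rightarrow> complex" where
  "signed_binomial k j = (-1) ^ j * (of_int k gchoose j)"

lemma signed_binomial_0 [simp]: "signed_binomial k 0 = 1"
  by (simp add: signed_binomial_def)

lemma signed_binomial_Suc: "signed_binomial (k + 1) (Suc j) = signed_binomial k (Suc j) - signed_binomial k j"
  using gbinomial_Suc_Suc[of "of_int k :: complex" j] by (simp add: signed_binomial_def distrib_left add.commute)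

lemma signed_binomial_zero: "signed_binomial 0 j = (if j = 0 then 1 else 0)"
  by (simp add: signed_binomial_def gbinomial_0_left)

text \<open>Coefficient form of d/dy (y - z)^k = k (y - z)^(k-1).\<close>

lemma signed_binomial_absorb_comp: "(of_int k - of_nat j) * signed_binomial k j = of_int k * signed_binomial (k - 1) j"
  using gbinomial_absorb_comp[of "of_int k :: complex" j] by (simp add: signed_binomial_def mult.left_commute)

text \<open>Coefficient form of d/dz (y - z)^k = - k (y - z)^(k-1).\<close>

lemma signed_binomial_absorb: "of_nat (Suc j) * signed_binomial k (Suc j) = - (of_int k * signed_binomial (k - 1) j)"
  using gbinomial_absorption[of j "of_int k :: complex"]
  by (simp add: signed_binomial_def mult.left_commute)

section \<open>Linear maps, truncated fields and expansions\<close>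

locale complex_space = vector_space sc
  for sc :: "complex \<Rightarrow> 'v::ab_group_add \<Rightarrow> 'v"  (infixr "*s" 75)
begin

text \<open>An unfolded form of linearity for which closure properties are immediate;
  \<open>lin_iff_linear\<close> leads back to \<open>Vector_Spaces.linear\<close>.\<close>

definition lin :: "('v \<Rightarrow> 'v) \<Rightarrow> bool" where
  "lin f \<longleftrightarrow> (\<forall>x y. f (x + y) = f x + f y) \<and> (\<forall>c x. f (c *s x) = c *s f x)"

lemma lin_iff_linear: "lin f \<longleftrightarrow> Vector_Spaces.linear (*s) (*s) f"
  using vector_space_axioms module_axioms
  unfolding Vector_Spaces.linear_def module_hom_def module_hom_axioms_def lin_def by blast

lemma lin_add: "lin f \<Longrightarrow> f (x + y) = f x + f y"
  and lin_scale: "lin f \<Longrightarrow> f (c *s x) = c *s f x"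
  by (auto simp: lin_def)

lemma lin_zero: "lin f \<Longrightarrow> f 0 = 0"
  using lin_scale[of f 0 0] by simp

lemma lin_minus: "lin f \<Longrightarrow> f (- x) = - f x"
  using lin_scale[of f "-1" x] by simp

lemma lin_diff: "lin f \<Longrightarrow> f (x - y) = f x - f y"
  using lin_add[of f x "- y"] by (simp add: lin_minus)

lemma lin_sum: "lin f \<Longrightarrow> f (sum g S) = (\<Sum>x\<in>S. f (g x))"
  by (induct S rule: infinite_finite_induct) (auto simp: lin_zero lin_add)

lemmas lin_simps = lin_add lin_scale lin_zero lin_minus lin_diff

lemma lin_intros:
  "lin (\<lambda>w. w)" "lin (\<lambda>w. 0)"
  "lin f \<Longrightarrow> lin g \<Longrightarrow> lin (\<lambda>w. f w + g w)"
  "lin f \<Longrightarrow> lin g \<Longrightarrow> lin (\<lambda>w. f w - g w)"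
  "lin f \<Longrightarrow> lin (\<lambda>w. c *s f w)"
  by (auto simp: lin_def algebra_simps)

lemma lin_comp: "lin f \<Longrightarrow> lin g \<Longrightarrow> lin (\<lambda>w. f (g w))"
  by (auto simp: lin_def)

text \<open>Truncation makes A(z) w a formal Laurent series for each w, and it is what keeps the
  sums in \<open>expansion\<close> finite.\<close>

definition is_field :: "(int \<Rightarrow> 'v \<Rightarrow> 'v) \<Rightarrow> bool" where
  "is_field A \<longleftrightarrow> (\<forall>n. lin (A n)) \<and> (\<forall>w. \<exists>N. \<forall>n\<ge>N. A n w = 0)"

lemma is_field_lin: "is_field A \<Longrightarrow> lin (A n)"
  by (simp add: is_field_def)

lemma is_field_bound:
  assumes "is_field A" obtains N :: nat where "\<forall>n\<ge>q + int N. A n w = 0"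
proof -
  obtain N where "\<forall>n\<ge>N. A n w = 0" using assms unfolding is_field_def by blast
  then have "\<forall>n\<ge>q + int (nat (N - q)). A n w = 0" by auto
  then show ?thesis using that by blast
qed

lemma is_field_bound2:
  assumes "is_field A" "is_field B"
  obtains N :: nat where "\<forall>n\<ge>q + int N. A n w = 0" "\<forall>n\<ge>q' + int N. B n w' = 0"
proof -
  obtain N where N: "\<forall>n\<ge>q + int N. A n w = 0" using is_field_bound[OF assms(1)] by blast
  obtain M where M: "\<forall>n\<ge>q' + int M. B n w' = 0" using is_field_bound[OF assms(2)] by blast
  show ?thesis using that[of "max N M"] N M by force
qed

lemma is_field_zero: "is_field (\<lambda>n w. 0)"
  by (auto simp: is_field_def intro: lin_intros)

lemma is_field_add: "is_field A \<Longrightarrow> is_field B \<Longrightarrow> is_field (\<lambda>n w. A n w + B n w)"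
proof -
  assume *: "is_field A" "is_field B"
  have "\<exists>N. \<forall>n\<ge>N. A n w + B n w = 0" for w
  proof -
    obtain N M where "\<forall>n\<ge>N. A n w = 0" "\<forall>n\<ge>M. B n w = 0" using * unfolding is_field_def by blast
    then show ?thesis by (intro exI[of _ "max N M"]) auto
  qed
  with * show ?thesis by (auto simp: is_field_def intro: lin_intros)
qed

lemma is_field_scale: 
  assumes "is_field A" shows "is_field (\<lambda>n w. c n *s A (n + t) w)"
proof -
  have "\<exists>N. \<forall>n\<ge>N. c n *s A (n + t) w = 0" for w
  proof -
    obtain N where "\<forall>n\<ge>N. A n w = 0" using assms unfolding is_field_def by blast
    then show ?thesis by (intro exI[of _ "N - t"]) auto
  qed
  with assms show ?thesis by (auto simp: is_field_def intro: lin_intros)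
qed

lemma is_field_cmult: "is_field A \<Longrightarrow> is_field (\<lambda>n w. c *s A n w)"
  using is_field_scale[of A "\<lambda>_. c" 0] by simp

lemma is_field_diff: "is_field A \<Longrightarrow> is_field B \<Longrightarrow> is_field (\<lambda>n w. A n w - B n w)"
  using is_field_add[of A "\<lambda>n w. (-1) *s B n w"] is_field_cmult[of B "-1"] by simp

lemma is_field_sum: "(\<And>i. i \<in> S \<Longrightarrow> is_field (f i)) \<Longrightarrow> is_field (\<lambda>n w. \<Sum>i\<in>S. f i n w)"
  by (induct S rule: infinite_finite_induct) (simp_all add: is_field_zero is_field_add)

lemma is_field_comp:
  assumes "is_field A" "lin L" shows "is_field (\<lambda>n w. L (A n w))" "is_field (\<lambda>n w. A n (L w))"
proof -
  have "\<exists>N. \<forall>n\<ge>N. L (A n w) = 0" for w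
  proof -
    obtain N where "\<forall>n\<ge>N. A n w = 0" using assms unfolding is_field_def by blast
    then show ?thesis using lin_zero[OF assms(2)] by (intro exI[of _ N]) simp
  qed
  then show "is_field (\<lambda>n w. L (A n w))" "is_field (\<lambda>n w. A n (L w))"
    using assms lin_comp[OF assms(2)] lin_comp[OF _ assms(2)] by (simp_all add: is_field_def)
qed

lemma is_field_comm:
  assumes "is_field A" "lin L" shows "is_field (\<lambda>n w. L (A n w) - A n (L w))"
  by (rule is_field_diff[OF is_field_comp[OF assms]])

text \<open>The coefficient of \<open>y^(-p-1) z^(-q-1)\<close> in \<open>(y - z)^k A(y) B(z)\<close>, expanded in
  nonnegative powers of \<open>z\<close>.\<close>

definition expansion :: "(int \<Rightarrow> 'v \<Rightarrow> 'v) \<Rightarrow> (int \<Rightarrow> 'v \<Rightarrow> 'v) \<Rightarrow> int \<Rightarrow> int \<Rightarrow> int \<Rightarrow> 'v \<Rightarrow> 'v" where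
  "expansion A B k p q w = Sum_any (\<lambda>j::nat. signed_binomial k j *s A (p + k - int j) (B (q + int j) w))"

text \<open>Any \<open>N\<close> beyond the truncation bound may be taken, so different expansions
  can be written over the same range.\<close>

lemma expansion_sum:
  assumes "\<And>n. A n 0 = 0" "\<forall>n\<ge>q + int N. B n w = 0"
  shows "expansion A B k p q w = (\<Sum>j<N. signed_binomial k j *s A (p + k - int j) (B (q + int j) w))"
proof -
  have "signed_binomial k j *s A (p + k - int j) (B (q + int j) w) = 0" if "\<not> j < N" for j
    using assms that by simp
  then show ?thesis
    unfolding expansion_def by (intro Sum_any.expand_superset) auto
qed

lemma expansion_sum':
  assumes "is_field A" "\<forall>n\<ge>q + int N. B n w = 0"
  shows "expansion A B k p q w = (\<Sum>j<N. signed_binomial k j *s A (p + k - int j) (B (q + int j) w))"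
  by (rule expansion_sum) (use assms in \<open>auto simp: lin_zero is_field_lin\<close>)

lemma expansion_zero_power: "is_field A \<Longrightarrow> is_field B \<Longrightarrow> expansion A B 0 p q w = A p (B q w)"
  unfolding expansion_def by (subst Sum_any.expand_superset[of "{0}"]) (auto simp: signed_binomial_zero)

text \<open>Multiplication by y - z: a factor y raises p by one, a factor z raises q by one.\<close>

lemma expansion_rec:
  assumes "is_field A" "is_field B"
  shows "expansion A B (k + 1) p q w = expansion A B k (p + 1) q w - expansion A B k p (q + 1) w"
proof -
  obtain N where N: "\<forall>n\<ge>q + int N. B n w = 0" using is_field_bound[OF assms(2)] by blast
  \<comment> \<open>One more term is used at q than at q + 1, so that after splitting off j = 0 the
    ranges agree and Pascal's rule applies termwise.\<close>
  have N': "\<forall>n\<ge>q + int (Suc N). B n w = 0" "\<forall>n\<ge>(q + 1) + int N. B n w = 0"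
    using N by auto
  show ?thesis
    unfolding expansion_sum'[of A q "Suc N" B w, OF assms(1) N'(1)] expansion_sum'[of A "q + 1" N B w, OF assms(1) N'(2)]
    unfolding sum.lessThan_Suc_shift signed_binomial_Suc scale_left_diff_distrib sum_subtractf
    by (simp add: algebra_simps)
qed


lemma expansion_lin:
  assumes "is_field A" "is_field B"
  shows "lin (expansion A B k p q)"
  unfolding lin_def
proof (intro conjI allI)
  fix x y c
  obtain N where N: "\<forall>n\<ge>q + int N. B n x = 0" "\<forall>n\<ge>q + int N. B n y = 0"
    using is_field_bound2[OF assms(2,2)] by blast
  note B = is_field_lin[OF assms(2)] and A = is_field_lin[OF assms(1)]
  have 1: "\<forall>n\<ge>q + int N. B n (x + y) = 0" and 2: "\<forall>n\<ge>q + int N. B n (c *s x) = 0"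
    using N by (auto simp: lin_simps[OF B])
  note S = expansion_sum'[OF assms(1), of q N B]
  show "expansion A B k p q (x + y) = expansion A B k p q x + expansion A B k p q y"
    unfolding S[OF 1] S[OF N(1)] S[OF N(2)]
    by (simp add: lin_simps[OF B] lin_simps[OF A] scale_right_distrib sum.distrib)
  show "expansion A B k p q (c *s x) = c *s expansion A B k p q x"
    unfolding S[OF 2] S[OF N(1)]
    by (simp add: lin_simps[OF B] lin_simps[OF A] scale_sum_right mult.commute)
qed

lemma is_field_expansion_right:
  assumes "is_field A" "is_field B"
  shows "is_field (\<lambda>q. expansion A B k p (q + t))"
proof -
  have "\<exists>N. \<forall>n\<ge>N. expansion A B k p (n + t) w = 0" for w
  proof -
    obtain N where N: "\<forall>n\<ge>0 + int N. B n w = 0" using is_field_bound[OF assms(2)] by blast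
    have "expansion A B k p (n + t) w = 0" if "n \<ge> int N - t" for n
      using expansion_sum'[OF assms(1), of "n + t" 0 B w] N that by simp
    then show ?thesis by blast
  qed
  then show ?thesis using expansion_lin[OF assms] by (simp add: is_field_def)
qed

lemma ex_common_bound:
  fixes P :: "'i \<Rightarrow> int \<Rightarrow> bool"
  assumes "finite S" "\<And>i. i \<in> S \<Longrightarrow> \<exists>N. \<forall>n\<ge>N. P i n"
  shows "\<exists>N. \<forall>i\<in>S. \<forall>n\<ge>N. P i n"
proof -
  have "eventually (\<lambda>n. \<forall>i\<in>S. P i n) at_top"
    using assms by (intro eventually_ball_finite) (auto simp: eventually_at_top_linorder)
  then show ?thesis by (auto simp: eventually_at_top_linorder)
qed

text \<open>Truncation of \<open>B\<close> leaves finitely many vectors B(q+j) w, and one bound for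
  the modes of \<open>A\<close> serves them all.\<close>

lemma is_field_expansion_left:
  assumes "is_field A" "is_field B"
  shows "is_field (\<lambda>p. expansion A B k (p + t) q)"
proof -
  have "\<exists>N. \<forall>n\<ge>N. expansion A B k (n + t) q w = 0" for w
  proof -
    obtain N where N: "\<forall>n\<ge>q + int N. B n w = 0" using is_field_bound[OF assms(2)] by blast
    have "\<exists>M. \<forall>j\<in>{..<N}. \<forall>n\<ge>M. A n (B (q + int j) w) = 0"
      using assms(1) by (intro ex_common_bound) (auto simp: is_field_def)
    then obtain M where M: "\<And>j n. j < N \<Longrightarrow> n \<ge> M \<Longrightarrow> A n (B (q + int j) w) = 0" by blast
    have "expansion A B k (n + t) q w = 0" if "n \<ge> M - k - t + int N" for n
      unfolding expansion_sum'[OF assms(1), of q N B w, OF N] using that by (intro sum.neutral) (simp add: M)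
    then show ?thesis by blast
  qed
  then show ?thesis using expansion_lin[OF assms] by (simp add: is_field_def)
qed

lemma expansion_shift_left: "expansion (\<lambda>n. A (n + t)) B k p q w = expansion A B k (p + t) q w"
  by (simp add: expansion_def algebra_simps)

lemma expansion_shift_right: "expansion A (\<lambda>n. B (n + t)) k p q w = expansion A B k p (q + t) w"
  by (simp add: expansion_def algebra_simps)

lemma expansion_zero_left: "expansion (\<lambda>n w. 0) B k p q w = 0"
  by (simp add: expansion_def)

lemma expansion_zero_right: "is_field A \<Longrightarrow> expansion A (\<lambda>n w. 0) k p q w = 0"
  by (simp add: expansion_def lin_zero is_field_lin)

lemma expansion_scale_left:
  assumes "is_field A" "is_field B"
  shows "expansion (\<lambda>n w. c *s A n w) B k p q w = c *s expansion A B k p q w"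
proof -
  obtain N where N: "\<forall>n\<ge>q + int N. B n w = 0" using is_field_bound[OF assms(2)] by blast
  show ?thesis
    unfolding expansion_sum'[OF assms(1), of q N B w, OF N] expansion_sum'[OF is_field_cmult[OF assms(1)], of q N B w, OF N]
    by (simp add: scale_sum_right mult.commute)
qed

lemma expansion_scale_right:
  assumes "is_field A" "is_field B"
  shows "expansion A (\<lambda>n w. c *s B n w) k p q w = c *s expansion A B k p q w"
proof -
  obtain N where N: "\<forall>n\<ge>q + int N. B n w = 0" using is_field_bound[OF assms(2)] by blast
  then have N': "\<forall>n\<ge>q + int N. c *s B n w = 0" by simp
  show ?thesis
    unfolding expansion_sum'[OF assms(1), of q N B w, OF N]
      expansion_sum'[OF assms(1), of q N "\<lambda>n w. c *s B n w" w, OF N']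
    by (simp add: scale_sum_right mult.commute lin_scale[OF is_field_lin[OF assms(1)]])
qed

lemma expansion_add_left:
  assumes "is_field A" "is_field A'" "is_field B"
  shows "expansion (\<lambda>n w. A n w + A' n w) B k p q w = expansion A B k p q w + expansion A' B k p q w"
proof -
  obtain N where N: "\<forall>n\<ge>q + int N. B n w = 0" using is_field_bound[OF assms(3)] by blast
  show ?thesis
    unfolding expansion_sum'[OF assms(1), of q N B w, OF N] expansion_sum'[OF assms(2), of q N B w, OF N] 
      expansion_sum'[OF is_field_add[OF assms(1,2)], of q N B w, OF N]
    by (simp add: scale_right_distrib sum.distrib)
qed

lemma expansion_add_right:
  assumes "is_field A" "is_field B" "is_field B'"
  shows "expansion A (\<lambda>n w. B n w + B' n w) k p q w = expansion A B k p q w + expansion A B' k p q w"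
proof -
  obtain N where N: "\<forall>n\<ge>q + int N. B n w = 0" "\<forall>n\<ge>q + int N. B' n w = 0"
    using is_field_bound2[OF assms(2,3)] by blast
  then have N': "\<forall>n\<ge>q + int N. B n w + B' n w = 0" by simp
  show ?thesis
    unfolding expansion_sum'[OF assms(1), of q N B w, OF N(1)] expansion_sum'[OF assms(1), of q N B' w, OF N(2)] 
      expansion_sum'[OF assms(1), of q N "\<lambda>n w. B n w + B' n w" w, OF N']
    by (simp add: scale_right_distrib sum.distrib lin_add[OF is_field_lin[OF assms(1)]])
qed

lemma expansion_diff_left:
  assumes "is_field A" "is_field A'" "is_field B"
  shows "expansion (\<lambda>n w. A n w - A' n w) B k p q w = expansion A B k p q w - expansion A' B k p q w"
  using expansion_add_left[OF assms(1) is_field_cmult[OF assms(2), of "-1"] assms(3)]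
    expansion_scale_left[OF assms(2,3), of "-1"] by simp

lemma expansion_diff_right:
  assumes "is_field A" "is_field B" "is_field B'"
  shows "expansion A (\<lambda>n w. B n w - B' n w) k p q w = expansion A B k p q w - expansion A B' k p q w"
  using expansion_add_right[OF assms(1,2) is_field_cmult[OF assms(3), of "-1"]]
    expansion_scale_right[OF assms(1,3), of "-1"] by simp

lemma expansion_sum_left:
  assumes "\<And>i. i \<in> S \<Longrightarrow> is_field (A i)" "is_field B"
  shows "expansion (\<lambda>n w. \<Sum>i\<in>S. A i n w) B k p q w = (\<Sum>i\<in>S. expansion (A i) B k p q w)"
  using assms by (induct S rule: infinite_finite_induct)
    (simp_all add: expansion_zero_left expansion_add_left is_field_sum)

lemma expansion_sum_right:
  assumes "\<And>i. i \<in> S \<Longrightarrow> is_field (B i)" "is_field A"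
  shows "expansion A (\<lambda>n w. \<Sum>i\<in>S. B i n w) k p q w = (\<Sum>i\<in>S. expansion A (B i) k p q w)"
  using assms by (induct S rule: infinite_finite_induct)
    (simp_all add: expansion_zero_right expansion_add_right is_field_sum)

text \<open>Leibniz rule: the commutator with \<open>L\<close> is a derivation of each product A(r)
  B(s).\<close>

lemma expansion_comm:
  assumes "lin L" "is_field A" "is_field B"
  shows "L (expansion A B k p q w) - expansion A B k p q (L w) =
    expansion (\<lambda>n w. L (A n w) - A n (L w)) B k p q w + expansion A (\<lambda>n w. L (B n w) - B n (L w)) k p q w"
proof -
  obtain N where N: "\<forall>n\<ge>q + int N. B n w = 0" "\<forall>n\<ge>q + int N. B n (L w) = 0"
    using is_field_bound2[OF assms(3,3)] by blast
  then have N': "\<forall>n\<ge>q + int N. L (B n w) - B n (L w) = 0" by (simp add: lin_zero[OF assms(1)])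
  note A = is_field_lin[OF assms(2)]
  show ?thesis
    unfolding expansion_sum'[OF assms(2), of q N B w, OF N(1)] expansion_sum'[OF assms(2), of q N B "L w", OF N(2)]
      expansion_sum'[OF is_field_comm[OF assms(2,1)], of q N B w, OF N(1)]
      expansion_sum'[OF assms(2), of q N "\<lambda>n w. L (B n w) - B n (L w)" w, OF N']
    by (simp add: lin_sum[OF assms(1)] lin_simps[OF assms(1)] lin_simps[OF A] scale_right_diff_distrib
        flip: sum_subtractf sum.distrib)
qed

text \<open>In the j-th summand n - p equals k - j, so the weight differentiates (y - z)^k with
  respect to y. In the companion lemma for \<open>B\<close> the weight n - q equals j and stands for
  d/dz.\<close>

lemma expansion_weight_left:
  assumes "is_field A" "is_field B"
  shows "expansion (\<lambda>n w. of_int (n - p) *s A n w) B k p q w = of_int k *s expansion A B (k - 1) (p + 1) q w"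
proof -
  obtain N where N: "\<forall>n\<ge>q + int N. B n w = 0" using is_field_bound[OF assms(2)] by blast
  have *: "signed_binomial k j * of_int (p + k - int j - p) = of_int k * signed_binomial (k - 1) j" for j
    using signed_binomial_absorb_comp[of k j] by (simp add: mult.commute)
  have **: "p + 1 + (k - 1) - int j = p + k - int j" for j by simp
  show ?thesis
    unfolding expansion_sum'[OF assms(1), of q N B w, OF N]
      expansion_sum'[OF is_field_scale[OF assms(1), of _ 0, simplified], of q N B w, OF N]
    unfolding scale_sum_right scale_scale * ** ..
qed

lemma expansion_weight_right:
  assumes "is_field A" "is_field B"
  shows "expansion A (\<lambda>n w. of_int (n - q) *s B n w) k p q w = - (of_int k *s expansion A B (k - 1) p (q + 1) w)"
proof -
  obtain N where N: "\<forall>n\<ge>(q + 1) + int N. B n w = 0" using is_field_bound[OF assms(2)] by blast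
  \<comment> \<open>One term more than at q + 1: the weight kills the term j = 0, and the others
    move down by one.\<close>
  then have N': "\<forall>n\<ge>q + int (Suc N). of_int (n - q) *s B n w = 0" by simp
  have *: "signed_binomial k (Suc j) * of_int (q + int (Suc j) - q) = - of_int k * signed_binomial (k - 1) j" for j
    using signed_binomial_absorb[of j k] by (simp add: algebra_simps)
  have **: "p + (k - 1) - int j = p + k - int (Suc j)" "q + 1 + int j = q + int (Suc j)" for j by simp_all
  show ?thesis
    unfolding expansion_sum'[OF assms(1), of "q + 1" N B w, OF N]
      expansion_sum'[OF assms(1), of q "Suc N" "\<lambda>n w. of_int (n - q) *s B n w" w, OF N']
      sum.lessThan_Suc_shift
    unfolding scale_sum_right scale_scale lin_scale[OF is_field_lin[OF assms(1)]] * **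
    by (simp add: lin_simps[OF is_field_lin[OF assms(1)]] sum_negf)
qed

end

lemma signed_binomial_of_nat: "signed_binomial (int N) i = (-1) ^ i * of_nat (N choose i)"
  by (simp add: signed_binomial_def binomial_gbinomial)

text \<open>Coefficient comparison in (y - z)^m (y - z)^n = (y - z)^(m+n).\<close>

lemma signed_binomial_Vandermonde: "(\<Sum>j\<le>s. signed_binomial m j * signed_binomial n (s - j)) = signed_binomial (m + n) s"
proof -
  have "signed_binomial m j * signed_binomial n (s - j) = (-1) ^ s * ((of_int m gchoose j) * (of_int n gchoose (s - j)))"
    if "j \<le> s" for j
  proof -
    have "(-1::complex) ^ j * (-1) ^ (s - j) = (-1) ^ s"
      using that by (simp flip: power_add)
    then show ?thesis by (simp add: signed_binomial_def mult.assoc mult.left_commute)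
  qed
  then have "(\<Sum>j\<le>s. signed_binomial m j * signed_binomial n (s - j)) =
      (-1) ^ s * (\<Sum>j\<le>s. (of_int m gchoose j) * (of_int n gchoose (s - j)))"
    by (simp add: sum_distrib_left)
  then show ?thesis
    using gbinomial_Vandermonde[of "of_int m :: complex" "of_int n" s]
    by (simp add: signed_binomial_def atMost_atLeast0)
qed

text \<open>For s > 0 a polynomial of degree s - 1 has no term z^s. This is what makes the central
  terms vanish off m + n = 0 in \<open>expansion_left_commute\<close>.\<close>

lemma signed_binomial_pred_self: "signed_binomial (int s - 1) s = (if s = 0 then 1 else 0)"
proof (cases s)
  case (Suc n)
  then show ?thesis using signed_binomial_of_nat[of n s] by (simp add: binomial_eq_0)
qed simp

section \<open>n-th products and their commutation relations\<close>

context complex_space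
begin

text \<open>The coefficient of \<open>y^(-p-1) z^(-q-1)\<close> in
  \<open>(y - z)^k A(y) B(z) - (-z + y)^k B(z) A(y)\<close>, each power being expanded in the second
  variable of the binomial; for \<open>p = 0\<close> it is the mode \<open>q\<close> of the \<open>k\<close>-th product of \<open>A\<close> and \<open>B\<close>,
  and \<open>A\<close>, \<open>B\<close> are mutually local iff it vanishes for all large \<open>k\<close>.\<close>

definition nth_product :: "(int \<Rightarrow> 'v \<Rightarrow> 'v) \<Rightarrow> (int \<Rightarrow> 'v \<Rightarrow> 'v) \<Rightarrow> int \<Rightarrow> int \<Rightarrow> int \<Rightarrow> 'v \<Rightarrow> 'v" where
  "nth_product A B k p q w = expansion A B k p q w - neg_one_pow k *s expansion B A k q p w"

lemma nth_product_swap: "nth_product A B k p q w = - (neg_one_pow k *s nth_product B A k q p w)"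
  by (simp add: nth_product_def scale_right_diff_distrib)

lemma nth_product_zero_power:
  "is_field A \<Longrightarrow> is_field B \<Longrightarrow> nth_product A B 0 p q w = A p (B q w) - B q (A p w)"
  by (simp add: nth_product_def expansion_zero_power)

lemma nth_product_rec:
  assumes "is_field A" "is_field B"
  shows "nth_product A B (k + 1) p q w = nth_product A B k (p + 1) q w - nth_product A B k p (q + 1) w"
  unfolding nth_product_def expansion_rec[OF assms] expansion_rec[OF assms(2,1)] neg_one_pow_simps
  by (simp add: scale_right_diff_distrib)

lemma is_field_nth_product:
  assumes "is_field A" "is_field B" shows "is_field (\<lambda>q. nth_product A B k p q)"
  using is_field_diff[OF is_field_expansion_right[OF assms, of k p 0]
      is_field_cmult[OF is_field_expansion_left[OF assms(2,1), of k 0 p], of "neg_one_pow k"]]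
  by (simp add: nth_product_def[abs_def])

text \<open>Binomial expansion of y^r = (z + (y - z))^r: the power of y - z raises k, the power of z
  raises q.\<close>

lemma nth_product_expand:
  assumes "is_field A" "is_field B"
  shows "nth_product A B k (p + int r) q w =
    (\<Sum>i\<le>r. of_nat (r choose i) *s nth_product A B (k + int i) p (q + int r - int i) w)"
proof (induction r arbitrary: k q)
  case (Suc r)
  have "nth_product A B k (p + int (Suc r)) q w =
      nth_product A B (k + 1) (p + int r) q w + nth_product A B k (p + int r) (q + 1) w"
    using nth_product_rec[OF assms, of k "p + int r" q w] by (simp add: algebra_simps)
  also have "\<dots> = (\<Sum>i\<le>r. of_nat (r choose i) *s nth_product A B (k + int (Suc i)) p (q + int (Suc r) - int (Suc i)) w)
      + (\<Sum>i\<le>Suc r. of_nat (r choose i) *s nth_product A B (k + int i) p (q + int (Suc r) - int i) w)"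
    unfolding Suc.IH by (simp add: algebra_simps)
  also have "\<dots> = (\<Sum>i\<le>Suc r. of_nat (Suc r choose i) *s nth_product A B (k + int i) p (q + int (Suc r) - int i) w)"
    unfolding sum.atMost_Suc_shift
    by (simp add: scale_left_distrib sum.distrib)
  finally show ?case .
qed simp

lemma expansion_of_nat:
  assumes "is_field A" "is_field B"
  shows "expansion A B (int N) p q w =
    (\<Sum>i\<le>N. ((-1) ^ i * of_nat (N choose i)) *s A (p + int (N - i)) (B (q + int i) w))"
proof -
  have "expansion A B (int N) p q w = (\<Sum>i\<le>N. signed_binomial (int N) i *s A (p + int N - int i) (B (q + int i) w))"
    unfolding expansion_def by (rule Sum_any.expand_superset) (auto simp: signed_binomial_of_nat intro: ccontr)
  then show ?thesis by (simp add: signed_binomial_of_nat of_nat_diff algebra_simps)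
qed

text \<open>For an exponent N >= 0 both expansions are the same polynomial, so the difference is (y
  - z)^N [A(y), B(z)], the expression in the locality axiom.\<close>

lemma nth_product_of_nat:
  assumes "is_field A" "is_field B"
  shows "nth_product A B (int N) p q w =
    (\<Sum>i\<le>N. ((-1) ^ i * of_nat (N choose i)) *s
      (A (p + int (N - i)) (B (q + int i) w) - B (q + int i) (A (p + int (N - i)) w)))"
proof -
  have "expansion B A (int N) q p w =
      (\<Sum>i\<le>N. ((-1) ^ (N - i) * of_nat (N choose (N - i))) *s B (q + int (N - (N - i))) (A (p + int (N - i)) w))"
    unfolding expansion_of_nat[OF assms(2,1)]
    by (rule sum.reindex_bij_witness[of _ "\<lambda>i. N - i" "\<lambda>i. N - i"]) auto
  also have "\<dots> = (\<Sum>i\<le>N. ((-1) ^ N * (-1) ^ i * of_nat (N choose i)) *s B (q + int i) (A (p + int (N - i)) w))"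
  proof (rule sum.cong)
    fix i assume "i \<in> {..N}"
    then have "(-1::complex) ^ (N - i) = (-1) ^ N * (-1) ^ i" "N choose (N - i) = N choose i" "N - (N - i) = i"
      by (auto simp: binomial_symmetric[symmetric] minus_one_power_iff)
    then show "((-1) ^ (N - i) * of_nat (N choose (N - i))) *s B (q + int (N - (N - i))) (A (p + int (N - i)) w)
      = ((-1) ^ N * (-1) ^ i * of_nat (N choose i)) *s B (q + int i) (A (p + int (N - i)) w)" by simp
  qed simp
  moreover have "(-1::complex) ^ N * ((-1) ^ N * x) = x" for x
    by (simp add: minus_one_power_iff)
  ultimately have "neg_one_pow (int N) *s expansion B A (int N) q p w =
    (\<Sum>i\<le>N. ((-1) ^ i * of_nat (N choose i)) *s B (q + int i) (A (p + int (N - i)) w))"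
    by (simp add: neg_one_pow_of_nat scale_sum_right mult.assoc)
  then show ?thesis
    unfolding nth_product_def expansion_of_nat[OF assms] by (simp add: scale_right_diff_distrib sum_subtractf)
qed

lemma ex_common_bound_nat:
  assumes "finite S" "\<And>i. i \<in> S \<Longrightarrow> is_field (A i)"
  obtains N :: nat where "\<And>i. i \<in> S \<Longrightarrow> \<forall>n\<ge>r i + int N. A i n (x i) = 0" "N \<ge> M"
proof -
  have "\<exists>N. \<forall>i\<in>S. \<forall>n\<ge>N. A i (r i + n) (x i) = 0"
  proof (rule ex_common_bound[OF assms(1)])
    fix i assume "i \<in> S"
    then obtain N where "\<forall>n\<ge>N. A i n (x i) = 0" using assms(2) unfolding is_field_def by blast
    then show "\<exists>N. \<forall>n\<ge>N. A i (r i + n) (x i) = 0" by (intro exI[of _ "N - r i"]) simp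
  qed
  then obtain N where N: "\<And>i n. i \<in> S \<Longrightarrow> n \<ge> N \<Longrightarrow> A i (r i + n) (x i) = 0" by blast
  show ?thesis
  proof (rule that[of "max M (nat N)"])
    fix i assume i: "i \<in> S"
    show "\<forall>n\<ge>r i + int (max M (nat N)). A i n (x i) = 0"
    proof (intro allI impI)
      fix n assume "n \<ge> r i + int (max M (nat N))"
      then show "A i n (x i) = 0" using N[OF i, of "n - r i"] by simp
    qed
  qed simp
qed

text \<open>The operators stand in the order B, A, C on both sides, and each binomial joins
  \<open>A\<close> to one neighbour; only two finite summations are interchanged.\<close>

lemma expansion_assoc:
  assumes "is_field A" "is_field B" "is_field C"
  shows "expansion (\<lambda>r. expansion B A n s r) C m q t w = expansion B (\<lambda>r. expansion A C m r t) n s q w"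
proof -
  obtain J where J: "\<forall>n\<ge>t + int J. C n w = 0" using is_field_bound[OF assms(3)] by blast
  obtain N where N: "\<And>j. j \<in> {..<J} \<Longrightarrow> \<forall>n\<ge>q + m - int j + int N. A n (C (t + int j) w) = 0"
    using ex_common_bound_nat[of "{..<J}" "\<lambda>_. A" "\<lambda>j. q + m - int j" "\<lambda>j. C (t + int j) w" 0] assms(1)
    by auto
  have 1: "expansion A C m r t w = (\<Sum>j<J. signed_binomial m j *s A (r + m - int j) (C (t + int j) w))" for r
    by (rule expansion_sum'[of A t J C w, OF assms(1) J])
  have 2: "\<forall>r\<ge>q + int N. expansion A C m r t w = 0"
    unfolding 1 using N by (auto intro!: sum.neutral)
  have "expansion (\<lambda>r. expansion B A n s r) C m q t w
      = (\<Sum>j<J. signed_binomial m j *s expansion B A n s (q + m - int j) (C (t + int j) w))"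
    using is_field_expansion_right[OF assms(2,1), of n s 0] J by (intro expansion_sum') auto
  also have "\<dots> = (\<Sum>j<J. signed_binomial m j *s (\<Sum>i<N. signed_binomial n i *s B (s + n - int i) (A (q + m - int j + int i) (C (t + int j) w))))"
    by (intro sum.cong arg_cong2[of _ _ _ _ "(*s)"] refl expansion_sum' assms N)
  also have "\<dots> = (\<Sum>i<N. signed_binomial n i *s B (s + n - int i) (\<Sum>j<J. signed_binomial m j *s A (q + int i + m - int j) (C (t + int j) w)))"
    unfolding lin_sum[OF is_field_lin[OF assms(2)]] scale_sum_right lin_scale[OF is_field_lin[OF assms(2)]] scale_scale
    by (subst sum.swap) (simp add: mult.commute algebra_simps)
  also have "\<dots> = expansion B (\<lambda>r. expansion A C m r t) n s q w"
    unfolding expansion_sum'[OF assms(2), of q N "\<lambda>r. expansion A C m r t" w, OF 2] 1 ..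
  finally show ?thesis .
qed

lemma expansion_nested_left:
  assumes "is_field a" "is_field b" "is_field A" "\<forall>n\<ge>q + int N. A n w = 0"
  shows "expansion a (\<lambda>r. expansion b A n 0 r) m 0 q w =
    (\<Sum>j<N. \<Sum>i<N. (signed_binomial m j * signed_binomial n i) *s a (m - int j) (b (n - int i) (A (q + int j + int i) w)))"
proof -
  have 1: "expansion b A n 0 (q + int j) w = (\<Sum>i<N. signed_binomial n i *s b (n - int i) (A (q + int j + int i) w))" for j
    using expansion_sum'[of b "q + int j" N A w n 0] assms by simp
  have 2: "\<forall>r\<ge>q + int N. expansion b A n 0 r w = 0"
    using expansion_sum'[of b _ 0 A w n 0] assms by simp
  show ?thesis
    unfolding expansion_sum'[OF assms(1), of q N "\<lambda>r. expansion b A n 0 r" w, OF 2] 1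
    by (simp add: lin_sum[OF is_field_lin[OF assms(1)]] scale_sum_right lin_scale[OF is_field_lin[OF assms(1)]])
qed

lemma expansion_nested_right:
  assumes "is_field a" "is_field b" "is_field A"
    "\<forall>n\<ge>0 + int N. a n w = 0" "\<And>j. \<forall>n\<ge>0 + int N. b n (a (int j) w) = 0"
  shows "expansion (\<lambda>r. expansion A b n r 0) a m q 0 w =
    (\<Sum>j<N. \<Sum>i<N. (signed_binomial m j * signed_binomial n i) *s A (q + m + n - int j - int i) (b (int i) (a (int j) w)))"
proof -
  have "expansion (\<lambda>r. expansion A b n r 0) a m q 0 w = (\<Sum>j<N. signed_binomial m j *s expansion A b n (q + m - int j) 0 (a (0 + int j) w))"
    using is_field_expansion_left[OF assms(3,2), of n 0 0] assms(4) by (intro expansion_sum') auto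
  also have "\<dots> = (\<Sum>j<N. signed_binomial m j *s (\<Sum>i<N. signed_binomial n i *s A (q + m - int j + n - int i) (b (0 + int i) (a (0 + int j) w))))"
    using assms(5) by (intro sum.cong arg_cong2[of _ _ _ _ "(*s)"] refl expansion_sum' assms) auto
  finally show ?thesis by (simp add: scale_sum_right algebra_simps)
qed

text \<open>To the right of \<open>A\<close> only nonnegative modes of \<open>a\<close> and
  \<open>b\<close> occur, and these commute without a central term.\<close>

lemma expansion_right_commute:
  assumes "is_field a" "is_field b" "is_field A" and comm: "\<And>i j w. a (int i) (b (int j) w) = b (int j) (a (int i) w)"
  shows "expansion (\<lambda>r. expansion A b n r 0) a m q 0 w = expansion (\<lambda>r. expansion A a m r 0) b n q 0 w"
proof -
  obtain N1 where N1: "\<forall>n\<ge>0 + int N1. a n w = 0" "\<forall>n\<ge>0 + int N1. b n w = 0"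
    using is_field_bound2[OF assms(1,2)] by blast
  \<comment> \<open>The bound must serve b(n) a(j) w for every j, but a(j) w = 0 from j = N1 on; the
    next bound treats the other order likewise.\<close>
  obtain N2 where N2: "\<And>j. j \<in> {..<N1} \<Longrightarrow> \<forall>n\<ge>0 + int N2. b n (a (int j) w) = 0" "N2 \<ge> N1"
    using ex_common_bound_nat[of "{..<N1}" "\<lambda>_. b" "\<lambda>_. 0" "\<lambda>j. a (int j) w" N1] assms(2) by auto
  obtain N where N: "\<And>j. j \<in> {..<N1} \<Longrightarrow> \<forall>n\<ge>0 + int N. a n (b (int j) w) = 0" "N \<ge> N2"
    using ex_common_bound_nat[of "{..<N1}" "\<lambda>_. a" "\<lambda>_. 0" "\<lambda>j. b (int j) w" N2] assms(1) by auto
  have ba: "\<forall>n\<ge>0 + int N. b n (a (int j) w) = 0" for j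
    using N1 N2 N(2) lin_zero[OF is_field_lin[OF assms(2)]] by (cases "j < N1") auto
  have ab: "\<forall>n\<ge>0 + int N. a n (b (int j) w) = 0" for j
    using N1 N lin_zero[OF is_field_lin[OF assms(1)]] by (cases "j < N1") auto
  have aw: "\<forall>n\<ge>0 + int N. a n w = 0" and bw: "\<forall>n\<ge>0 + int N. b n w = 0"
    using N1 N2(2) N(2) by auto
  have "expansion (\<lambda>r. expansion A b n r 0) a m q 0 w =
      (\<Sum>j<N. \<Sum>i<N. (signed_binomial m j * signed_binomial n i) *s A (q + m + n - int j - int i) (b (int i) (a (int j) w)))"
    by (rule expansion_nested_right[OF assms(1-3) aw ba])
  also have "\<dots> = (\<Sum>i<N. \<Sum>j<N. (signed_binomial m j * signed_binomial n i) *s A (q + m + n - int j - int i) (b (int i) (a (int j) w)))"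
    by (rule sum.swap)
  also have "\<dots> = (\<Sum>i<N. \<Sum>j<N. (signed_binomial n i * signed_binomial m j) *s A (q + n + m - int i - int j) (a (int j) (b (int i) w)))"
    by (simp only: comm mult.commute add.commute add.left_commute diff_diff_eq)
  also have "\<dots> = expansion (\<lambda>r. expansion A a m r 0) b n q 0 w"
    by (rule expansion_nested_right[OF assms(2,1,3) bw ab, symmetric])
  finally show ?thesis .
qed

text \<open>The bracket of a(m-j) and b(n-i) is nonzero only for i + j = m + n = s. By absorption
  and Vandermonde these terms add up to m \<kappa> times the coefficient of z^s in (y - z)^(s-1),
  which is zero unless s = 0.\<close>

lemma expansion_left_commute:
  assumes "is_field a" "is_field b" "is_field A"
    and comm: "\<And>i j w. a i (b j w) = b j (a i w) + (if i + j = 0 then of_int i * \<kappa> else 0) *s w"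
  shows "expansion a (\<lambda>r. expansion b A n 0 r) m 0 q w =
    expansion b (\<lambda>r. expansion a A m 0 r) n 0 q w + (if m + n = 0 then of_int m * \<kappa> else 0) *s A q w"
proof -
  define s where "s = nat (m + n)"
  obtain N0 where N0: "\<forall>n\<ge>q + int N0. A n w = 0" using is_field_bound[OF assms(3)] by blast
  \<comment> \<open>Beyond s as well, so that the whole diagonal i + j = s lies in the
    range.\<close>
  define N where "N = max N0 (Suc s)"
  have N: "\<forall>n\<ge>q + int N. A n w = 0" "s < N" using N0 by (auto simp: N_def)
  have "expansion a (\<lambda>r. expansion b A n 0 r) m 0 q w - expansion b (\<lambda>r. expansion a A m 0 r) n 0 q w =
      (\<Sum>j<N. \<Sum>i<N. (signed_binomial m j * signed_binomial n i) *s 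
        (if m - int j + (n - int i) = 0 then of_int (m - int j) * \<kappa> else 0) *s A (q + int j + int i) w)"
    unfolding expansion_nested_left[OF assms(1,2,3) N(1)] expansion_nested_left[OF assms(2,1,3) N(1)] comm
    by (subst (2) sum.swap) (simp add: scale_right_distrib sum.distrib algebra_simps)
  also have "\<dots> = (\<Sum>j<N. \<Sum>i<N. (if m + n = int (j + i)
       then (signed_binomial m j * signed_binomial n i * (of_int (m - int j) * \<kappa>)) else 0) *s A (q + m + n) w)"
  proof (intro sum.cong refl)
    fix j i
    have "A (q + int j + int i) w = A (q + m + n) w" if "m + n = int (j + i)"
      using that by (intro arg_cong2[of _ _ _ _ A]) auto
    then show "(signed_binomial m j * signed_binomial n i) *s 
        (if m - int j + (n - int i) = 0 then of_int (m - int j) * \<kappa> else 0) *s A (q + int j + int i) w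
      = (if m + n = int (j + i) then (signed_binomial m j * signed_binomial n i * (of_int (m - int j) * \<kappa>)) else 0) *s A (q + m + n) w"
      by auto
  qed
  also have "\<dots> = (\<Sum>j<N. \<Sum>i<N. (if m + n = int (j + i)
       then (of_int m * \<kappa>) * (signed_binomial (m - 1) j * signed_binomial n i) else 0)) *s A (q + m + n) w"
    using signed_binomial_absorb_comp[of m]
    by (simp add: scale_sum_left mult_ac cong: if_cong) (intro sum.cong refl; simp add: mult_ac)
  also have "(\<Sum>j<N. \<Sum>i<N. (if m + n = int (j + i)
       then (of_int m * \<kappa>) * (signed_binomial (m - 1) j * signed_binomial n i) else 0)) = 
       (if m + n = 0 then of_int m * \<kappa> else 0)"
  proof (cases "m + n < 0")
    case False
    then have s: "m + n = int s" by (simp add: s_def)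
    have "(\<Sum>i<N. (if m + n = int (j + i) then (of_int m * \<kappa>) * (signed_binomial (m - 1) j * signed_binomial n i) else 0))
       = (if j \<le> s then (of_int m * \<kappa>) * (signed_binomial (m - 1) j * signed_binomial n (s - j)) else 0)" for j
    proof -
      have "(\<Sum>i<N. (if m + n = int (j + i) then (of_int m * \<kappa>) * (signed_binomial (m - 1) j * signed_binomial n i) else 0))
        = (\<Sum>i<N. (if i = s - j then (if j \<le> s then (of_int m * \<kappa>) * (signed_binomial (m - 1) j * signed_binomial n i) else 0) else 0))"
      proof (intro sum.cong refl)
        fix i
        have "m + n = int (j + i) \<longleftrightarrow> i = s - j \<and> j \<le> s" unfolding s by linarith
        then show "(if m + n = int (j + i) then (of_int m * \<kappa>) * (signed_binomial (m - 1) j * signed_binomial n i) else 0) =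
          (if i = s - j then (if j \<le> s then (of_int m * \<kappa>) * (signed_binomial (m - 1) j * signed_binomial n i) else 0) else 0)"
          by simp
      qed
      then show ?thesis using N(2) by (simp add: less_imp_diff_less)
    qed
    then have "(\<Sum>j<N. \<Sum>i<N. (if m + n = int (j + i) then (of_int m * \<kappa>) * (signed_binomial (m - 1) j * signed_binomial n i) else 0))
       = (\<Sum>j<N. (if j \<le> s then (of_int m * \<kappa>) * (signed_binomial (m - 1) j * signed_binomial n (s - j)) else 0))" by simp
    also have "\<dots> = (\<Sum>j\<le>s. (of_int m * \<kappa>) * (signed_binomial (m - 1) j * signed_binomial n (s - j)))"
      using N(2) by (intro sum.mono_neutral_cong_right) auto
    also have "\<dots> = of_int m * \<kappa> * signed_binomial (m - 1 + n) s"
      by (simp add: signed_binomial_Vandermonde flip: sum_distrib_left)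
    also have "m - 1 + n = int s - 1" using s by simp
    finally show ?thesis using s by (simp add: signed_binomial_pred_self)
  qed (auto intro!: sum.neutral)
  finally have "expansion a (\<lambda>r. expansion b A n 0 r) m 0 q w - expansion b (\<lambda>r. expansion a A m 0 r) n 0 q w =
      (if m + n = 0 then of_int m * \<kappa> else 0) *s A (q + m + n) w" .
  moreover have "q + m + n = q" if "m + n = 0" using that by simp
  ultimately have "expansion a (\<lambda>r. expansion b A n 0 r) m 0 q w - expansion b (\<lambda>r. expansion a A m 0 r) n 0 q w =
      (if m + n = 0 then of_int m * \<kappa> else 0) *s A q w" by (cases "m + n = 0") simp_all
  then show ?thesis by (simp only: diff_eq_eq add.commute)
qed

text \<open>Each side expands into four orderings. Those with \<open>A\<close> in the middle match
  by \<open>expansion_assoc\<close>, those with \<open>A\<close> on the left by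
  \<open>expansion_right_commute\<close>, and those with \<open>A\<close> on the right leave the
  central term.\<close>

lemma nth_product_commute:
  assumes "is_field a" "is_field b" "is_field A"
    and comm: "\<And>i j w. a i (b j w) = b j (a i w) + (if i + j = 0 then of_int i * \<kappa> else 0) *s w"
  shows "nth_product a (\<lambda>r. nth_product b A n 0 r) m 0 q w =
    nth_product b (\<lambda>r. nth_product a A m 0 r) n 0 q w + (if m + n = 0 then of_int m * \<kappa> else 0) *s A q w"
proof -
  have R: "is_field (\<lambda>r. expansion x A k p r)" and L: "is_field (\<lambda>r. expansion A x k r p)" if "is_field x" for x k p
    using is_field_expansion_right[OF that assms(3), of k p 0] is_field_expansion_left[OF assms(3) that, of k 0 p] by simp_all
  have D: "expansion x (\<lambda>r. nth_product y A k 0 r) l 0 q w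
        = expansion x (\<lambda>r. expansion y A k 0 r) l 0 q w - neg_one_pow k *s expansion x (\<lambda>r. expansion A y k r 0) l 0 q w"
      "expansion (\<lambda>r. nth_product y A k 0 r) x l q 0 w
        = expansion (\<lambda>r. expansion y A k 0 r) x l q 0 w - neg_one_pow k *s expansion (\<lambda>r. expansion A y k r 0) x l q 0 w"
    if "is_field x" "is_field y" for x y k l
    unfolding nth_product_def
    by (simp_all add: expansion_diff_left expansion_diff_right expansion_scale_left expansion_scale_right is_field_cmult R L that)
  have c: "a (int i) (b (int j) w) = b (int j) (a (int i) w)" for i j w
    using comm by auto
  show ?thesis
    unfolding nth_product_def[of _ "\<lambda>r. nth_product _ _ _ _ r"] D[OF assms(1,2)] D[OF assms(2,1)]
      expansion_left_commute[OF assms] expansion_right_commute[OF assms(1-3) c] 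
      expansion_assoc[OF assms(3,2,1)] expansion_assoc[OF assms(3,1,2)]
    by (simp add: algebra_simps)
qed

end

text \<open>Negating the upper index of the binomial produces a second sign (-1)^s, as in the
  expansion of 1/(y - z)^r with positive coefficients.\<close>

lemma signed_binomial_neg: "signed_binomial (- int r) s = of_nat ((r + s - 1) choose s)" if "r > 0"
proof -
  have "- of_nat r gchoose s = (-1) ^ s * (of_nat (r + s - 1) gchoose s :: complex)"
    using that gbinomial_minus[of "of_nat r :: complex" s] by (simp add: of_nat_diff)
  moreover have "(-1::complex) ^ s * ((-1) ^ s * x) = x" for x by (simp add: minus_one_power_iff)
  ultimately show ?thesis by (simp add: signed_binomial_def binomial_gbinomial)
qed

text \<open>The two sides are the scalar terms that arise when \<open>a(m)\<close> is commuted past the \<open>k\<close>-th product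
  by \<open>b(z)\<close>, once termwise and once through the commutator formula.\<close>

lemma signed_binomial_cocycle:
  assumes "k < 0"
  shows "of_int m * ((if m + k \<ge> 0 then signed_binomial k (nat (m + k)) else 0) - neg_one_pow k * (if m \<le> 0 then signed_binomial k (nat (- m)) else 0))
    = of_int (- k) * (of_int m gchoose nat (- k) :: complex)"
proof -
  obtain r where k: "k = - int (Suc r)" 
    using assms by (metis Suc_pred' int_nat_eq minus_minus nat_eq_iff neg_0_less_iff_less zero_less_nat_eq less_imp_le)
  \<comment> \<open>At most one of the two scalar terms survives: the first needs m >= -k > 0, the
    second m <= 0.\<close>
  consider (pos) n where "m = int (Suc n)" | (zero) "m = 0" | (neg) s where "m = - int (Suc s)"
    by (metis int_cases nat.exhaust of_nat_0)
  then show ?thesis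
  proof cases
    case pos
    show ?thesis
    proof (cases "r \<le> n")
      case True
      then have "nat (m + k) = n - r" "r + (n - r) = n" by (auto simp: pos k)
      then have "signed_binomial k (nat (m + k)) = of_nat (n choose (n - r))"
        using signed_binomial_neg[of "Suc r" "n - r"] True by (simp add: k)
      also have "n choose (n - r) = n choose r" using True by (simp add: binomial_symmetric[symmetric])
      finally have "of_int m * signed_binomial k (nat (m + k)) = of_nat (Suc n * (n choose r))"
        by (simp add: pos distrib_right)
      also have "Suc n * (n choose r) = Suc r * (Suc n choose Suc r)"
        using binomial_absorption[of r "Suc n"] by simp
      also have "of_nat \<dots> = of_int (- k) * (of_int m gchoose nat (- k) :: complex)"
      proof -
        have "of_int (- k) = (of_nat (Suc r) :: complex)" "nat (- k) = Suc r"
          "of_int m = (of_nat (Suc n) :: complex)" by (auto simp: k pos)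
        then show ?thesis by (simp only: of_nat_mult binomial_gbinomial)
      qed
      finally show ?thesis using True by (simp add: pos k)
    next
      case False
      then have "of_int m gchoose nat (- k) = (of_nat (Suc n choose Suc r) :: complex)"
        by (simp add: k pos binomial_gbinomial nat_add_distrib del: binomial_Suc_Suc flip: of_nat_Suc)
      then show ?thesis using False by (simp add: pos k binomial_eq_0)
    qed
  next
    case zero
    then show ?thesis by (simp add: k nat_add_distrib gbinomial_0_left)
  next
    case neg
    have 1: "of_int m gchoose nat (- k) = ((-1) ^ Suc r * of_nat ((Suc r + s) choose Suc r) :: complex)"
    proof -
      have "- of_nat (Suc s) gchoose Suc r = ((-1) ^ Suc r * (of_nat (Suc r + s) gchoose Suc r) :: complex)"
        using gbinomial_minus[of "of_nat (Suc s) :: complex" "Suc r"] by (simp add: add.commute)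
      moreover have "nat (- k) = Suc r" "of_int m = (- of_nat (Suc s) :: complex)" by (auto simp: k neg)
      ultimately show ?thesis by (simp only: binomial_gbinomial)
    qed
    have 2: "signed_binomial k (nat (- m)) = of_nat ((Suc r + s) choose Suc s)"
      using signed_binomial_neg[of "Suc r" "Suc s"] by (simp add: k neg nat_add_distrib)
    have "Suc s * ((Suc r + s) choose Suc s) = Suc r * ((Suc r + s) choose Suc r)"
      using binomial_absorption[of s "Suc r + s"] binomial_absorption[of r "Suc r + s"]
        binomial_symmetric[of s "r + s"] by simp
    then have 3: "of_nat (Suc s) * of_nat ((Suc r + s) choose Suc s) = (of_nat (Suc r) * of_nat ((Suc r + s) choose Suc r) :: complex)"
      by (metis of_nat_mult)
    have "of_int m * (0 - neg_one_pow k * of_nat ((Suc r + s) choose Suc s)) = 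
       neg_one_pow k * (of_nat (Suc s) * of_nat ((Suc r + s) choose Suc s))"
      by (simp add: neg algebra_simps del: binomial_Suc_Suc)
    also have "\<dots> = of_int (- k) * ((-1) ^ Suc r * of_nat ((Suc r + s) choose Suc r) :: complex)"
      unfolding 3 using neg_one_pow_of_nat[of "Suc r"] by (simp add: k neg_one_pow_def del: binomial_Suc_Suc)
    moreover have "\<not> m + k \<ge> 0" "m \<le> 0" by (auto simp: neg k)
    ultimately show ?thesis unfolding 1 2 by simp
  qed
qed

text \<open>Trinomial revision; coefficient form of applying (1/i!) (d/dy)^i to (y - z)^k.\<close>

lemma signed_binomial_gbinomial_mult: "signed_binomial k j * (of_int (k - int j) gchoose i) = (of_int k gchoose i) * signed_binomial (k - int i) j"
proof -
  have "(of_int k gchoose j) * (of_int k - of_nat j gchoose i) = ((of_int k gchoose (i + j)) * (of_nat (i + j) gchoose j) :: complex)"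
    using gbinomial_trinomial_revision[of j "i + j" "of_int k :: complex"] by simp
  also have "(of_nat (i + j) gchoose j) = (of_nat (i + j) gchoose i :: complex)"
    using gbinomial_of_nat_symmetric[of j "i + j"] by simp
  also have "(of_int k gchoose (i + j)) * (of_nat (i + j) gchoose i) = (of_int k gchoose i) * (of_int k - of_nat i gchoose j :: complex)"
    using gbinomial_trinomial_revision[of i "i + j" "of_int k :: complex"] by simp
  finally show ?thesis by (simp add: signed_binomial_def mult_ac)
qed

text \<open>The same for (1/i!) (d/dz)^i, which accounts for the sign (-1)^i.\<close>

lemma signed_binomial_add_mult: "signed_binomial k (i + j) * (of_nat (i + j) gchoose i) = (-1) ^ i * (of_int k gchoose i) * signed_binomial (k - int i) j"
  using gbinomial_trinomial_revision[of i "i + j" "of_int k :: complex"] 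
  by (simp add: signed_binomial_def power_add mult_ac)

section \<open>Bilinearity and integration by parts for n-th products\<close>

context complex_space
begin

lemma is_field_nth_product_left:
  assumes "is_field A" "is_field B" shows "is_field (\<lambda>p. nth_product A B k p q)"
  using is_field_cmult[OF is_field_nth_product[OF assms(2,1)], of "- neg_one_pow k" k q]
  by (subst nth_product_swap[abs_def]) simp

lemma nth_product_add_left:
  assumes "is_field A" "is_field A'" "is_field B"
  shows "nth_product (\<lambda>n w. A n w + A' n w) B k p q w = nth_product A B k p q w + nth_product A' B k p q w"
  by (simp add: nth_product_def expansion_add_left expansion_add_right assms algebra_simps)

lemma nth_product_scale_left:
  assumes "is_field A" "is_field B"
  shows "nth_product (\<lambda>n w. c *s A n w) B k p q w = c *s nth_product A B k p q w"
  by (simp add: nth_product_def expansion_scale_left expansion_scale_right assms algebra_simps)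

lemma nth_product_add_right:
  assumes "is_field A" "is_field B" "is_field B'"
  shows "nth_product A (\<lambda>n w. B n w + B' n w) k p q w = nth_product A B k p q w + nth_product A B' k p q w"
  by (simp add: nth_product_def expansion_add_left expansion_add_right assms algebra_simps)

lemma nth_product_scale_right:
  assumes "is_field A" "is_field B"
  shows "nth_product A (\<lambda>n w. c *s B n w) k p q w = c *s nth_product A B k p q w"
  by (simp add: nth_product_def expansion_scale_left expansion_scale_right assms algebra_simps)

lemma nth_product_diff_right:
  assumes "is_field A" "is_field B" "is_field B'"
  shows "nth_product A (\<lambda>n w. B n w - B' n w) k p q w = nth_product A B k p q w - nth_product A B' k p q w"
  by (simp add: nth_product_def expansion_diff_left expansion_diff_right assms algebra_simps)

lemma nth_product_shift_right: "nth_product A (\<lambda>n. B (n + t)) k p q w = nth_product A B k p (q + t) w"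
  by (simp add: nth_product_def expansion_shift_left expansion_shift_right)

lemma nth_product_sum_left:
  assumes "\<And>i. i \<in> S \<Longrightarrow> is_field (A i)" "is_field B"
  shows "nth_product (\<lambda>n w. \<Sum>i\<in>S. A i n w) B k p q w = (\<Sum>i\<in>S. nth_product (A i) B k p q w)"
  by (simp add: nth_product_def expansion_sum_left expansion_sum_right assms scale_sum_right sum_subtractf)

lemma nth_product_sum_right:
  assumes "\<And>i. i \<in> S \<Longrightarrow> is_field (B i)" "is_field A"
  shows "nth_product A (\<lambda>n w. \<Sum>i\<in>S. B i n w) k p q w = (\<Sum>i\<in>S. nth_product A (B i) k p q w)"
  by (simp add: nth_product_def expansion_sum_left expansion_sum_right assms scale_sum_right sum_subtractf)

lemma nth_product_lincomb_right:
  assumes "\<And>i. i \<in> S \<Longrightarrow> is_field (B i)" "is_field A"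
  shows "nth_product A (\<lambda>n w. \<Sum>i\<in>S. c i *s B i (n + t i) w) k p q w =
    (\<Sum>i\<in>S. c i *s nth_product A (B i) k p (q + t i) w)"
proof -
  have *: "is_field (\<lambda>n. B i (n + t i))" if "i \<in> S" for i
    using is_field_scale[OF assms(1)[OF that], of "\<lambda>_. 1" "t i"] by simp
  show ?thesis
    by (simp add: nth_product_sum_right nth_product_scale_right assms * is_field_cmult nth_product_shift_right)
qed

lemma nth_product_comm:
  assumes "lin L" "is_field A" "is_field B"
  shows "L (nth_product A B k p q w) - nth_product A B k p q (L w) =
    nth_product (\<lambda>n w. L (A n w) - A n (L w)) B k p q w + nth_product A (\<lambda>n w. L (B n w) - B n (L w)) k p q w"
proof -
  have "L (nth_product A B k p q w) - nth_product A B k p q (L w) = (L (expansion A B k p q w) - expansion A B k p q (L w))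
     - neg_one_pow k *s (L (expansion B A k q p w) - expansion B A k q p (L w))"
    by (simp add: nth_product_def lin_simps[OF assms(1)] scale_right_diff_distrib)
  then show ?thesis
    unfolding expansion_comm[OF assms] expansion_comm[OF assms(1,3,2)] by (simp add: nth_product_def algebra_simps)
qed

text \<open>Integration by parts: n A(n+t) are the modes of -d/dy (y^(t+1) A(y)), p = 0 takes the
  residue in y, and the derivative passes to (y - z)^k.\<close>

lemma nth_product_weight_left:
  assumes "is_field A" "is_field B"
  shows "nth_product (\<lambda>n w. of_int n *s A (n + t) w) B k 0 q w = of_int k *s nth_product A B (k - 1) (t + 1) q w"
proof -
  have A: "is_field (\<lambda>n. A (n + t))" using is_field_scale[OF assms(1), of "\<lambda>_. 1" t] by simp
  have "expansion (\<lambda>n w. of_int n *s A (n + t) w) B k 0 q w = of_int k *s expansion A B (k - 1) (t + 1) q w"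
    using expansion_weight_left[OF A assms(2), of 0 k q w] by (simp add: expansion_shift_left add.commute)
  moreover have "expansion B (\<lambda>n w. of_int n *s A (n + t) w) k q 0 w = - (of_int k *s expansion B A (k - 1) q (t + 1) w)"
    using expansion_weight_right[OF assms(2) A, of 0 k q w] by (simp add: expansion_shift_right add.commute)
  ultimately show ?thesis by (simp add: nth_product_def algebra_simps)
qed

text \<open>Product rule for d/dz: n B(n-1) are the modes of -B'(z), and the term with k - 1 comes
  from differentiating (y - z)^k.\<close>

lemma nth_product_weight_right:
  assumes "is_field A" "is_field B"
  shows "nth_product A (\<lambda>n w. of_int n *s B (n - 1) w) k 0 q w =
    of_int q *s nth_product A B k 0 (q - 1) w - of_int k *s nth_product A B (k - 1) 0 q w"
proof -
  have B: "is_field (\<lambda>n. B (n - 1))" using is_field_scale[OF assms(2), of "\<lambda>_. 1" "- 1"] by simp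
  have B': "is_field (\<lambda>n w. of_int (n - q) *s B (n - 1) w)"
    using is_field_scale[OF assms(2), of "\<lambda>n. of_int (n - q)" "- 1"] by simp
  \<comment> \<open>The weight lemmas for \<open>expansion\<close> measure the weight from q, hence
    n = (n - q) + q.\<close>
  have *: "(\<lambda>n w. of_int n *s B (n - 1) w) = (\<lambda>n w. of_int (n - q) *s B (n - 1) w + of_int q *s B (n - 1) w)"
    by (simp add: fun_eq_iff algebra_simps)
  have "expansion A (\<lambda>n w. of_int n *s B (n - 1) w) k 0 q w
      = of_int q *s expansion A B k 0 (q - 1) w - of_int k *s expansion A B (k - 1) 0 q w"
    unfolding * expansion_add_right[OF assms(1) B' is_field_cmult[OF B]] expansion_scale_right[OF assms(1) B]
      expansion_weight_right[OF assms(1) B, of q k 0 w]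
    using expansion_shift_right[of A B "-1"] by simp
  moreover have "expansion (\<lambda>n w. of_int n *s B (n - 1) w) A k q 0 w
      = of_int q *s expansion B A k (q - 1) 0 w + of_int k *s expansion B A (k - 1) q 0 w"
    unfolding * expansion_add_left[OF B' is_field_cmult[OF B] assms(1)] expansion_scale_left[OF B assms(1)]
      expansion_weight_left[OF B assms(1), of q k 0 w]
    using expansion_shift_left[of B "-1" A] by simp
  ultimately show ?thesis by (simp add: nth_product_def algebra_simps)
qed

text \<open>The left factor has its only possibly nonzero mode at n = -m, so each expansion has at
  most one term, j = m + k or j = -m, with the same mode of \<open>A\<close>. The two coefficients
  combine by \<open>signed_binomial_cocycle\<close>.\<close>

lemma nth_product_delta_left:
  assumes "is_field A" "k < 0"
  shows "nth_product (\<lambda>n w. (if m + n = 0 then of_int m * \<kappa> else 0) *s w) A k 0 q w =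
    ((of_int (- k) * (of_int m gchoose nat (- k))) * \<kappa>) *s A (m + q + k) w"
proof -
  let ?E = "\<lambda>n w. (if m + n = 0 then of_int m * \<kappa> else 0) *s w"
  have "expansion ?E A k 0 q w = (\<Sum>j\<in>(if m + k \<ge> 0 then {nat (m + k)} else {}). signed_binomial k j *s ?E (0 + k - int j) (A (q + int j) w))"
    unfolding expansion_def by (rule Sum_any.expand_superset) auto
  then have 1: "expansion ?E A k 0 q w = ((if m + k \<ge> 0 then signed_binomial k (nat (m + k)) else 0) * (of_int m * \<kappa>)) *s A (m + q + k) w"
    by (simp add: algebra_simps)
  have "expansion A ?E k q 0 w = (\<Sum>j\<in>(if m \<le> 0 then {nat (- m)} else {}). signed_binomial k j *s A (q + k - int j) (?E (0 + int j) w))"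
    unfolding expansion_def by (rule Sum_any.expand_superset) (auto simp: lin_zero[OF is_field_lin[OF assms(1)]])
  then have 2: "expansion A ?E k q 0 w = ((if m \<le> 0 then signed_binomial k (nat (- m)) else 0) * (of_int m * \<kappa>)) *s A (m + q + k) w"
    by (simp add: lin_scale[OF is_field_lin[OF assms(1)]] algebra_simps)
  show ?thesis
    unfolding nth_product_def 1 2 scale_scale scale_left_diff_distrib[symmetric] signed_binomial_cocycle[OF assms(2), symmetric]
    by (simp only: left_diff_distrib right_diff_distrib mult_ac)
qed

text \<open>Integration by parts i times: the left factor has the modes of (-1)^i (1/i!) (d/dy)^i
  (y^n A(y)), and the residue passes the derivative to (y - z)^k.\<close>

lemma nth_product_gbinomial_left:
  assumes "is_field A" "is_field B"
  shows "nth_product (\<lambda>p w. (of_int p gchoose i) *s A (p + (n - int i)) w) B k 0 m w =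
    (of_int k gchoose i) *s nth_product A B (k - int i) n m w"
proof -
  let ?A = "\<lambda>p w. (of_int p gchoose i) *s A (p + (n - int i)) w"
  have fA: "is_field ?A" by (rule is_field_scale[OF assms(1)])
  obtain N where N: "\<forall>n\<ge>m + int N. B n w = 0" using is_field_bound[OF assms(2)] by blast
  have e: "0 + k - int j + (n - int i) = n + (k - int i) - int j" for j by simp
  have "expansion ?A B k 0 m w = (of_int k gchoose i) *s expansion A B (k - int i) n m w"
    unfolding expansion_sum'[OF fA, of m N B w, OF N] expansion_sum'[OF assms(1), of m N B w, OF N]
    unfolding scale_sum_right scale_scale e using signed_binomial_gbinomial_mult[of k _ i] by simp
  moreover have "expansion B ?A k m 0 w = ((-1) ^ i * (of_int k gchoose i)) *s expansion B A (k - int i) m n w"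
  proof -
    obtain M where M: "\<forall>p\<ge>n + int M. A p w = 0" using is_field_bound[OF assms(1)] by blast
    \<comment> \<open>Here the modes of the left factor are j >= 0, where (j choose i) vanishes for
      j < i; so only indices i + j remain.\<close>
    have "expansion B ?A k m 0 w = (\<Sum>j\<in>(\<lambda>j. i + j) ` {..<M}. signed_binomial k j *s B (m + k - int j) (?A (0 + int j) w))"
      unfolding expansion_def
    proof (rule Sum_any.expand_superset)
      show "{j. signed_binomial k j *s B (m + k - int j) (?A (0 + int j) w) \<noteq> 0} \<subseteq> (\<lambda>j. i + j) ` {..<M}"
      proof
        fix j assume *: "j \<in> {j. signed_binomial k j *s B (m + k - int j) (?A (0 + int j) w) \<noteq> 0}"
        have "i \<le> j"
        proof (rule ccontr)
          assume "\<not> i \<le> j"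
          then have "(of_int (0 + int j) gchoose i) = (0::complex)"
            by (simp add: binomial_eq_0 flip: binomial_gbinomial)
          then show False using * by (simp add: lin_zero[OF is_field_lin[OF assms(2)]])
        qed
        moreover have "j < i + M"
        proof (rule ccontr)
          assume "\<not> j < i + M"
          then have "A (0 + int j + (n - int i)) w = 0" using M by auto
          then show False using * by (simp add: lin_zero[OF is_field_lin[OF assms(2)]])
        qed
        ultimately show "j \<in> (\<lambda>j. i + j) ` {..<M}" by (intro image_eqI[of _ _ "j - i"]) auto
      qed
    qed simp
    also have "\<dots> = (\<Sum>j<M. signed_binomial k (i + j) *s B (m + k - int (i + j)) (?A (0 + int (i + j)) w))"
      by (simp add: sum.reindex)
    also have "\<dots> = (\<Sum>j<M. (signed_binomial k (i + j) * (of_nat (i + j) gchoose i)) *s B (m + (k - int i) - int j) (A (n + int j) w))"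
      by (simp add: lin_scale[OF is_field_lin[OF assms(2)]] algebra_simps)
    also have "\<dots> = ((-1) ^ i * (of_int k gchoose i)) *s expansion B A (k - int i) m n w"
      unfolding expansion_sum'[OF assms(2), of n M A w, OF M] signed_binomial_add_mult by (simp add: scale_sum_right)
    finally show ?thesis .
  qed
  moreover have "neg_one_pow k * (-1) ^ i = neg_one_pow (k - int i)"
    using neg_one_pow_add[of k "- int i"] by (simp add: neg_one_pow_def)
  ultimately show ?thesis by (simp add: nth_product_def scale_right_diff_distrib mult_ac)
qed

section \<open>Locality\<close>

definition mutually_local :: "(int \<Rightarrow> 'v \<Rightarrow> 'v) \<Rightarrow> (int \<Rightarrow> 'v \<Rightarrow> 'v) \<Rightarrow> bool" where
  "mutually_local A B \<longleftrightarrow> (\<exists>N. \<forall>k\<ge>N. \<forall>p q w. nth_product A B k p q w = 0)"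

lemma mutually_local_sym: "mutually_local A B \<Longrightarrow> mutually_local B A"
  unfolding mutually_local_def by (metis nth_product_swap minus_zero scale_zero_right)

text \<open>A form of Dong's lemma: the commutator of \<open>a\<close> with \<open>B\<close> is replaced by the singular part
  of an operator product expansion, with coefficients \<open>C i\<close> local to \<open>A\<close>.\<close>

lemma mutually_local_iter:
  assumes a: "is_field a" and A: "is_field A" and B: "is_field B" and C: "\<And>i. is_field (C i)"
    and ope: "\<And>p n w. a p (B n w) - B n (a p w) = (\<Sum>i<K. (of_int p gchoose i) *s C i (p + (n - int i)) w)"
    and AB: "mutually_local A B" and CA: "\<And>i. mutually_local (C i) A"
  shows "mutually_local (\<lambda>m. nth_product a A k 0 m) B"
proof -
  let ?X = "\<lambda>m. nth_product a A k 0 m"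
  have X: "is_field ?X" by (rule is_field_nth_product[OF a A])
  \<comment> \<open>The case t = 0 is the derivation property of the commutator with B(n). Each step
    multiplies by the difference of the variables of the product and of \<open>B\<close>; in the
    terms with \<open>C i\<close> these variables are exchanged, hence the sign (-1)^t.\<close>
  have expand: "nth_product ?X B (int t) m n w = nth_product a (\<lambda>r. nth_product A B (int t) r n) k 0 m w
      + (-1) ^ t *s (\<Sum>i<K. (of_int k gchoose i) *s nth_product (C i) A (k - int i + int t) n m w)" for t m n w
  proof (induction t arbitrary: m n)
    case 0
    have 1: "(\<lambda>r w. B n (A r w) - A r (B n w)) = (\<lambda>r w. (- 1) *s nth_product A B 0 r n w)"
      by (simp add: fun_eq_iff nth_product_zero_power A B)
    have 2: "(\<lambda>r w. B n (a r w) - a r (B n w)) = (\<lambda>r w. (- 1) *s (a r (B n w) - B n (a r w)))"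
      by (simp add: fun_eq_iff)
    have f: "is_field (\<lambda>p w. (of_int p gchoose i) *s C i (p + (n - int i)) w)" for i
      by (rule is_field_scale[OF C])
    have "nth_product ?X B 0 m n w = - (B n (?X m w) - ?X m (B n w))"
      by (simp add: nth_product_zero_power X B)
    also have "\<dots> = nth_product a (\<lambda>r. nth_product A B 0 r n) k 0 m w
        + nth_product (\<lambda>r w. a r (B n w) - B n (a r w)) A k 0 m w"
      unfolding nth_product_comm[OF is_field_lin[OF B] a A] 1 2 ope
      by (subst nth_product_scale_left[OF is_field_sum[OF f] A],
          subst nth_product_scale_right[OF a is_field_nth_product_left[OF A B]]) (simp add: algebra_simps)
    also have "nth_product (\<lambda>r w. a r (B n w) - B n (a r w)) A k 0 m w
        = (\<Sum>i<K. (of_int k gchoose i) *s nth_product (C i) A (k - int i) n m w)"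
      unfolding ope by (simp add: nth_product_sum_left[OF f A] nth_product_gbinomial_left[OF C A])
    finally show ?case by simp
  next
    case (Suc t)
    have t: "int (Suc t) = int t + 1" by simp
    have s: "k - int i + int (Suc t) = (k - int i + int t) + 1" for i by simp
    have "nth_product a (\<lambda>r. nth_product A B (int t) r n) k 0 (m + 1) w - nth_product a (\<lambda>r. nth_product A B (int t) r (n + 1)) k 0 m w
        = nth_product a (\<lambda>r w. nth_product A B (int t) (r + 1) n w - nth_product A B (int t) r (n + 1) w) k 0 m w"
      using is_field_scale[OF is_field_nth_product_left[OF A B, of "int t" n], of "\<lambda>_. 1" 1]
      by (simp add: nth_product_diff_right[OF a] is_field_nth_product_left A B flip: nth_product_shift_right[of a _ 1])
    also have "\<dots> = nth_product a (\<lambda>r. nth_product A B (int (Suc t)) r n) k 0 m w"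
      unfolding t by (intro arg_cong[where f = "\<lambda>B. nth_product a B k 0 m w"] ext nth_product_rec[OF A B, symmetric])
    finally have 1: "nth_product a (\<lambda>r. nth_product A B (int t) r n) k 0 (m + 1) w - nth_product a (\<lambda>r. nth_product A B (int t) r (n + 1)) k 0 m w
        = nth_product a (\<lambda>r. nth_product A B (int (Suc t)) r n) k 0 m w" .
    have "nth_product ?X B (int (Suc t)) m n w = nth_product ?X B (int t) (m + 1) n w - nth_product ?X B (int t) m (n + 1) w"
      using nth_product_rec[OF X B, of "int t"] by (simp add: add.commute)
    also have "\<dots> = nth_product a (\<lambda>r. nth_product A B (int (Suc t)) r n) k 0 m w
      + ((-1) ^ t *s (\<Sum>i<K. (of_int k gchoose i) *s nth_product (C i) A (k - int i + int t) n (m + 1) w) -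
         (-1) ^ t *s (\<Sum>i<K. (of_int k gchoose i) *s nth_product (C i) A (k - int i + int t) (n + 1) m w))"
      unfolding Suc.IH 1[symmetric] by (simp add: algebra_simps)
    also have "(-1) ^ t *s (\<Sum>i<K. (of_int k gchoose i) *s nth_product (C i) A (k - int i + int t) n (m + 1) w) -
         (-1) ^ t *s (\<Sum>i<K. (of_int k gchoose i) *s nth_product (C i) A (k - int i + int t) (n + 1) m w)
      = (-1) ^ Suc t *s (\<Sum>i<K. (of_int k gchoose i) *s nth_product (C i) A (k - int i + int (Suc t)) n m w)"
      unfolding s nth_product_rec[OF C A] by (simp add: scale_right_diff_distrib sum_subtractf)
    finally show ?case .
  qed
  obtain N where N: "\<And>k p q w. k \<ge> N \<Longrightarrow> nth_product A B k p q w = 0" using AB unfolding mutually_local_def by blast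
  have "\<exists>M. \<forall>i\<in>{..<K}. \<forall>s\<ge>M. \<forall>p q w. nth_product (C i) A s p q w = 0"
    using CA by (intro ex_common_bound) (auto simp: mutually_local_def)
  then obtain M where M: "\<And>i s p q w. i < K \<Longrightarrow> s \<ge> M \<Longrightarrow> nth_product (C i) A s p q w = 0" by blast
  show ?thesis
    unfolding mutually_local_def
  \<comment> \<open>\<open>M + int K - k\<close> keeps k - i + s above \<open>M\<close> for all i <
    K; the 0 is there because \<open>expand\<close> concerns natural exponents.\<close>
  proof (intro exI[of _ "max 0 (max N (M + int K - k))"] allI impI)
    fix s p q w assume s: "s \<ge> max 0 (max N (M + int K - k))"
    have "nth_product A B (int (nat s)) = (\<lambda>p q w. 0)"
      using s by (intro ext N) simp
    moreover have "nth_product a (\<lambda>r w. 0) k 0 p w = 0"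
      by (simp add: nth_product_def expansion_zero_left expansion_zero_right[OF a])
    moreover have "nth_product (C i) A (k - int i + int (nat s)) q p w = 0" if "i < K" for i
      using s that by (intro M) auto
    ultimately have "nth_product ?X B (int (nat s)) p q w = 0"
      unfolding expand by simp
    with s show "nth_product ?X B s p q w = 0" by simp
  qed
qed

end

section \<open>Vertex algebras generated by Heisenberg fields\<close>

text \<open>The level is absorbed into \<open>K\<close>, so that the central element has disappeared
  and only the modes of the generating fields remain.\<close>

locale heisenberg_module = complex_space sc
  for sc :: "complex \<Rightarrow> 'v::ab_group_add \<Rightarrow> 'v"  (infixr "*s" 75) +
  fixes md :: "'a \<Rightarrow> int \<Rightarrow> 'v \<Rightarrow> 'v" and K :: "'a \<Rightarrow> 'a \<Rightarrow> complex" and vac :: 'v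
  assumes md_lin: "lin (md a n)"
    and md_comm: "md a i (md b j w) = md b j (md a i w) + (if i + j = 0 then of_int i * K a b else 0) *s w"
    and md_vac: "n \<ge> 0 \<Longrightarrow> md a n vac = 0"
    and generated: "subspace S \<Longrightarrow> vac \<in> S \<Longrightarrow> (\<And>a k v. v \<in> S \<Longrightarrow> md a k v \<in> S) \<Longrightarrow> v \<in> S"
begin

text \<open>Nonnegative modes can be moved to the right until they reach the vacuum, so they do not
  lead out of the span of creation monomials.\<close>

lemma creation_generated:
  assumes S: "subspace S" "vac \<in> S" "\<And>a k v. k < 0 \<Longrightarrow> v \<in> S \<Longrightarrow> md a k v \<in> S"
  shows "v \<in> S"
proof -
  define closed where "closed = (\<lambda>S. subspace S \<and> vac \<in> S \<and> (\<forall>a k v. k < 0 \<longrightarrow> v \<in> S \<longrightarrow> md a k v \<in> S))"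
  define T where "T = \<Inter> (Collect closed)"
  have T: "subspace T" "vac \<in> T" "\<And>a k v. k < 0 \<Longrightarrow> v \<in> T \<Longrightarrow> md a k v \<in> T"
    unfolding T_def by (rule subspace_Inter) (auto simp: closed_def)
  \<comment> \<open>By minimality of \<open>T\<close>, it is enough that the vectors of
    \<open>T\<close> which nonnegative modes keep in \<open>T\<close> form a closed
    subspace.\<close>
  have "closed {v \<in> T. \<forall>a n. n \<ge> 0 \<longrightarrow> md a n v \<in> T}" (is "closed ?U")
    unfolding closed_def
  proof (intro conjI allI impI)
    show "subspace ?U"
      using T(1) by (auto simp: subspace_def lin_zero[OF md_lin] lin_add[OF md_lin] lin_scale[OF md_lin])
    show "vac \<in> ?U" using T(2) subspace_0[OF T(1)] by (simp add: md_vac)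
    show "md b k v \<in> ?U" if "k < 0" "v \<in> ?U" for b k v
      using that T(3) by (auto simp: md_comm[of _ _ b k] intro!: subspace_add[OF T(1)] subspace_scale[OF T(1)] subspace_0[OF T(1)])
  qed
  then have "T \<subseteq> ?U" unfolding T_def by blast
  then have "md a k v \<in> T" if "v \<in> T" for a k v
    using that T(3) by (cases "k < 0") auto
  then have "v \<in> T" by (rule generated[OF T(1,2)])
  then show ?thesis using S unfolding T_def closed_def by blast
qed

lemma generated_induct [case_names vac md add scale]:
  assumes "P vac" "\<And>a k v. k < 0 \<Longrightarrow> P v \<Longrightarrow> P (md a k v)"
    "\<And>x y. P x \<Longrightarrow> P y \<Longrightarrow> P (x + y)" "\<And>c x. P x \<Longrightarrow> P (c *s x)"
  shows "P v"
proof -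
  have "P 0" using assms(4)[OF assms(1), of 0] by simp
  then have "subspace {v. P v}" using assms by (intro subspaceI) auto
  then have "v \<in> {v. P v}" by (rule creation_generated) (use assms in auto)
  then show ?thesis by simp
qed

text \<open>Passing a(n) across b(k) costs a scalar only at n = -k, so each creation operator raises
  the bound at most to 1 - k.\<close>

lemma is_field_md: "is_field (md a)"
proof -
  have "\<exists>N. \<forall>n\<ge>N. md a n w = 0" for w
  proof (induction w rule: generated_induct)
    case vac
    then show ?case using md_vac by blast
  next
    case (md b k v)
    then obtain N where "\<forall>n\<ge>N. md a n v = 0" by blast
    then show ?case
      by (intro exI[of _ "max N (1 - k)"]) (simp add: md_comm[of a _ b k] lin_zero[OF md_lin])
  next
    case (add x y)
    then obtain N M where "\<forall>n\<ge>N. md a n x = 0" "\<forall>n\<ge>M. md a n y = 0" by blast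
    then show ?case by (intro exI[of _ "max N M"]) (simp add: lin_add[OF md_lin])
  next
    case (scale c x)
    then show ?case by (metis lin_scale[OF md_lin] scale_zero_right)
  qed
  then show ?thesis by (simp add: is_field_def md_lin)
qed

lemma eq_zero_if_commutes:
  assumes "lin f" "f vac = 0" "\<And>a k w. k < 0 \<Longrightarrow> f (md a k w) = md a k (f w)"
  shows "f w = 0"
  by (induction w rule: generated_induct) (simp_all add: assms lin_simps[OF assms(1)] lin_zero[OF md_lin])

end

text \<open>\<open>Y_md\<close> is required for every integer k, making \<open>Y\<close> a module
  map into fields; nonnegative k occur in \<open>L_Y_comm\<close>.\<close>

locale heisenberg_vertex = heisenberg_module sc md K vac
  for sc :: "complex \<Rightarrow> 'v::ab_group_add \<Rightarrow> 'v"  (infixr "*s" 75)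
    and md :: "'a \<Rightarrow> int \<Rightarrow> 'v \<Rightarrow> 'v" and K vac +
  fixes Y :: "'v \<Rightarrow> int \<Rightarrow> 'v \<Rightarrow> 'v"
  assumes Y_lin_state: "lin (\<lambda>v. Y v n w)"
    and Y_vac: "Y vac n w = (if n = -1 then w else 0)"
    and Y_md: "Y (md a k v) q w = nth_product (md a) (Y v) k 0 q w"
begin

lemma Y_add: "Y (u + v) = (\<lambda>n w. Y u n w + Y v n w)"
  and Y_scale: "Y (c *s v) = (\<lambda>n w. c *s Y v n w)"
  and Y_zero: "Y 0 = (\<lambda>n w. 0)"
  by (simp_all add: fun_eq_iff lin_simps[OF Y_lin_state])

lemma is_field_Y: "is_field (Y v)"
proof (induction v rule: generated_induct)
  case vac
  have "\<forall>n\<ge>0. Y vac n w = 0" for w by (simp add: Y_vac)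
  moreover have "lin (Y vac n)" for n by (simp add: lin_def Y_vac)
  ultimately show ?case unfolding is_field_def by blast
next
  case (md a k v)
  have "Y (md a k v) = (\<lambda>q. nth_product (md a) (Y v) k 0 q)"
    by (simp add: fun_eq_iff Y_md)
  then show ?case using is_field_nth_product[OF is_field_md md(2)] by simp
qed (simp_all add: Y_add Y_scale is_field_add is_field_cmult)

text \<open>On the vacuum the expansion with a(z) on the right vanishes; in the other one only j = 0
  can contribute, since n + j >= 0 for j >= 1.\<close>

lemma creation: "n \<ge> -1 \<Longrightarrow> Y v n vac = (if n = -1 then v else 0)"
proof (induction v arbitrary: n rule: generated_induct)
  case vac
  then show ?case by (simp add: Y_vac)
next
  case (md a k v)
  have "expansion (Y v) (md a) k n 0 vac = 0"
    using expansion_sum'[OF is_field_Y, of 0 0 "md a" vac v] md_vac by simp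
  moreover have "expansion (md a) (Y v) k 0 n vac = (if n = -1 then md a k v else 0)"
  proof -
    have "\<forall>m\<ge>n + int 1. Y v m vac = 0" using md by auto
    then show ?thesis
      using expansion_sum'[OF is_field_md, of n 1 "Y v" vac] md by (simp add: lin_zero[OF md_lin])
  qed
  ultimately show ?case by (simp add: Y_md nth_product_def)
qed (simp_all add: Y_add Y_scale)

text \<open>The right-hand side of the commutator formula. The index is bracketed as
  \<open>m + (q - int i)\<close> to fit the hypothesis of
  \<open>mutually_local_iter\<close>.\<close>

definition ope :: "'a \<Rightarrow> 'v \<Rightarrow> int \<Rightarrow> int \<Rightarrow> 'v \<Rightarrow> 'v" where
  "ope a v m q w = Sum_any (\<lambda>i::nat. (of_int m gchoose i) *s Y (md a (int i) v) (m + (q - int i)) w)"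

lemma ope_sum:
  assumes "\<forall>i\<ge>int N. md a i v = 0"
  shows "ope a v m q w = (\<Sum>i<N. (of_int m gchoose i) *s Y (md a (int i) v) (m + (q - int i)) w)"
  unfolding ope_def
proof (rule Sum_any.expand_superset)
  show "{i. (of_int m gchoose i) *s Y (md a (int i) v) (m + (q - int i)) w \<noteq> 0} \<subseteq> {..<N}"
    using assms by (auto simp: Y_zero) (metis Y_zero linorder_not_less of_nat_le_iff scale_zero_right)
qed simp

lemma md_bound: obtains N where "\<forall>i\<ge>int N. md a i v = 0" "N \<ge> M"
proof -
  obtain N where "\<forall>n\<ge>0 + int N. md a n v = 0" using is_field_bound[OF is_field_md] by blast
  then show ?thesis using that[of "max N M"] by simp
qed

text \<open>a(m) acts as a derivation on the product of b(z) and Y(v,z). The bracket with b(z) gives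
  a scalar term, and the same scalar arises on the other side when a(i) is moved past b(k) at i =
  -k.\<close>

lemma md_Y_comm: "md a m (Y v q w) - Y v q (md a m w) = ope a v m q w"
proof (induction v arbitrary: m q w rule: generated_induct)
  case vac
  have "ope a vac m q w = 0" using ope_sum[of 0 a vac] md_vac by simp
  then show ?case by (simp add: Y_vac lin_zero[OF md_lin])
next
  case (md b k v)
  note fb = is_field_md[of b] and fY = is_field_Y
  \<comment> \<open>\<open>N > -k\<close> for two reasons: the central term of a(i) b(k) v lies
    below the bound, and the summand i = -k lies in the range.\<close>
  obtain N where N: "\<forall>i\<ge>int N. md a i v = 0" "N \<ge> nat (1 - k)" using md_bound by blast
  have N': "\<forall>i\<ge>int N. md a i (md b k v) = 0"
    using N by (auto simp: md_comm[of a _ b k] lin_zero[OF md_lin])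
  have "md a m (Y (md b k v) q w) - Y (md b k v) q (md a m w) =
     nth_product (\<lambda>n w. (if m + n = 0 then of_int m * K a b else 0) *s w) (Y v) k 0 q w
     + nth_product (md b) (\<lambda>n w. ope a v m n w) k 0 q w"
    unfolding Y_md nth_product_comm[OF md_lin fb fY] md.IH
    by (simp add: md_comm[of a m b])
  also have "nth_product (\<lambda>n w. (if m + n = 0 then of_int m * K a b else 0) *s w) (Y v) k 0 q w
      = ((of_int (- k) * (of_int m gchoose nat (- k))) * K a b) *s Y v (m + q + k) w"
    by (rule nth_product_delta_left[OF fY md(1)])
  also have "nth_product (md b) (\<lambda>n w. ope a v m n w) k 0 q w = 
      (\<Sum>i<N. (of_int m gchoose i) *s Y (md b k (md a (int i) v)) (m + (q - int i)) w)"
  proof -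
    have e: "(\<lambda>n w. ope a v m n w) = (\<lambda>n w. \<Sum>i<N. (of_int m gchoose i) *s Y (md a (int i) v) (n + (m - int i)) w)"
      unfolding ope_sum[OF N(1)] by (simp add: algebra_simps)
    show ?thesis
      unfolding Y_md[of b k] e nth_product_lincomb_right[OF fY fb] by (simp add: algebra_simps)
  qed
  \<comment> \<open>The scalar term is spread out as the summand i = -k so that it can be merged
    termwise.\<close>
  also have "((of_int (- k) * (of_int m gchoose nat (- k))) * K a b) *s Y v (m + q + k) w =
      (\<Sum>i<N. (if i = nat (- k) then ((of_int m gchoose i) * (of_int (int i) * K a b)) *s Y v (m + (q - int i)) w else 0))"
  proof -
    have "nat (- k) < N" using N(2) md(1) by linarith
    then show ?thesis using md(1) by (simp add: mult_ac algebra_simps)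
  qed
  also have "\<dots> + (\<Sum>i<N. (of_int m gchoose i) *s Y (md b k (md a (int i) v)) (m + (q - int i)) w)
      = ope a (md b k v) m q w"
    unfolding ope_sum[OF N'] sum.distrib[symmetric]
  proof (intro sum.cong refl)
    fix i
    have "i = nat (- k) \<longleftrightarrow> int i + k = 0" using md(1) by auto
    then show "(if i = nat (- k) then ((of_int m gchoose i) * (of_int (int i) * K a b)) *s Y v (m + (q - int i)) w else 0)
      + (of_int m gchoose i) *s Y (md b k (md a (int i) v)) (m + (q - int i)) w
      = (of_int m gchoose i) *s Y (md a (int i) (md b k v)) (m + (q - int i)) w"
      by (simp add: md_comm[of a _ b k] Y_add Y_scale scale_right_distrib)
  qed
  finally show ?case .
next
  case (add x y)
  obtain M where M: "\<forall>i\<ge>int M. md a i x = 0" using md_bound by blast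
  obtain N where N: "\<forall>i\<ge>int N. md a i y = 0" "N \<ge> M" using md_bound by blast
  have M': "\<forall>i\<ge>int N. md a i x = 0" using M N(2) by auto
  have N': "\<forall>i\<ge>int N. md a i (x + y) = 0" using M' N(1) by (simp add: lin_add[OF md_lin])
  show ?case
    using add[of m q w, symmetric]
    unfolding ope_sum[OF N(1)] ope_sum[OF N'] ope_sum[OF M']
    by (simp add: Y_add lin_add[OF md_lin] scale_right_distrib sum.distrib)
next
  case (scale c x)
  obtain N where N: "\<forall>i\<ge>int N. md a i x = 0" using md_bound by blast
  have N': "\<forall>i\<ge>int N. md a i (c *s x) = 0" using N by (simp add: lin_scale[OF md_lin])
  have "md a m (Y (c *s x) q w) - Y (c *s x) q (md a m w) = c *s ope a x m q w"
    by (simp add: Y_scale lin_scale[OF md_lin] scale_right_diff_distrib flip: scale)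
  then show ?case
    unfolding ope_sum[OF N'] ope_sum[OF N]
    by (simp add: Y_scale lin_scale[OF md_lin] scale_sum_right mult.commute)
qed

text \<open>The operator product coefficients in the step are the fields of a(i) v, so the induction
  hypothesis is needed for all second states.\<close>

lemma mutually_local_Y: "mutually_local (Y u) (Y v)"
proof (induction u arbitrary: v rule: generated_induct)
  case vac
  have f: "is_field (Y vac)" "is_field (Y v)" by (rule is_field_Y)+
  have "nth_product (Y vac) (Y v) (int t) p q w = 0" for t p q w
  proof (induction t arbitrary: p q)
    case 0
    have "nth_product (Y vac) (Y v) 0 p q w = 0"
      unfolding nth_product_zero_power[OF f] Y_vac by (simp add: lin_zero[OF is_field_lin[OF f(2)]])
    then show ?case by simp
  next
    case (Suc t)
    then show ?case using nth_product_rec[OF f, of "int t" p q w] by (simp add: add.commute)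
  qed
  then show ?case
    unfolding mutually_local_def by (metis nonneg_int_cases)
next
  case (md a k u)
  obtain N where N: "\<forall>i\<ge>int N. md a i v = 0" using md_bound by blast
  have "mutually_local (\<lambda>m. nth_product (md a) (Y u) k 0 m) (Y v)"
    by (rule mutually_local_iter[where C = "\<lambda>i. Y (md a (int i) v)" and K = N])
      (simp_all add: is_field_md is_field_Y md_Y_comm ope_sum[OF N] md.IH mutually_local_sym[OF md.IH])
  moreover have "Y (md a k u) = (\<lambda>m. nth_product (md a) (Y u) k 0 m)" by (simp add: fun_eq_iff Y_md)
  ultimately show ?case by simp
next
  case (add x y)
  obtain N M where "\<forall>k\<ge>N. \<forall>p q w. nth_product (Y x) (Y v) k p q w = 0" "\<forall>k\<ge>M. \<forall>p q w. nth_product (Y y) (Y v) k p q w = 0"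
    using add[of v] unfolding mutually_local_def by blast
  then show ?case
    unfolding mutually_local_def
    by (intro exI[of _ "max N M"]) (simp add: Y_add nth_product_add_left is_field_Y)
next
  case (scale c x)
  then show ?case 
    unfolding mutually_local_def by (simp add: Y_scale nth_product_scale_left is_field_Y) (metis scale_zero_right)
qed

end

section \<open>The operators L(n) on states and fields\<close>

locale heisenberg_quasi_conformal = heisenberg_vertex sc md K vac Y
  for sc :: "complex \<Rightarrow> 'v::ab_group_add \<Rightarrow> 'v"  (infixr "*s" 75)
    and md :: "'a \<Rightarrow> int \<Rightarrow> 'v \<Rightarrow> 'v" and K vac Y +
  fixes L :: "int \<Rightarrow> 'v \<Rightarrow> 'v"
  assumes L_lin: "n \<ge> -1 \<Longrightarrow> lin (L n)"
    and L_vac: "n \<ge> -1 \<Longrightarrow> L n vac = 0"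
    and L_md: "n \<ge> -1 \<Longrightarrow> L n (md a k w) = md a k (L n w) - of_int k *s md a (n + k) w"
begin

lemma L_bracket:
  assumes "m \<ge> -1" "n \<ge> -1"
  shows "L m (L n w) - L n (L m w) = of_int (m - n) *s L (m + n) w"
proof (cases "m + n \<ge> -1")
  case True
  let ?f = "\<lambda>w. L m (L n w) - L n (L m w) - of_int (m - n) *s L (m + n) w"
  have "?f w = 0"
  proof (rule eq_zero_if_commutes[of ?f])
    show "lin ?f"
      by (rule lin_intros(4)[OF lin_intros(4)[OF lin_comp lin_comp] lin_intros(5)])
        (simp_all add: L_lin assms True)
    show "?f vac = 0" using True assms by (simp add: L_vac lin_zero[OF L_lin])
    show "?f (md a k w) = md a k (?f w)" for a k w
    proof -
      \<comment> \<open>The terms with a single remaining L are symmetric in i and j and cancel in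
        the commutator; the last terms leave k (n+k) - k (m+k) = -k (m-n).\<close>
      have LL: "L i (L j (md a k w)) = md a k (L i (L j w)) - of_int k *s md a (i + k) (L j w)
          - of_int k *s md a (j + k) (L i w) + (of_int k * of_int (j + k)) *s md a (m + n + k) w"
        if "i \<ge> -1" "j \<ge> -1" "i + j = m + n" for i j
      proof -
        have e: "m + n + k = i + (j + k)" using that by simp
        show ?thesis
          unfolding e by (simp add: L_md lin_diff[OF L_lin] lin_scale[OF L_lin] that(1,2) scale_right_diff_distrib)
      qed
      show ?thesis
        unfolding LL[OF assms refl] LL[OF assms(2,1) add.commute] L_md[OF True] 
          lin_diff[OF md_lin] lin_scale[OF md_lin]
        by (simp add: scale_right_diff_distrib scale_left_diff_distrib scale_left_distrib distrib_left 
            left_diff_distrib right_diff_distrib mult_ac)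
    qed
  qed
  then show ?thesis by simp
next
  case False
  \<comment> \<open>Both indices are -1 here, so the coefficient m - n vanishes and nothing about
    \<open>L (-2)\<close> is required.\<close>
  then have "m = n" using assms by auto
  then show ?thesis by simp
qed

text \<open>Commuting L(n) with a(z) and integrating by parts produces -k y^(n+1) (y - z)^(k-1); the
  binomial coefficients are those of y^(n+1) = (z + (y - z))^(n+1).\<close>

lemma L_Y_comm:
  assumes n: "n \<ge> -1"
  shows "L n (Y v q w) - Y v q (L n w) =
    (\<Sum>m\<in>{-1..n}. of_nat (nat (n + 1) choose nat (m + 1)) *s Y (L m v) (q + n - m) w)"
proof (induction v arbitrary: q w rule: generated_induct)
  case vac
  show ?case by (simp add: Y_vac L_vac Y_zero lin_zero[OF L_lin[OF n]])
next
  case (md a k v)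
  note fa = is_field_md[of a] and fY = is_field_Y
  let ?c = "\<lambda>m. of_nat (nat (n + 1) choose nat (m + 1)) :: complex"
  have 1: "(\<lambda>p w. L n (md a p w) - md a p (L n w)) = (\<lambda>p w. (-1) *s of_int p *s md a (p + n) w)"
    by (simp add: fun_eq_iff L_md n add.commute)
  have 2: "(\<lambda>p w. L n (Y v p w) - Y v p (L n w)) = (\<lambda>p w. \<Sum>m\<in>{-1..n}. ?c m *s Y (L m v) (p + (n - m)) w)"
    unfolding md.IH by (simp add: add_diff_eq)
  have "L n (Y (md a k v) q w) - Y (md a k v) q (L n w)
      = - (of_int k *s nth_product (md a) (Y v) (k - 1) (0 + int (nat (n + 1))) q w)
        + (\<Sum>m\<in>{-1..n}. ?c m *s nth_product (md a) (Y (L m v)) k 0 (q + (n - m)) w)"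
    unfolding Y_md nth_product_comm[OF L_lin[OF n] fa fY] 1 2 nth_product_lincomb_right[OF fY fa]
      nth_product_scale_left[OF is_field_scale[OF fa] fY] nth_product_weight_left[OF fa fY]
    using n by simp
  also have "nth_product (md a) (Y v) (k - 1) (0 + int (nat (n + 1))) q w
      = (\<Sum>i\<le>nat (n + 1). of_nat (nat (n + 1) choose i) *s Y (md a (k - 1 + int i) v) (q + (n + 1) - int i) w)"
    unfolding nth_product_expand[OF fa fY] Y_md using n by simp
  \<comment> \<open>The exponent i of y - z corresponds to m = i - 1, as (y - z)^(k-1+i) yields
    a(k+m).\<close>
  also have "\<dots> = (\<Sum>m\<in>{-1..n}. ?c m *s Y (md a (m + k) v) (q + n - m) w)"
    by (rule sum.reindex_bij_witness[of _ "\<lambda>m. nat (m + 1)" "\<lambda>i. int i - 1"]) (use n in \<open>auto simp: algebra_simps\<close>)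
  also have "- (of_int k *s \<dots>) + (\<Sum>m\<in>{-1..n}. ?c m *s nth_product (md a) (Y (L m v)) k 0 (q + (n - m)) w)
      = (\<Sum>m\<in>{-1..n}. ?c m *s Y (L m (md a k v)) (q + n - m) w)"
    unfolding scale_sum_right sum_negf[symmetric] sum.distrib[symmetric]
    by (intro sum.cong refl)
      (simp add: L_md Y_md[symmetric] lin_diff[OF Y_lin_state] lin_scale[OF Y_lin_state] 
        scale_right_diff_distrib add_diff_eq mult.commute)
  finally show ?case .
next
  case (add x y)
  have "L n (Y (x + y) q w) - Y (x + y) q (L n w) = (L n (Y x q w) - Y x q (L n w)) + (L n (Y y q w) - Y y q (L n w))"
    by (simp add: Y_add lin_add[OF L_lin[OF n]])
  then show ?case unfolding add
    by (simp add: Y_add lin_add[OF L_lin] scale_right_distrib flip: sum.distrib)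
next
  case (scale c x)
  have "L n (Y (c *s x) q w) - Y (c *s x) q (L n w) = c *s (L n (Y x q w) - Y x q (L n w))"
    by (simp add: Y_scale lin_scale[OF L_lin[OF n]] scale_right_diff_distrib)
  then show ?case unfolding scale
    by (simp add: Y_scale lin_scale[OF L_lin] scale_sum_right mult.commute)
qed

text \<open>The term -k a(k-1) v in L(-1) a(k) v cancels the one that arises when (y - z)^k is
  differentiated.\<close>

lemma Y_translation: "Y (L (-1) v) q w = - (of_int q *s Y v (q - 1) w)"
proof (induction v arbitrary: q w rule: generated_induct)
  case vac
  show ?case by (simp add: Y_vac L_vac Y_zero)
next
  case (md a k v)
  have "Y (L (-1) (md a k v)) q w = nth_product (md a) (Y (L (-1) v)) k 0 q w - of_int k *s nth_product (md a) (Y v) (k - 1) 0 q w"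
    by (simp add: L_md lin_diff[OF Y_lin_state] lin_scale[OF Y_lin_state] Y_md)
  also have "Y (L (-1) v) = (\<lambda>n w. (-1) *s of_int n *s Y v (n - 1) w)"
    by (simp add: fun_eq_iff md.IH)
  also have "nth_product (md a) (\<lambda>n w. (-1) *s of_int n *s Y v (n - 1) w) k 0 q w
      = (-1) *s (of_int q *s nth_product (md a) (Y v) k 0 (q - 1) w - of_int k *s nth_product (md a) (Y v) (k - 1) 0 q w)"
    using is_field_scale[OF is_field_Y, of "\<lambda>n. of_int n" v "-1"]
    by (subst nth_product_scale_right[OF is_field_md]) (simp_all add: nth_product_weight_right is_field_md is_field_Y)
  finally show ?case by (simp add: Y_md)
qed (simp_all add: lin_add[OF L_lin] lin_scale[OF L_lin] Y_add Y_scale scale_right_distrib mult.commute)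

lemma L_minus_one_eq: "Y v (-2) vac = L (-1) v"
  using Y_translation[of v "-1" vac] creation[of "-1" "L (-1) v"] by simp

theorem quasi_conformal: "quasi_conformal (*s) vac Y L"
proof -
  have "vertex_algebra (*s) vac Y"
    unfolding vertex_algebra_def lin_iff_linear[symmetric] L_minus_one_eq
  proof (intro conjI allI)
    show "vector_space (*s)" by (rule vector_space_axioms)
    show "lin (\<lambda>v. Y v n w)" for n w by (rule Y_lin_state)
    show "lin (Y v n)" for v n by (rule is_field_lin[OF is_field_Y])
    show "\<exists>N. \<forall>n\<ge>N. Y v n w = 0" for v w using is_field_Y unfolding is_field_def by blast
    show "Y vac n w = (if n = -1 then w else 0)" for n w by (rule Y_vac)
    show "Y v (- 1) vac = v" for v by (simp add: creation)
    show "n \<ge> 0 \<longrightarrow> Y v n vac = 0" for v n by (simp add: creation)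
    show "L (-1) (Y v n w) - Y v n (L (-1) w) = (- of_int n) *s Y v (n - 1) w" for v n w
      unfolding L_Y_comm[OF order_refl] by (simp add: Y_translation)
    show "\<exists>N::nat. \<forall>m n w. (\<Sum>i\<le>N. ((-1) ^ i * of_nat (N choose i)) *s
      (Y u (m + int (N - i)) (Y v (n + int i) w) - Y v (n + int i) (Y u (m + int (N - i)) w))) = 0" for u v
    proof -
      obtain N where "\<forall>k\<ge>N. \<forall>p q w. nth_product (Y u) (Y v) k p q w = 0"
        using mutually_local_Y unfolding mutually_local_def by blast
      then have "\<forall>m n w. nth_product (Y u) (Y v) (int (nat N)) m n w = 0" by simp
      then show ?thesis unfolding nth_product_of_nat[OF is_field_Y is_field_Y] by blast
    qed
  qed
  then show ?thesis
    unfolding quasi_conformal_def lin_iff_linear[symmetric]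
    using L_lin L_bracket L_Y_comm by blast
qed

end

section \<open>The universal property of induced modules\<close>

text \<open>\<open>tensor_eval\<close> with arbitrary values on the symbols, so that evaluation in
  the module and the map into another space obey the same lemmas.\<close>

definition lin_ext :: "(complex \<Rightarrow> 'b \<Rightarrow> 'b) \<Rightarrow> ('x \<Rightarrow> 'b) \<Rightarrow> ('x \<Rightarrow>\<^sub>0 complex) \<Rightarrow> 'b::ab_group_add" where
  "lin_ext s \<phi> f = (\<Sum>x\<in>Poly_Mapping.keys f. s (Poly_Mapping.lookup f x) (\<phi> x))"

lemma tensor_eval_eq: "tensor_eval sv act \<iota> = lin_ext sv (\<lambda>(p, w). foldr act p (\<iota> w))"
  by (auto simp: tensor_eval_def lin_ext_def fun_eq_iff intro!: sum.cong)

lemma lookup_free_scale: "Poly_Mapping.lookup (free_scale c f) x = c * Poly_Mapping.lookup f x"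
  by (simp add: free_scale_def Poly_Mapping.map.rep_eq when_def)

lemma module_free_scale: "module free_scale"
  by standard (auto intro!: poly_mapping_eqI simp: lookup_free_scale lookup_add algebra_simps)

context complex_space
begin

lemma lin_ext_superset:
  "finite S \<Longrightarrow> Poly_Mapping.keys f \<subseteq> S \<Longrightarrow> lin_ext sc \<phi> f = (\<Sum>x\<in>S. Poly_Mapping.lookup f x *s \<phi> x)"
  unfolding lin_ext_def by (rule sum.mono_neutral_left) (auto simp: in_keys_iff)

lemma lin_ext_add: "lin_ext sc \<phi> (f + g) = lin_ext sc \<phi> f + lin_ext sc \<phi> g"
proof -
  let ?S = "Poly_Mapping.keys f \<union> Poly_Mapping.keys g"
  show ?thesis
    using lin_ext_superset[of ?S f \<phi>] lin_ext_superset[of ?S g \<phi>] lin_ext_superset[of ?S "f + g" \<phi>] Poly_Mapping.keys_add[of f g]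
    by (simp add: lookup_add scale_left_distrib sum.distrib)
qed

lemma lin_ext_scale: "lin_ext sc \<phi> (free_scale c f) = c *s lin_ext sc \<phi> f"
proof -
  have "Poly_Mapping.keys (free_scale c f) \<subseteq> Poly_Mapping.keys f"
    by (auto simp: in_keys_iff lookup_free_scale)
  then show ?thesis
    using lin_ext_superset[of "Poly_Mapping.keys f" "free_scale c f" \<phi>]
    by (simp add: lin_ext_def lookup_free_scale scale_sum_right)
qed

lemma lin_ext_diff: "lin_ext sc \<phi> (f - g) = lin_ext sc \<phi> f - lin_ext sc \<phi> g"
  using lin_ext_add[of \<phi> "f - g" g] by (simp add: algebra_simps)

lemma lin_ext_single: "lin_ext sc \<phi> (Poly_Mapping.single x c) = c *s \<phi> x"
  by (simp add: lin_ext_def)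

lemma lin_ext_span_zero:
  assumes "\<And>r. r \<in> R \<Longrightarrow> lin_ext sc \<phi> r = 0" "f \<in> module.span free_scale R"
  shows "lin_ext sc \<phi> f = 0"
proof -
  interpret P: module free_scale by (rule module_free_scale)
  have "P.subspace {f. lin_ext sc \<phi> f = 0}"
    by (rule P.subspaceI) (simp_all add: lin_ext_add lin_ext_scale lin_ext_def[of _ _ 0])
  then have "P.span R \<subseteq> {f. lin_ext sc \<phi> f = 0}" using assms(1) by (intro P.span_minimal) auto
  then show ?thesis using assms(2) by auto
qed

lemma lin_ext_in_subspace:
  assumes "subspace S" "\<And>x. \<phi> x \<in> S" shows "lin_ext sc \<phi> f \<in> S"
  unfolding lin_ext_def by (intro subspace_sum[OF assms(1)] subspace_scale[OF assms(1)] assms(2))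

end

lemma SetCompr_ball:
  "(\<forall>r\<in>{f p q x y w |p q x y w. True}. P r) \<longleftrightarrow> (\<forall>p q x y w. P (f p q x y w))"
  "(\<forall>r\<in>{f' p q c w |p q c w. True}. P r) \<longleftrightarrow> (\<forall>p q c w. P (f' p q c w))"
  "(\<forall>r\<in>{g p v w |p v w. True}. P r) \<longleftrightarrow> (\<forall>p v w. P (g p v w))"
  "(\<forall>r\<in>{h p b w |p b w. b \<in> B}. P r) \<longleftrightarrow> (\<forall>p b w. b \<in> B \<longrightarrow> P (h p b w))"
  by blast+

text \<open>Read from left to right it yields the laws of the action, from right to left the
  well-definedness of a map out of the induced module.\<close>

lemma induced_relations_zero_iff:
  assumes "vector_space sb"
  shows "(\<forall>r \<in> induced_relations sg br B sw bact. lin_ext sb \<phi> r = 0) \<longleftrightarrow>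
    (\<forall>p q x y w. \<phi> (p @ [x + y] @ q, w) = \<phi> (p @ [x] @ q, w) + \<phi> (p @ [y] @ q, w)) \<and>
    (\<forall>p q c x w. \<phi> (p @ [sg c x] @ q, w) = sb c (\<phi> (p @ [x] @ q, w))) \<and>
    (\<forall>p v w. \<phi> (p, v + w) = \<phi> (p, v) + \<phi> (p, w)) \<and>
    (\<forall>p c w. \<phi> (p, sw c w) = sb c (\<phi> (p, w))) \<and>
    (\<forall>p q x y w. \<phi> (p @ [x, y] @ q, w) - \<phi> (p @ [y, x] @ q, w) = \<phi> (p @ [br x y] @ q, w)) \<and>
    (\<forall>p b w. b \<in> B \<longrightarrow> \<phi> (p @ [b], w) = \<phi> (p, bact b w))"
proof -
  interpret complex_space sb using assms by (simp add: complex_space_def)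
  show ?thesis
    unfolding induced_relations_def ball_Un conj_assoc SetCompr_ball lin_ext_diff lin_ext_scale
      lin_ext_single scale_one right_minus_eq
    by (simp only: diff_eq_eq add.commute)
qed

locale induced_module =
  fixes sg :: "complex \<Rightarrow> 'g \<Rightarrow> 'g::ab_group_add" and br :: "'g \<Rightarrow> 'g \<Rightarrow> 'g" and B :: "'g set"
    and sw :: "complex \<Rightarrow> 'w \<Rightarrow> 'w::ab_group_add" and bact :: "'g \<Rightarrow> 'w \<Rightarrow> 'w"
    and sv :: "complex \<Rightarrow> 'v \<Rightarrow> 'v::ab_group_add" and act :: "'g \<Rightarrow> 'v \<Rightarrow> 'v" and \<iota> :: "'w \<Rightarrow> 'v"
  assumes induced: "is_induced_module sg br B sw bact sv act \<iota>"
begin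

sublocale complex_space sv
  using induced by (simp add: complex_space_def is_induced_module_def)

abbreviation word :: "'g list \<times> 'w \<Rightarrow> 'v" where
  "word \<equiv> \<lambda>(p, w). foldr act p (\<iota> w)"

lemma act_lin: "lin (act x)"
  using induced by (simp add: is_induced_module_def lin_iff_linear)

lemma ex_words: "\<exists>f. v = lin_ext sv word f"
  using induced unfolding is_induced_module_def tensor_eval_eq by (metis UNIV_I image_iff)

lemma relations_kernel: "lin_ext sv word f = 0 \<longleftrightarrow> f \<in> module.span free_scale (induced_relations sg br B sw bact)"
  using induced unfolding is_induced_module_def tensor_eval_eq by (metis (mono_tags) mem_Collect_eq)

lemma word_relations:
  shows act_add_word: "foldr act (p @ [x + y] @ q) (\<iota> w) = foldr act (p @ [x] @ q) (\<iota> w) + foldr act (p @ [y] @ q) (\<iota> w)"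
    and act_scale_word: "foldr act (p @ [sg c x] @ q) (\<iota> w) = sv c (foldr act (p @ [x] @ q) (\<iota> w))"
    and act_bracket_word: "foldr act (p @ [x, y] @ q) (\<iota> w) - foldr act (p @ [y, x] @ q) (\<iota> w) = foldr act (p @ [br x y] @ q) (\<iota> w)"
    and act_B_word: "b \<in> B \<Longrightarrow> foldr act (p @ [b]) (\<iota> w) = foldr act p (\<iota> (bact b w))"
proof -
  interpret P: module free_scale by (rule module_free_scale)
  have "\<forall>r\<in>induced_relations sg br B sw bact. lin_ext sv word r = 0"
    using P.span_base relations_kernel by blast
  note R = this[unfolded induced_relations_zero_iff[OF vector_space_axioms] prod.case]
  show "foldr act (p @ [x + y] @ q) (\<iota> w) = foldr act (p @ [x] @ q) (\<iota> w) + foldr act (p @ [y] @ q) (\<iota> w)"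
    by (rule R[THEN conjunct1, rule_format])
  show "foldr act (p @ [sg c x] @ q) (\<iota> w) = sv c (foldr act (p @ [x] @ q) (\<iota> w))"
    by (rule R[THEN conjunct2, THEN conjunct1, rule_format])
  show "foldr act (p @ [x, y] @ q) (\<iota> w) - foldr act (p @ [y, x] @ q) (\<iota> w) = foldr act (p @ [br x y] @ q) (\<iota> w)"
    by (rule R[THEN conjunct2, THEN conjunct2, THEN conjunct2, THEN conjunct2, THEN conjunct1, rule_format])
  show "b \<in> B \<Longrightarrow> foldr act (p @ [b]) (\<iota> w) = foldr act p (\<iota> (bact b w))"
    by (rule R[THEN conjunct2, THEN conjunct2, THEN conjunct2, THEN conjunct2, THEN conjunct2, rule_format])
qed

lemma words_in_subspace:
  assumes "subspace S" "\<And>p w. foldr act p (\<iota> w) \<in> S"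
  shows "v \<in> S"
proof -
  obtain f where "v = lin_ext sv word f" using ex_words by blast
  moreover have "word x \<in> S" for x by (cases x) (simp add: assms(2))
  ultimately show ?thesis by (simp add: lin_ext_in_subspace[OF assms(1)])
qed

lemma eq_if_eq_on_words:
  assumes "lin f" "lin g" "\<And>p w. f (foldr act p (\<iota> w)) = g (foldr act p (\<iota> w))"
  shows "f v = g v"
proof -
  have "subspace {v. f v = g v}"
    using assms(1,2) by (intro subspaceI) (simp_all add: lin_simps)
  then have "v \<in> {v. f v = g v}" by (rule words_in_subspace) (simp add: assms(3))
  then show ?thesis by simp
qed

lemma act_add: "act (x + y) v = act x v + act y v"
  by (rule eq_if_eq_on_words[OF act_lin lin_intros(3)[OF act_lin act_lin]])
    (use act_add_word[of "[]"] in simp)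

lemma act_scale: "act (sg c x) v = sv c (act x v)"
  by (rule eq_if_eq_on_words[OF act_lin lin_intros(5)[OF act_lin]])
    (use act_scale_word[of "[]"] in simp)

lemma act_bracket: "act x (act y v) - act y (act x v) = act (br x y) v"
  by (rule eq_if_eq_on_words[OF lin_intros(4)[OF lin_comp[OF act_lin act_lin] lin_comp[OF act_lin act_lin]] act_lin])
    (use act_bracket_word[of "[]"] in simp)

lemma act_B: "b \<in> B \<Longrightarrow> act b (\<iota> w) = \<iota> (bact b w)"
  using act_B_word[of b "[]"] by simp

lemma act_zero: "act 0 v = 0"
  using act_add[of 0 0 v] by simp

text \<open>The subspace \<open>G\<close> is there because the \<open>n\<close>-th products satisfy the bracket relation only on
  truncated fields, not on arbitrary families of operators.\<close>

lemma universal: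
  assumes sb: "vector_space sb" and G: "module.subspace sb G"
    and X_closed: "\<And>x b. b \<in> G \<Longrightarrow> X x b \<in> G"
    and X_add: "\<And>x b c. b \<in> G \<Longrightarrow> c \<in> G \<Longrightarrow> X x (b + c) = X x b + X x c"
    and X_scale: "\<And>x b c. b \<in> G \<Longrightarrow> X x (sb c b) = sb c (X x b)"
    and X_add_left: "\<And>x y b. b \<in> G \<Longrightarrow> X (x + y) b = X x b + X y b"
    and X_scale_left: "\<And>x c b. b \<in> G \<Longrightarrow> X (sg c x) b = sb c (X x b)"
    and X_bracket: "\<And>x y b. b \<in> G \<Longrightarrow> X x (X y b) - X y (X x b) = X (br x y) b"
    and \<psi>: "\<And>w. \<psi> w \<in> G" "\<And>v w. \<psi> (v + w) = \<psi> v + \<psi> w" "\<And>c w. \<psi> (sw c w) = sb c (\<psi> w)"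
    and X_B: "\<And>b w. b \<in> B \<Longrightarrow> X b (\<psi> w) = \<psi> (bact b w)"
  obtains h where "\<And>x y. h (x + y) = h x + h y" "\<And>c x. h (sv c x) = sb c (h x)"
    "\<And>w. h (\<iota> w) = \<psi> w" "\<And>x v. h (act x v) = X x (h v)"
proof -
  interpret b: complex_space sb using sb by (simp add: complex_space_def)
  define \<phi> where "\<phi> = (\<lambda>(p, w). foldr X p (\<psi> w))"
  have foldr_in: "foldr X p b \<in> G" if "b \<in> G" for p b
    using that by (induction p) (auto intro: X_closed)
  have foldr_add: "foldr X p (b + c) = foldr X p b + foldr X p c" if "b \<in> G" "c \<in> G" for p b c
    using that by (induction p) (auto simp: X_add foldr_in)
  have foldr_scale: "foldr X p (sb c b) = sb c (foldr X p b)" if "b \<in> G" for p b c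
    using that by (induction p) (auto simp: X_scale foldr_in)
  have foldr_diff: "foldr X p b - foldr X p c = foldr X p (b - c)" if "b \<in> G" "c \<in> G" for p b c
    using foldr_add[of "b - c" c p] that b.subspace_diff[OF G] by (simp add: algebra_simps)
  have "\<forall>r\<in>induced_relations sg br B sw bact. lin_ext sb \<phi> r = 0"
    unfolding induced_relations_zero_iff[OF sb] \<phi>_def
    by (simp add: X_add_left X_scale_left X_bracket X_B foldr_in \<psi> foldr_add foldr_scale foldr_diff X_closed)
  then have kernel: "lin_ext sb \<phi> f = 0" if "lin_ext sv word f = 0" for f
    using b.lin_ext_span_zero that relations_kernel by metis
  \<comment> \<open>A representing combination of words is chosen; \<open>kernel\<close> makes the
    value independent of the choice.\<close>
  define h where "h v = lin_ext sb \<phi> (SOME f. v = lin_ext sv word f)" for v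
  have h_eq: "h (lin_ext sv word f) = lin_ext sb \<phi> f" for f
  proof -
    define g where "g = (SOME g. lin_ext sv word f = lin_ext sv word g)"
    have "lin_ext sv word f = lin_ext sv word g" unfolding g_def by (rule someI) (rule refl)
    then have "lin_ext sb \<phi> (f - g) = 0" by (intro kernel) (simp add: lin_ext_diff)
    then show ?thesis by (simp add: h_def g_def b.lin_ext_diff)
  qed
  have h_word: "h (foldr act p (\<iota> w)) = foldr X p (\<psi> w)" for p w
    using h_eq[of "Poly_Mapping.single (p, w) 1"] by (simp add: lin_ext_single b.lin_ext_single \<phi>_def)
  have h_add: "h (x + y) = h x + h y" for x y
    using ex_words[of x] ex_words[of y] h_eq by (metis b.lin_ext_add lin_ext_add)
  have h_scale: "h (sv c x) = sb c (h x)" for c x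
    using ex_words[of x] h_eq by (metis b.lin_ext_scale lin_ext_scale)
  \<comment> \<open>Membership in \<open>G\<close> is carried along because the laws of
    \<open>X\<close> hold only there.\<close>
  have "subspace {v. h v \<in> G \<and> (\<forall>x. h (act x v) = X x (h v))}"
  proof (rule subspaceI)
    have "h 0 = 0" using h_scale[of 0 0] by simp
    moreover have "X x 0 = 0" for x using X_scale[of 0 x 0] b.subspace_0[OF G] by simp
    ultimately show "0 \<in> {v. h v \<in> G \<and> (\<forall>x. h (act x v) = X x (h v))}"
      using b.subspace_0[OF G] by (simp add: lin_zero[OF act_lin])
  qed (simp_all add: h_add h_scale b.subspace_add[OF G] b.subspace_scale[OF G] lin_add[OF act_lin]
      lin_scale[OF act_lin] X_add X_scale)
  then have "v \<in> {v. h v \<in> G \<and> (\<forall>x. h (act x v) = X x (h v))}" for v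
  proof (rule words_in_subspace)
    show "foldr act p (\<iota> w) \<in> {v. h v \<in> G \<and> (\<forall>x. h (act x v) = X x (h v))}" for p w
      using h_word[of "_ # p" w] by (simp add: h_word foldr_in \<psi>)
  qed
  then show ?thesis using that[of h] h_add h_scale h_word[of "[]"] by simp
qed

end

section \<open>The state-field map of \<open>M(l)\<close>\<close>

lemma poly_mapping_sum_single: "(\<Sum>n\<in>Poly_Mapping.keys f. Poly_Mapping.single n (Poly_Mapping.lookup f n)) = f"
  by (rule poly_mapping_eqI) (simp add: lookup_sum lookup_single when_def in_keys_iff)

locale M_module =
  fixes sh :: "complex \<Rightarrow> 'h \<Rightarrow> 'h::ab_group_add" and form :: "'h \<Rightarrow> 'h \<Rightarrow> complex" and l :: complex
    and sv :: "complex \<Rightarrow> 'v \<Rightarrow> 'v::ab_group_add" and act :: "'h affine \<Rightarrow> 'v \<Rightarrow> 'v" and vac :: 'v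
  assumes sh: "vector_space sh" and form: "nondegenerate_symmetric_form sh form"
    and M: "is_M sh form l sv act vac"
begin

sublocale induced_module "affine_scale sh" "affine_bracket form" affine_nonneg
  "(*)" "\<lambda>X z. l * snd X * z" sv act "\<lambda>z. sv z vac"
  using M by (simp add: is_M_def induced_module_def)

notation sv (infixr "*s" 75)

interpretation h: vector_space sh by (rule sh)

lemma form_sym: "form x y = form y x"
  and form_add: "form x (y + z) = form x y + form x z"
  and form_scale: "form x (sh c y) = c * form x y"
  using form unfolding nondegenerate_symmetric_form_def Vector_Spaces.linear_def module_hom_def module_hom_axioms_def
  by blast+

lemma form_zero [simp]: "form x 0 = 0" "form 0 x = 0"
  using form_add[of x 0 0] form_sym[of 0 x] by simp_all

text \<open>The level enters here because the bracket is a multiple of the central element, which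
  acts as l.\<close>

definition pairing :: "'h poly \<Rightarrow> 'h poly \<Rightarrow> complex" where
  "pairing a b = l * (\<Sum>j\<le>degree a. form (coeff a j) (coeff b j))"

lemma pairing_zero [simp]: "pairing a 0 = 0" "pairing 0 a = 0"
  by (simp_all add: pairing_def)

lemma mode_lin: "lin (mode act a n)"
  by (simp add: mode_def act_lin)

lemma mode_add: "mode act (a + b) n v = mode act a n v + mode act b n v"
  using act_add[of "(Poly_Mapping.single n a, 0)" "(Poly_Mapping.single n b, 0)" v]
  by (simp add: mode_def single_add)

lemma mode_zero: "mode act 0 n v = 0"
  using mode_add[of 0 0 n v] by simp

lemma mode_scale: "mode act (map_poly (sh c) a) n v = c *s mode act a n v"
  using act_scale[of c "(Poly_Mapping.single n a, 0)" v]
  by (simp add: mode_def affine_scale_def)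

text \<open>Having zero bracket with everything, a central element moves through a word to the
  vacuum, where it lies in \<open>affine_nonneg\<close> and acts by the given scalar.\<close>

lemma act_central: "act (0, c) v = (l * c) *s v"
proof (rule eq_if_eq_on_words[of "act (0, c)" "\<lambda>v. (l * c) *s v"])
  show "act (0, c) (foldr act p (z *s vac)) = (l * c) *s foldr act p (z *s vac)" for p z
  proof (induction p)
    case Nil
    have "(0, c) \<in> affine_nonneg" by (simp add: affine_nonneg_def)
    from act_B[OF this, of z] show ?case by simp
  next
    case (Cons x p)
    have "affine_bracket form (0, c) x = 0" by (simp add: affine_bracket_def zero_prod_def)
    then have "act (0, c) (act x v) = act x (act (0, c) v)" for v
      using act_bracket[of "(0, c)" x v] by (simp add: act_zero)
    then show ?case using Cons by (simp add: lin_scale[OF act_lin])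
  qed
qed (simp_all add: act_lin lin_intros)

lemma act_eq_modes:
  "act X v = (\<Sum>n\<in>Poly_Mapping.keys (fst X). mode act (Poly_Mapping.lookup (fst X) n) n v) + (l * snd X) *s v"
proof -
  have *: "act (\<Sum>n\<in>S. g n, 0) v = (\<Sum>n\<in>S. act (g n, 0) v)" if "finite S" for S and g :: "int \<Rightarrow> int \<Rightarrow>\<^sub>0 'h poly"
    using that
  proof (induction S rule: finite_induct)
    case empty
    show ?case using act_zero by (simp add: zero_prod_def)
  next
    case (insert x S)
    then show ?case using act_add[of "(g x, 0)" "(sum g S, 0)" v] by simp
  qed
  have "act X v = act (fst X, 0) v + act (0, snd X) v"
    using act_add[of "(fst X, 0)" "(0, snd X)" v] by simp
  also have "act (fst X, 0) v = (\<Sum>n\<in>Poly_Mapping.keys (fst X). mode act (Poly_Mapping.lookup (fst X) n) n v)"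
    unfolding mode_def by (subst poly_mapping_sum_single[of "fst X", symmetric], subst *) simp_all
  finally show ?thesis by (simp add: act_central)
qed

lemma mode_comm: "mode act a i (mode act b j w) =
  mode act b j (mode act a i w) + (if i + j = 0 then of_int i * pairing a b else 0) *s w"
proof -
  have "affine_bracket form (Poly_Mapping.single i a, 0) (Poly_Mapping.single j b, 0)
     = (0, if i + j = 0 then of_int i * (\<Sum>j\<le>degree a. form (coeff a j) (coeff b j)) else 0)"
    by (auto simp: affine_bracket_def lookup_single when_def)
  then show ?thesis
    using act_bracket[of "(Poly_Mapping.single i a, 0)" "(Poly_Mapping.single j b, 0)" w]
    by (simp add: mode_def act_central pairing_def algebra_simps)
qed

lemma mode_vac: "n \<ge> 0 \<Longrightarrow> mode act a n vac = 0"
  using act_B[of "(Poly_Mapping.single n a, 0)" 1]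
  by (simp add: mode_def affine_nonneg_def lookup_single)

sublocale heisenberg_module sv "mode act" pairing vac
proof
  show "lin (mode act a n)" for a n by (rule mode_lin)
  show "mode act a n vac = 0" if "n \<ge> 0" for a n using that by (rule mode_vac)
  show "mode act a i (mode act b j w) =
    mode act b j (mode act a i w) + (if i + j = 0 then of_int i * pairing a b else 0) *s w" for a i b j w
    by (rule mode_comm)
  fix S v assume S: "subspace S" "vac \<in> S" "\<And>a k v. v \<in> S \<Longrightarrow> mode act a k v \<in> S"
  show "v \<in> S"
  proof (rule words_in_subspace[OF S(1)])
    show "foldr act p (z *s vac) \<in> S" for p z
      by (induction p)
        (auto simp: act_eq_modes S intro!: subspace_add[OF S(1)] subspace_scale[OF S(1)] subspace_sum[OF S(1)])
  qed
qed

section \<open>The affinization acting on fields\<close>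

definition field_act :: "'h affine \<Rightarrow> (int \<Rightarrow> 'v \<Rightarrow> 'v) \<Rightarrow> int \<Rightarrow> 'v \<Rightarrow> 'v" where
  "field_act X A q w =
    (\<Sum>n\<in>Poly_Mapping.keys (fst X). nth_product (mode act (Poly_Mapping.lookup (fst X) n)) A n 0 q w) + (l * snd X) *s A q w"

lemma nth_product_mode_zero: "nth_product (mode act 0) A k p q w = 0" if "is_field A"
proof -
  have "mode act 0 = (\<lambda>n w. 0)" by (simp add: fun_eq_iff mode_zero)
  then show ?thesis by (simp add: nth_product_def expansion_zero_left expansion_zero_right that)
qed

text \<open>Sums over the keys of different elements become comparable on a common index
  set.\<close>

lemma field_act_superset:
  assumes "is_field A" "finite S" "Poly_Mapping.keys (fst X) \<subseteq> S"
  shows "field_act X A q w = (\<Sum>n\<in>S. nth_product (mode act (Poly_Mapping.lookup (fst X) n)) A n 0 q w) + (l * snd X) *s A q w"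
  unfolding field_act_def
  by (rule arg_cong2[of _ _ _ _ "(+)"], rule sum.mono_neutral_left)
    (use assms in \<open>auto simp: in_keys_iff nth_product_mode_zero\<close>)

lemma is_field_field_act: "is_field A \<Longrightarrow> is_field (field_act X A)"
  unfolding field_act_def[abs_def]
  by (intro is_field_add is_field_sum is_field_cmult is_field_nth_product is_field_md)

lemma field_act_add: "field_act (X + X') A = (\<lambda>q w. field_act X A q w + field_act X' A q w)" if A: "is_field A"
proof (intro ext)
  fix q w
  let ?S = "Poly_Mapping.keys (fst X) \<union> Poly_Mapping.keys (fst X')"
  have "mode act (a + b) = (\<lambda>n w. mode act a n w + mode act b n w)" for a b
    by (simp add: fun_eq_iff mode_add)
  then show "field_act (X + X') A q w = field_act X A q w + field_act X' A q w"
    using field_act_superset[OF A, of ?S X q w] field_act_superset[OF A, of ?S X' q w]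
      field_act_superset[OF A, of ?S "X + X'" q w] Poly_Mapping.keys_add[of "fst X" "fst X'"]
    by (simp add: lookup_add nth_product_add_left is_field_md A sum.distrib algebra_simps)
qed

lemma lookup_map_poly: "Poly_Mapping.lookup (Poly_Mapping.map (map_poly (sh c)) f) n = map_poly (sh c) (Poly_Mapping.lookup f n)"
  by (simp add: Poly_Mapping.map.rep_eq when_def)

lemma field_act_scale: "field_act (affine_scale sh c X) A = (\<lambda>q w. c *s field_act X A q w)" if A: "is_field A"
proof (intro ext)
  fix q w
  let ?S = "Poly_Mapping.keys (fst X)"
  have "Poly_Mapping.keys (fst (affine_scale sh c X)) \<subseteq> ?S"
    by (cases X) (auto simp: affine_scale_def in_keys_iff lookup_map_poly)
  moreover have "mode act (map_poly (sh c) a) = (\<lambda>n w. c *s mode act a n w)" for a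
    by (simp add: fun_eq_iff mode_scale)
  ultimately show "field_act (affine_scale sh c X) A q w = c *s field_act X A q w"
    using field_act_superset[OF A, of ?S "affine_scale sh c X" q w]
    by (cases X) (simp add: affine_scale_def field_act_def lookup_map_poly nth_product_scale_left is_field_md A
      scale_right_distrib scale_sum_right mult_ac)
qed

text \<open>Contributions involving a central part are symmetric in \<open>X\<close> and
  \<open>X'\<close> and cancel; the double sum is treated by \<open>nth_product_commute\<close>, and
  m + n = 0 picks out the pairs in the bracket.\<close>

lemma field_act_bracket:
  assumes A: "is_field A"
  shows "field_act X (field_act X' A) q w - field_act X' (field_act X A) q w = field_act (affine_bracket form X X') A q w"
proof -
  let ?a = "Poly_Mapping.lookup (fst X)" and ?S = "Poly_Mapping.keys (fst X)"
  let ?b = "Poly_Mapping.lookup (fst X')" and ?T = "Poly_Mapping.keys (fst X')"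
  have expand: "field_act X (field_act X' A) q w
      = (\<Sum>m\<in>Poly_Mapping.keys (fst X). \<Sum>n\<in>Poly_Mapping.keys (fst X'). nth_product (mode act (Poly_Mapping.lookup (fst X) m))
          (nth_product (mode act (Poly_Mapping.lookup (fst X') n)) A n 0) m 0 q w)
      + (l * snd X') *s (\<Sum>m\<in>Poly_Mapping.keys (fst X). nth_product (mode act (Poly_Mapping.lookup (fst X) m)) A m 0 q w)
      + (l * snd X) *s (\<Sum>m\<in>Poly_Mapping.keys (fst X'). nth_product (mode act (Poly_Mapping.lookup (fst X') m)) A m 0 q w)
      + (l * snd X * (l * snd X')) *s A q w" for X X'
  proof -
    have f: "is_field (nth_product (mode act a) A n 0)" for a n
      using is_field_nth_product[OF is_field_md A] by (simp add: eta_contract_eq)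
    have e: "field_act X' A = (\<lambda>q w. (\<Sum>n\<in>Poly_Mapping.keys (fst X').
        nth_product (mode act (Poly_Mapping.lookup (fst X') n)) A n 0 q w) + (l * snd X') *s A q w)"
      by (simp add: fun_eq_iff field_act_def)
    show ?thesis
      unfolding field_act_def[of X] e
      by (simp add: nth_product_add_right[OF is_field_md is_field_sum[OF f] is_field_cmult[OF A]]
        nth_product_sum_right[OF f is_field_md] nth_product_scale_right[OF is_field_md A] sum.distrib scale_sum_right
        scale_right_distrib)
  qed
  have "field_act X (field_act X' A) q w - field_act X' (field_act X A) q w
    = (\<Sum>m\<in>?S. \<Sum>n\<in>?T. nth_product (mode act (?a m)) (nth_product (mode act (?b n)) A n 0) m 0 q w)
     - (\<Sum>m\<in>?S. \<Sum>n\<in>?T. nth_product (mode act (?b n)) (nth_product (mode act (?a m)) A m 0) n 0 q w)"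
    unfolding expand by (subst (3) sum.swap) (simp add: algebra_simps)
  also have "\<dots> = (\<Sum>m\<in>?S. \<Sum>n\<in>?T. (if m + n = 0 then of_int m * pairing (?a m) (?b n) else 0) *s A q w)"
    unfolding sum_subtractf[symmetric]
  proof (intro sum.cong refl)
    fix m n
    show "nth_product (mode act (?a m)) (nth_product (mode act (?b n)) A n 0) m 0 q w
        - nth_product (mode act (?b n)) (nth_product (mode act (?a m)) A m 0) n 0 q w
      = (if m + n = 0 then of_int m * pairing (?a m) (?b n) else 0) *s A q w"
      using nth_product_commute[OF is_field_md is_field_md A md_comm, of "?a m" "?b n" n m q w]
      by (simp only: diff_eq_eq add.commute)
  qed
  also have "\<dots> = (\<Sum>m\<in>?S. \<Sum>n\<in>?T. (if m + n = 0 then of_int m * pairing (?a m) (?b n) else 0)) *s A q w"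
    by (simp add: scale_sum_left)
  also have "(\<Sum>m\<in>?S. \<Sum>n\<in>?T. (if m + n = 0 then of_int m * pairing (?a m) (?b n) else 0))
     = (\<Sum>m\<in>?S. of_int m * pairing (?a m) (?b (- m)))"
  proof (rule sum.cong[OF refl])
    fix m
    have "(\<Sum>n\<in>?T. (if m + n = 0 then of_int m * pairing (?a m) (?b n) else 0))
      = (\<Sum>n\<in>?T. (if n = - m then of_int m * pairing (?a m) (?b n) else 0))"
      by (intro sum.cong) auto
    then show "(\<Sum>n\<in>?T. (if m + n = 0 then of_int m * pairing (?a m) (?b n) else 0)) = of_int m * pairing (?a m) (?b (- m))"
      by (simp add: in_keys_iff)
  qed
  also have "\<dots> *s A q w = field_act (affine_bracket form X X') A q w"
    by (simp add: field_act_def affine_bracket_def pairing_def sum_distrib_left mult_ac)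
  finally show ?thesis .
qed

lemma ex_state_field_map: "\<exists>Y. heisenberg_vertex sv (mode act) pairing vac Y"
proof -
  define sb where "sb = (\<lambda>c (A :: int \<Rightarrow> 'v \<Rightarrow> 'v) n w. c *s A n w)"
  \<comment> \<open>The identity field is constant in z, and z^0 belongs to the mode -1.\<close>
  define Id where "Id = (\<lambda>(n::int) (w::'v). if n = -1 then w else 0)"
  have sb: "vector_space sb"
    by standard (simp_all add: sb_def fun_eq_iff plus_fun_def scale_right_distrib scale_left_distrib)
  interpret b: vector_space sb by (rule sb)
  have Id: "is_field Id"
  proof -
    have "\<forall>n\<ge>0. Id n w = 0" for w by (simp add: Id_def)
    moreover have "lin (Id n)" for n by (simp add: lin_def Id_def)
    ultimately show ?thesis unfolding is_field_def by blast
  qed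
  \<comment> \<open>This is the image of the relation that nonnegative modes annihilate the
    vacuum.\<close>
  have nth_product_Id: "nth_product (mode act a) Id (int n) p q w = 0" for a n p q w
  proof (induction n arbitrary: p q)
    case 0
    have "nth_product (mode act a) Id 0 p q w = 0"
      unfolding nth_product_zero_power[OF is_field_md Id] unfolding Id_def by (simp add: lin_zero[OF md_lin])
    then show ?case by simp
  next
    case (Suc n)
    then show ?case using nth_product_rec[OF is_field_md Id, of a "int n" p q w] by (simp add: add.commute)
  qed
  obtain h where h: "\<And>x y. h (x + y) = h x + h y" "\<And>c x. h (c *s x) = sb c (h x)"
    "\<And>z. h (z *s vac) = sb z Id" "\<And>x v. h (act x v) = field_act x (h v)"
  proof (rule universal[of sb "Collect is_field" field_act "\<lambda>z. sb z Id"])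
    show "vector_space sb" by (rule sb)
    show "b.subspace (Collect is_field)"
      by (rule b.subspaceI) (simp_all add: sb_def plus_fun_def zero_fun_def is_field_zero is_field_add is_field_cmult)
    show "field_act x A \<in> Collect is_field" if "A \<in> Collect is_field" for x A
      using that by (simp add: is_field_field_act)
    show "field_act x (A + B) = field_act x A + field_act x B" if "A \<in> Collect is_field" "B \<in> Collect is_field" for x A B
      using that by (simp add: fun_eq_iff plus_fun_def field_act_def nth_product_add_right is_field_md sum.distrib scale_right_distrib)
    show "field_act x (sb c A) = sb c (field_act x A)" if "A \<in> Collect is_field" for x A c
      using that by (simp add: fun_eq_iff sb_def field_act_def nth_product_scale_right is_field_md scale_sum_right scale_right_distrib mult.commute)
    show "field_act (x + y) A = field_act x A + field_act y A" if "A \<in> Collect is_field" for x y A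
      using that by (simp add: field_act_add fun_eq_iff plus_fun_def)
    show "field_act (affine_scale sh c x) A = sb c (field_act x A)" if "A \<in> Collect is_field" for c x A
      using that by (simp add: field_act_scale fun_eq_iff sb_def)
    show "field_act x (field_act y A) - field_act y (field_act x A) = field_act (affine_bracket form x y) A"
      if "A \<in> Collect is_field" for x y A
      using that by (simp add: field_act_bracket fun_eq_iff)
    show "sb z Id \<in> Collect is_field" for z by (simp add: sb_def Id is_field_cmult)
    show "sb (v + w) Id = sb v Id + sb w Id" for v w by (rule b.scale_left_distrib)
    show "sb (c * w) Id = sb c (sb w Id)" for c w by simp
    show "field_act b (sb w Id) = sb (l * snd b * w) Id" if "b \<in> affine_nonneg" for b w
    proof -
      have "nth_product (mode act (Poly_Mapping.lookup (fst b) n)) (\<lambda>n u. w *s Id n u) n 0 q u = 0"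
        if n: "n \<in> Poly_Mapping.keys (fst b)" for n q u
      proof -
        have "n = int (nat n)" using n \<open>b \<in> affine_nonneg\<close> by (cases "n < 0") (auto simp: affine_nonneg_def in_keys_iff)
        then show ?thesis using nth_product_Id[of _ "nat n"] by (simp add: nth_product_scale_right is_field_md Id)
      qed
      then show ?thesis by (simp add: fun_eq_iff field_act_def sb_def)
    qed
  qed blast
  have "heisenberg_vertex sv (mode act) pairing vac h"
  proof
    show "lin (\<lambda>v. h v n w)" for n w by (simp add: lin_def h sb_def plus_fun_def)
    show "h vac n w = (if n = -1 then w else 0)" for n w
      using h(3)[of 1] by (simp add: Id_def)
    \<comment> \<open>\<open>universal\<close> does not export that its values lie in the subspace,
      so this is recovered on words; it is used for a = 0, where \<open>Poly_Mapping.single\<close>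
      has no keys.\<close>
    have "v \<in> {v. is_field (h v)}" for v
    proof (rule words_in_subspace)
      show "subspace {v. is_field (h v)}"
        using h(1,2) h(2)[of 0 0] 
        by (intro subspaceI) (simp_all add: sb_def plus_fun_def is_field_add is_field_cmult is_field_zero)
      show "foldr act p (z *s vac) \<in> {v. is_field (h v)}" for p z
        using h(3)[of 1]
        by (induction p) (simp_all add: h(2,4) is_field_field_act Id is_field_cmult sb_def)
    qed
    moreover have "h 0 q w = 0" for q w using h(2)[of 0 0] by (simp add: sb_def)
    ultimately show "h (mode act a k v) q w = nth_product (mode act a) (h v) k 0 q w" for a k v q w
      by (cases "a = 0") (simp_all add: mode_def[of _ a k] h field_act_def nth_product_mode_zero mode_zero)
  qed
  then show ?thesis by blast
qed

end

section \<open>Normally ordered products\<close>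

text \<open>The three ranges of p in the k-th factor: p = j >= 0 gives the mode -k - j, p = -k - j
  gives the mode j, and in between the coefficient is zero. The first two match the expansions of (y
  - z)^(-k).\<close>

lemma gchoose_field_coeff:
  assumes "k \<ge> 1"
  shows "(of_int (int j + int k - 1) gchoose (k - 1)) = signed_binomial (- int k) j"
    and "(of_int (- int k - int j + int k - 1) gchoose (k - 1)) = - (neg_one_pow (- int k) * signed_binomial (- int k) j)"
    and "p < 0 \<Longrightarrow> - p - int k < 0 \<Longrightarrow> (of_int (p + int k - 1) gchoose (k - 1)) = (0 :: complex)"
proof -
  have e: "(k + j - 1) choose j = ((k + j - 1) choose (k - 1))"
    using assms binomial_symmetric[of j "k + j - 1"] by simp
  have "int j + int k - 1 = int (k + j - 1)" using assms by simp
  then have 1: "(of_int (int j + int k - 1) gchoose (k - 1)) = (of_nat ((k + j - 1) choose (k - 1)) :: complex)"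
    by (simp only: of_int_of_nat_eq binomial_gbinomial)
  show "(of_int (int j + int k - 1) gchoose (k - 1)) = signed_binomial (- int k) j"
    unfolding 1 using signed_binomial_neg[of k j] assms e by simp
  have "(of_int (- int k - int j + int k - 1) gchoose (k - 1)) = (- of_nat (j + 1) gchoose (k - 1) :: complex)"
    by (rule arg_cong2[of _ _ _ _ "(gchoose)"]) simp_all
  also have "\<dots> = (-1) ^ (k - 1) * ((of_nat (j + 1) + of_nat (k - 1) - 1) gchoose (k - 1))"
    by (rule gbinomial_minus)
  also have "(of_nat (j + 1) + of_nat (k - 1) - 1 :: complex) = of_nat (k + j - 1)"
    using assms by (simp add: of_nat_diff)
  also have "(of_nat (k + j - 1) gchoose (k - 1) :: complex) = signed_binomial (- int k) j"
    unfolding binomial_gbinomial[symmetric] using signed_binomial_neg[of k j] assms e by simp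
  also have "(-1) ^ (k - 1) = - neg_one_pow (- int k)"
    using assms by (cases k) (auto simp: neg_one_pow_def)
  finally show "(of_int (- int k - int j + int k - 1) gchoose (k - 1)) = - (neg_one_pow (- int k) * signed_binomial (- int k) j)"
    by simp
  assume "p < 0" "- p - int k < 0"
  then have "p + int k - 1 = int (nat (p + int k - 1))" "nat (p + int k - 1) < k - 1" by auto
  then show "(of_int (p + int k - 1) gchoose (k - 1)) = (0 :: complex)"
    by (metis binomial_eq_0 binomial_gbinomial of_int_of_nat_eq of_nat_0)
qed

context M_module
begin

lemma foldr_mode_nonneg_comm:
  assumes "n \<ge> 0" "\<forall>(b, m)\<in>set ops. m \<ge> 0"
  shows "foldr (\<lambda>(a, n). mode act a n) ops (mode act a n w) = mode act a n (foldr (\<lambda>(a, n). mode act a n) ops w)"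
  using assms(2) by (induction ops) (use assms(1) in \<open>auto simp: mode_comm[of _ _ a n]\<close>)

text \<open>A leading nonnegative mode may act first instead of in its listed place, since
  nonnegative modes commute.\<close>

lemma normal_ordered_Cons:
  "normal_ordered act ((a, n) # ops) w =
    (if n < 0 then mode act a n (normal_ordered act ops w) else normal_ordered act ops (mode act a n w))"
  using foldr_mode_nonneg_comm[of n "filter (\<lambda>(a, n). n \<ge> 0) ops" a w]
  by (auto simp: normal_ordered_def)

lemma normal_ordered_Nil: "normal_ordered act [] w = w"
  by (simp add: normal_ordered_def)

lemma normal_ordered_lin: "lin (normal_ordered act ops)"
proof -
  have "lin (foldr (\<lambda>(a, n). mode act a n) ops)" for ops
  proof (induction ops)
    case Nil
    show ?case by (simp add: id_def lin_intros)
  next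
    case (Cons x ops)
    show ?case using lin_comp[OF mode_lin Cons] by (cases x) (simp add: comp_def)
  qed
  then show ?thesis unfolding normal_ordered_def .
qed

definition nof_term :: "('h poly \<times> nat) list \<Rightarrow> int list \<Rightarrow> 'v \<Rightarrow> 'v" where
  "nof_term xs ps w = prod_list (map2 (\<lambda>(a, n) p. of_int (p + int n - 1) gchoose (n - 1)) xs ps)
     *s normal_ordered act (map2 (\<lambda>(a, n) p. (a, - p - int n)) xs ps) w"

lemma nof_term_Cons: "nof_term ((a, k) # xs) (p # ps) w = (of_int (p + int k - 1) gchoose (k - 1)) *s
    (if - p - int k < 0 then mode act a (- p - int k) (nof_term xs ps w)
     else nof_term xs ps (mode act a (- p - int k) w))"
  by (simp add: nof_term_def normal_ordered_Cons lin_scale[OF mode_lin])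

lemma nof_term_lin: "lin (nof_term xs ps)"
  unfolding nof_term_def[abs_def] by (intro lin_intros normal_ordered_lin)

definition nof_support :: "('h poly \<times> nat) list \<Rightarrow> int \<Rightarrow> 'v \<Rightarrow> int list set" where
  "nof_support xs Q w = {ps. length ps = length xs \<and> sum_list ps = Q \<and> nof_term xs ps w \<noteq> 0}"

lemma nof_eq_sum:
  assumes "finite S" "nof_support xs Q w \<subseteq> S" "\<And>ps. ps \<in> S \<Longrightarrow> length ps = length xs \<and> sum_list ps = Q"
  shows "normal_ordered_field sv act xs Q w = (\<Sum>ps\<in>S. nof_term xs ps w)"
  unfolding normal_ordered_field_def nof_term_def[symmetric]
proof (subst Sum_any.expand_superset[OF assms(1)])
  show "{ps. (if length ps = length xs \<and> sum_list ps = Q then nof_term xs ps w else 0) \<noteq> 0} \<subseteq> S"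
    using assms(2) by (auto simp: nof_support_def)
qed (use assms(3) in auto)

text \<open>The first exponent avoids the gap between -k and 0, where its coefficient vanishes;
  below the gap its mode a(j) acts first, which forces j < J.\<close>

lemma nof_support_Cons:
  assumes k: "k \<ge> 1" and J: "\<forall>n\<ge>int J. mode act a n w = 0"
    and ps: "ps \<in> nof_support ((a, k) # xs) Q w"
  obtains (nonneg) j qs where "ps = int j # qs" "qs \<in> nof_support xs (Q - int j) w"
  | (neg) j qs where "j < J" "ps = (- int k - int j) # qs"
      "qs \<in> nof_support xs (Q + int k + int j) (mode act a (int j) w)"
proof -
  obtain p qs where p: "ps = p # qs" using ps by (cases ps) (auto simp: nof_support_def)
  have ne: "nof_term ((a, k) # xs) (p # qs) w \<noteq> 0" and l: "length qs = length xs" and s: "sum_list qs = Q - p"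
    using ps unfolding p by (auto simp: nof_support_def)
  show ?thesis
  proof (cases "- p - int k < 0")
    case True
    with ne have "(of_int (p + int k - 1) gchoose (k - 1)) \<noteq> (0::complex)" "nof_term xs qs w \<noteq> 0"
      by (auto simp: nof_term_Cons lin_zero[OF mode_lin])
    then have "p \<ge> 0" using gchoose_field_coeff(3)[OF k _ True] by (meson linorder_not_less)
    then show ?thesis
      using nonneg[of "nat p" qs] p l s \<open>nof_term xs qs w \<noteq> 0\<close> by (simp add: nof_support_def)
  next
    case False
    define j where "j = nat (- p - int k)"
    have pj: "p = - int k - int j" and j: "- p - int k = int j" using False by (auto simp: j_def)
    have ne': "nof_term xs qs (mode act a (int j) w) \<noteq> 0" using ne False by (auto simp: nof_term_Cons j)
    then have "j < J" using J lin_zero[OF nof_term_lin, of xs qs] by (cases "j < J") auto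
    then show ?thesis using neg[of j qs] p l s ne' by (simp add: nof_support_def pj)
  qed
qed

text \<open>Finiteness alone is not inductive: in total degree Q the first exponent j runs over all
  naturals, and only emptiness for low degrees of the tail bounds it.\<close>

lemma nof_support_finite:
  assumes "\<forall>(a, k)\<in>set xs. k \<ge> 1"
  shows "(\<forall>Q w. finite (nof_support xs Q w)) \<and> (\<forall>w. \<exists>Q0. \<forall>Q<Q0. nof_support xs Q w = {})"
  using assms
proof (induction xs)
  case Nil
  have "nof_support [] Q w \<subseteq> {[]}" "Q < 0 \<Longrightarrow> nof_support [] Q w = {}" for Q w
    by (auto simp: nof_support_def)
  then show ?case by (meson finite.intros finite_subset)
next
  case (Cons x xs)
  obtain a k where x: "x = (a, k)" by (cases x)
  have k: "k \<ge> 1" using Cons.prems by (simp add: x)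
  have fin: "finite (nof_support xs Q w)" for Q w using Cons by simp
  have bd: "\<exists>Q0. \<forall>Q<Q0. nof_support xs Q w = {}" for w using Cons by simp
  show ?case unfolding x
  proof (intro conjI allI)
    fix Q w
    obtain J where J: "\<forall>n\<ge>0 + int J. mode act a n w = 0" using is_field_bound[OF is_field_md] by blast
    then have J: "\<forall>n\<ge>int J. mode act a n w = 0" by simp
    obtain Q0 where Q0: "\<And>Q. Q < Q0 \<Longrightarrow> nof_support xs Q w = {}" using bd by blast
    have "nof_support ((a, k) # xs) Q w \<subseteq>
       (\<Union>j\<in>{..nat (Q - Q0)}. (#) (int j) ` nof_support xs (Q - int j) w) \<union>
       (\<Union>j\<in>{..<J}. (#) (- int k - int j) ` nof_support xs (Q + int k + int j) (mode act a (int j) w))"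
      (is "_ \<subseteq> ?R")
    proof
      fix ps assume "ps \<in> nof_support ((a, k) # xs) Q w"
      then show "ps \<in> ?R"
      proof (cases rule: nof_support_Cons[OF k J, consumes 1, case_names nonneg neg])
        case (nonneg j qs)
        then have "\<not> Q - int j < Q0" using Q0 by auto
        then have "j \<le> nat (Q - Q0)" by linarith
        then show ?thesis using nonneg by blast
      next
        case (neg j qs)
        then show ?thesis by blast
      qed
    qed
    then show "finite (nof_support ((a, k) # xs) Q w)" by (rule finite_subset) (simp add: fin)
  next
    fix w
    obtain J where J: "\<forall>n\<ge>0 + int J. mode act a n w = 0" using is_field_bound[OF is_field_md] by blast
    then have J: "\<forall>n\<ge>int J. mode act a n w = 0" by simp
    obtain Q0 where Q0: "\<And>Q. Q < Q0 \<Longrightarrow> nof_support xs Q w = {}" using bd by blast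
    \<comment> \<open>One bound for the finitely many vectors a(j) w; the degree is negated because
      \<open>ex_common_bound\<close> concerns large integers.\<close>
    have "\<exists>N. \<forall>j\<in>{..<J}. \<forall>n\<ge>N. nof_support xs (- n + int k + int j) (mode act a (int j) w) = {}"
    proof (rule ex_common_bound)
      fix j
      obtain Q1 where Q1: "\<And>Q. Q < Q1 \<Longrightarrow> nof_support xs Q (mode act a (int j) w) = {}" using bd by blast
      show "\<exists>N. \<forall>n\<ge>N. nof_support xs (- n + int k + int j) (mode act a (int j) w) = {}"
        by (intro exI[of _ "int k + int j + 1 - Q1"] allI impI Q1) simp
    qed simp
    then obtain N where N: "\<And>j n. j < J \<Longrightarrow> n \<ge> N \<Longrightarrow> nof_support xs (- n + int k + int j) (mode act a (int j) w) = {}"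
      by blast
    have "nof_support ((a, k) # xs) Q w = {}" if Q: "Q < min Q0 (- N)" for Q
    proof (rule ccontr)
      assume "nof_support ((a, k) # xs) Q w \<noteq> {}"
      then obtain ps where "ps \<in> nof_support ((a, k) # xs) Q w" by blast
      then show False
      proof (cases rule: nof_support_Cons[OF k J, consumes 1, case_names nonneg neg])
        case (nonneg j qs)
        then show ?thesis using Q Q0[of "Q - int j"] by auto
      next
        case (neg j qs)
        then show ?thesis using Q N[of j "- Q"] by auto
      qed
    qed
    then show "\<exists>Q0. \<forall>Q<Q0. nof_support ((a, k) # xs) Q w = {}" by blast
  qed
qed

text \<open>The right-hand side is the product of index -k of a(z) with the field of
  \<open>xs\<close>, in truncated form. All large \<open>B\<close> are allowed so that the range can
  be fitted to a bound for the corresponding \<open>Y\<close>.\<close>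

lemma nof_Cons:
  assumes xs: "\<forall>(a, k)\<in>set xs. k \<ge> 1" and k: "k \<ge> 1" and J: "\<forall>n\<ge>int J. mode act a n w = 0"
  shows "\<exists>B0. \<forall>B\<ge>B0. normal_ordered_field sv act ((a, k) # xs) Q w =
    (\<Sum>j<B. signed_binomial (- int k) j *s mode act a (- int k - int j) (normal_ordered_field sv act xs (Q - int j) w))
    - neg_one_pow (- int k) *s
      (\<Sum>j<J. signed_binomial (- int k) j *s normal_ordered_field sv act xs (Q + int k + int j) (mode act a (int j) w))"
proof -
  have fin: "finite (nof_support xs Q w)" for Q w using nof_support_finite[OF xs] by blast
  obtain Q0 where Q0: "\<And>Q. Q < Q0 \<Longrightarrow> nof_support xs Q w = {}" using nof_support_finite[OF xs] by blast
  have nof: "normal_ordered_field sv act xs Q w = (\<Sum>ps\<in>nof_support xs Q w. nof_term xs ps w)" for Q w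
    by (rule nof_eq_sum[OF fin]) (auto simp: nof_support_def)
  show ?thesis
  proof (intro exI[of _ "nat (Q - Q0) + 1"] allI impI)
    fix B assume B: "B \<ge> nat (Q - Q0) + 1"
    let ?S1 = "SIGMA j:{..<B}. nof_support xs (Q - int j) w"
    let ?S2 = "SIGMA j:{..<J}. nof_support xs (Q + int k + int j) (mode act a (int j) w)"
    let ?f1 = "\<lambda>(j, qs). int j # qs" and ?f2 = "\<lambda>(j, qs). (- int k - int j) # qs"
    have fS: "finite ?S1" "finite ?S2" using fin by (auto intro: finite_SigmaI)
    have sub: "nof_support ((a, k) # xs) Q w \<subseteq> ?f1 ` ?S1 \<union> ?f2 ` ?S2"
    proof
      fix ps assume "ps \<in> nof_support ((a, k) # xs) Q w"
      then show "ps \<in> ?f1 ` ?S1 \<union> ?f2 ` ?S2"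
      proof (cases rule: nof_support_Cons[OF k J, consumes 1, case_names nonneg neg])
        case (nonneg j qs)
        then have "\<not> Q - int j < Q0" using Q0 by auto
        then have "j < B" using B by linarith
        then show ?thesis using nonneg by (intro UnI1 image_eqI[of _ _ "(j, qs)"]) auto
      next
        case (neg j qs)
        then show ?thesis by (intro UnI2 image_eqI[of _ _ "(j, qs)"]) auto
      qed
    qed
    have "normal_ordered_field sv act ((a, k) # xs) Q w = (\<Sum>ps\<in>?f1 ` ?S1 \<union> ?f2 ` ?S2. nof_term ((a, k) # xs) ps w)"
      by (rule nof_eq_sum[OF _ sub]) (use fS in \<open>auto simp: nof_support_def\<close>)
    also have "\<dots> = (\<Sum>ps\<in>?f1 ` ?S1. nof_term ((a, k) # xs) ps w) + (\<Sum>ps\<in>?f2 ` ?S2. nof_term ((a, k) # xs) ps w)"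
      using k by (intro sum.union_disjoint finite_imageI fS) auto
    also have "(\<Sum>ps\<in>?f1 ` ?S1. nof_term ((a, k) # xs) ps w)
        = (\<Sum>j<B. \<Sum>qs\<in>nof_support xs (Q - int j) w. nof_term ((a, k) # xs) (int j # qs) w)"
      by (subst sum.reindex) (auto simp: inj_on_def sum.Sigma fin case_prod_unfold)
    also have "(\<Sum>ps\<in>?f2 ` ?S2. nof_term ((a, k) # xs) ps w)
        = (\<Sum>j<J. \<Sum>qs\<in>nof_support xs (Q + int k + int j) (mode act a (int j) w). nof_term ((a, k) # xs) ((- int k - int j) # qs) w)"
      by (subst sum.reindex) (auto simp: inj_on_def sum.Sigma fin case_prod_unfold)
    finally have sum: "normal_ordered_field sv act ((a, k) # xs) Q w
        = (\<Sum>j<B. \<Sum>qs\<in>nof_support xs (Q - int j) w. nof_term ((a, k) # xs) (int j # qs) w)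
        + (\<Sum>j<J. \<Sum>qs\<in>nof_support xs (Q + int k + int j) (mode act a (int j) w). nof_term ((a, k) # xs) ((- int k - int j) # qs) w)" .
    have t1: "nof_term ((a, k) # xs) (int j # qs) w = signed_binomial (- int k) j *s mode act a (- int k - int j) (nof_term xs qs w)" for j qs
    proof -
      have e: "- int j - int k = - int k - int j" and neg: "(- int k - int j < 0) = True" using k by auto
      show ?thesis unfolding nof_term_Cons gchoose_field_coeff(1)[OF k] e neg by simp
    qed
    have t2: "nof_term ((a, k) # xs) ((- int k - int j) # qs) w
       = - (neg_one_pow (- int k) * signed_binomial (- int k) j) *s nof_term xs qs (mode act a (int j) w)" for j qs
      unfolding nof_term_Cons gchoose_field_coeff(2)[OF k] by simp
    show "normal_ordered_field sv act ((a, k) # xs) Q w =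
      (\<Sum>j<B. signed_binomial (- int k) j *s mode act a (- int k - int j) (normal_ordered_field sv act xs (Q - int j) w))
      - neg_one_pow (- int k) *s
        (\<Sum>j<J. signed_binomial (- int k) j *s normal_ordered_field sv act xs (Q + int k + int j) (mode act a (int j) w))"
      unfolding sum t1 t2 nof by (simp add: lin_sum[OF mode_lin] scale_sum_right sum_negf)
  qed
qed

text \<open>\<open>Y_md\<close> at -k and \<open>nof_Cons\<close> are the same recursion, the mode n
  being the coefficient of z^(-n-1).\<close>

lemma state_field_map_normal_ordered:
  assumes Y: "heisenberg_vertex sv (mode act) pairing vac Y" and xs: "\<forall>(a, k)\<in>set xs. k \<ge> 1"
  shows "Y (foldr (\<lambda>(a, k). mode act a (- int k)) xs vac) n w = normal_ordered_field sv act xs (- n - 1) w"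
  using xs
proof (induction xs arbitrary: n w)
  case Nil
  interpret Y: heisenberg_vertex sv "mode act" pairing vac Y by (rule Y)
  have "normal_ordered_field sv act [] (- n - 1) w = (\<Sum>ps\<in>(if n = -1 then {[]} else {}). nof_term [] ps w)"
    by (rule nof_eq_sum) (auto simp: nof_support_def split: if_splits)
  then show ?case by (simp add: Y.Y_vac nof_term_def normal_ordered_Nil)
next
  case (Cons x xs)
  interpret Y: heisenberg_vertex sv "mode act" pairing vac Y by (rule Y)
  obtain a k where x: "x = (a, k)" by (cases x)
  let ?v = "foldr (\<lambda>(a, k). mode act a (- int k)) xs vac"
  have k: "k \<ge> 1" and xs: "\<forall>(a, k)\<in>set xs. k \<ge> 1" using Cons.prems by (auto simp: x)
  have IH: "normal_ordered_field sv act xs q u = Y ?v (- q - 1) u" for q u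
    using Cons.IH[OF xs, of "- q - 1" u] by simp
  obtain J where J: "\<forall>n\<ge>0 + int J. mode act a n w = 0" using is_field_bound[OF is_field_md] by blast
  obtain B1 where B1: "\<forall>m\<ge>n + int B1. Y ?v m w = 0" using is_field_bound[OF Y.is_field_Y] by blast
  have J': "\<forall>n\<ge>int J. mode act a n w = 0" using J by simp
  obtain B0 where B0: "\<And>B. B \<ge> B0 \<Longrightarrow> normal_ordered_field sv act ((a, k) # xs) (- n - 1) w =
    (\<Sum>j<B. signed_binomial (- int k) j *s mode act a (- int k - int j) (normal_ordered_field sv act xs (- n - 1 - int j) w))
    - neg_one_pow (- int k) *s
      (\<Sum>j<J. signed_binomial (- int k) j *s normal_ordered_field sv act xs (- n - 1 + int k + int j) (mode act a (int j) w))"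
    using nof_Cons[OF xs k J', of "- n - 1"] by blast
  define B where "B = max B0 B1"
  have B: "\<forall>m\<ge>n + int B. Y ?v m w = 0" "B \<ge> B0" using B1 by (auto simp: B_def)
  have "Y (foldr (\<lambda>(a, k). mode act a (- int k)) (x # xs) vac) n w = nth_product (mode act a) (Y ?v) (- int k) 0 n w"
    by (simp add: x Y.Y_md)
  also have "\<dots> = normal_ordered_field sv act (x # xs) (- n - 1) w"
    unfolding x B0[OF B(2)] IH nth_product_def expansion_sum'[of "mode act a" n B "Y ?v" w, OF is_field_md B(1)]
      expansion_sum'[of "Y ?v" 0 J "mode act a" w, OF Y.is_field_Y J]
    by (simp add: algebra_simps)
  finally show ?case .
qed

lemma M_Y_eq:
  assumes Y: "heisenberg_vertex sv (mode act) pairing vac Y"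
  shows "M_Y sv act vac = Y"
  unfolding M_Y_def
proof (rule the_equality)
  interpret Y: heisenberg_vertex sv "mode act" pairing vac Y by (rule Y)
  show "(\<forall>n w. Vector_Spaces.linear sv sv (\<lambda>v. Y v n w)) \<and> (\<forall>xs n w. (\<forall>(a, k)\<in>set xs. k \<ge> 1) \<longrightarrow>
      Y (foldr (\<lambda>(a, k). mode act a (- int k)) xs vac) n w = normal_ordered_field sv act xs (- n - 1) w)"
    using Y.Y_lin_state state_field_map_normal_ordered[OF Y] by (simp add: lin_iff_linear)
  fix Y' assume Y': "(\<forall>n w. Vector_Spaces.linear sv sv (\<lambda>v. Y' v n w)) \<and> (\<forall>xs n w. (\<forall>(a, k)\<in>set xs. k \<ge> 1) \<longrightarrow>
      Y' (foldr (\<lambda>(a, k). mode act a (- int k)) xs vac) n w = normal_ordered_field sv act xs (- n - 1) w)"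
  define W where "W = {foldr (\<lambda>(a, k). mode act a (- int k)) xs vac | xs. \<forall>(a, k)\<in>set xs. k \<ge> 1}"
  \<comment> \<open>Creation monomials span, which gives the uniqueness demanded by the definite
    description.\<close>
  have span_W: "v \<in> span W" for v
  proof (rule creation_generated)
    have "vac \<in> W" unfolding W_def by (intro CollectI exI[of _ "[]"]) simp
    then show "vac \<in> span W" by (simp add: span_base)
    fix a :: "'h poly" and k :: int and v assume k: "k < 0" "v \<in> span W"
    have "subspace {v. mode act a k v \<in> span W}"
      by (rule subspaceI)
        (simp_all add: lin_add[OF mode_lin] lin_scale[OF mode_lin] lin_zero[OF mode_lin] span_add span_scale span_zero)
    moreover have "W \<subseteq> {v. mode act a k v \<in> span W}"
    proof
      fix v assume "v \<in> W"
      then obtain xs where xs: "v = foldr (\<lambda>(a, k). mode act a (- int k)) xs vac" "\<forall>(a, k)\<in>set xs. k \<ge> 1"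
        unfolding W_def by blast
      have "mode act a k v = foldr (\<lambda>(a, k). mode act a (- int k)) ((a, nat (- k)) # xs) vac"
        using k by (simp add: xs)
      moreover have "\<forall>(a, k)\<in>set ((a, nat (- k)) # xs). k \<ge> 1" using xs k by auto
      ultimately have "mode act a k v \<in> W"
        unfolding W_def by (intro CollectI exI[of _ "(a, nat (- k)) # xs"] conjI)
      then show "v \<in> {v. mode act a k v \<in> span W}" by (simp add: span_base)
    qed
    ultimately show "mode act a k v \<in> span W" using span_minimal k(2) by blast
  qed simp
  show "Y' = Y"
  proof (intro ext)
    fix v n w
    have l: "lin (\<lambda>v. Y' v n w)" using Y' by (simp add: lin_iff_linear)
    have "subspace {v. Y' v n w = Y v n w}"
      by (rule subspaceI) (simp_all add: lin_simps[OF l] lin_simps[OF Y.Y_lin_state])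
    moreover have "W \<subseteq> {v. Y' v n w = Y v n w}"
      using Y' state_field_map_normal_ordered[OF Y] by (auto simp: W_def)
    ultimately show "Y' v n w = Y v n w" using span_minimal span_W by blast
  qed
qed

end

section \<open>The operators \<open>L(n)\<close>\<close>

locale M_conformal = M_module sh form l sv act vac
  for sh :: "complex \<Rightarrow> 'h \<Rightarrow> 'h::ab_group_add" and form l
    and sv :: "complex \<Rightarrow> 'v \<Rightarrow> 'v::ab_group_add" and act vac +
  fixes d :: nat and u :: "nat \<Rightarrow> 'h"
  assumes basis: "orthonormal_basis_for sh form d u" and l: "l \<noteq> 0"
begin

interpretation h: vector_space sh by (rule sh)

notation sv (infixr "*s" 75)

lemma basis_expand: "(\<Sum>i\<in>{1..d}. sh (form (u i) x) (u i)) = x"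
proof -
  have "h.subspace {x. (\<Sum>i\<in>{1..d}. sh (form (u i) x) (u i)) = x}"
    by (rule h.subspaceI)
      (simp_all add: form_add form_scale h.scale_left_distrib sum.distrib flip: h.scale_scale h.scale_sum_right)
  moreover have "u ` {1..d} \<subseteq> {x. (\<Sum>i\<in>{1..d}. sh (form (u i) x) (u i)) = x}"
  proof clarify
    fix k assume k: "k \<in> {1..d}"
    have "(\<Sum>i\<in>{1..d}. sh (form (u i) (u k)) (u i)) = (\<Sum>i\<in>{1..d}. if i = k then u i else 0)"
      using basis k by (intro sum.cong) (auto simp: orthonormal_basis_for_def)
    then show "(\<Sum>i\<in>{1..d}. sh (form (u i) (u k)) (u i)) = u k" using k by simp
  qed
  ultimately have "h.span (u ` {1..d}) \<subseteq> {x. (\<Sum>i\<in>{1..d}. sh (form (u i) x) (u i)) = x}"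
    by (intro h.span_minimal)
  then show ?thesis using basis by (auto simp: orthonormal_basis_for_def)
qed

lemma mode_sum: "finite S \<Longrightarrow> mode act (\<Sum>i\<in>S. f i) n v = (\<Sum>i\<in>S. mode act (f i) n v)"
  by (induction S rule: finite_induct) (simp_all add: mode_zero mode_add)

text \<open>Any \<open>J\<close> above the degree is allowed, since \<open>M_L_mode\<close> uses the
  cutoff of the operators L(n).\<close>

lemma mode_basis_expand:
  assumes "degree a \<le> J"
  shows "(\<Sum>i\<in>{1..d}. \<Sum>j\<le>J. form (u i) (coeff a j) *s mode act (monom (u i) j) n w) = mode act a n w"
proof -
  have m: "form (u i) x *s mode act (monom (u i) j) n w = mode act (monom (sh (form (u i) x) (u i)) j) n w" for i x j
    by (simp add: map_poly_monom flip: mode_scale)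
  have "(\<Sum>i\<in>{1..d}. \<Sum>j\<le>J. form (u i) (coeff a j) *s mode act (monom (u i) j) n w)
      = (\<Sum>j\<le>J. \<Sum>i\<in>{1..d}. mode act (monom (sh (form (u i) (coeff a j)) (u i)) j) n w)"
    unfolding m by (rule sum.swap)
  also have "\<dots> = (\<Sum>j\<le>J. mode act (monom (coeff a j) j) n w)"
    unfolding mode_sum[OF finite_atLeastAtMost, symmetric] monom_sum[symmetric] basis_expand ..
  also have "\<dots> = mode act a n w"
    using poly_as_sum_of_monoms'[OF assms] by (simp flip: mode_sum)
  finally show ?thesis .
qed

lemma pairing_monom: "pairing (monom x j) a = l * form x (coeff a j)"
proof (cases "x = 0")
  case False
  have "(\<Sum>i\<le>j. form (coeff (monom x j) i) (coeff a i)) = (\<Sum>i\<le>j. if i = j then form x (coeff a j) else 0)"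
    by (intro sum.cong) auto
  then show ?thesis using False by (simp add: pairing_def degree_monom_eq)
qed simp

text \<open>One number controls both infinite sums in L(n), over powers of t and over modes.\<close>

definition annihilation_bound :: "'v \<Rightarrow> nat \<Rightarrow> bool" where
  "annihilation_bound w N \<longleftrightarrow> (\<forall>x j m. m \<ge> 0 \<longrightarrow> j \<ge> N \<or> m \<ge> int N \<longrightarrow> mode act (monom x j) m w = 0)"

lemma annihilation_bound_mono: "annihilation_bound w N \<Longrightarrow> N \<le> N' \<Longrightarrow> annihilation_bound w N'"
  unfolding annihilation_bound_def by (meson le_trans of_nat_le_iff order_trans)

lemma ex_annihilation_bound: "\<exists>N. annihilation_bound w N"
proof (induction w rule: generated_induct)
  case vac
  show ?case by (auto simp: annihilation_bound_def mode_vac)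
next
  case (md a k v)
  then obtain N where N: "annihilation_bound v N" by blast
  \<comment> \<open>The central term needs both m = -k and a nonzero coefficient of t^j in
    \<open>a\<close>; the bounds 1 - k and degree + 1 exclude one or the other.\<close>
  have "mode act (monom x j) m (mode act a k v) = 0"
    if m: "m \<ge> 0" and jm: "j \<ge> max N (max (Suc (degree a)) (nat (1 - k))) \<or> m \<ge> int (max N (max (Suc (degree a)) (nat (1 - k))))" for x j m
  proof -
    have "mode act (monom x j) m v = 0" using N m jm unfolding annihilation_bound_def by auto
    moreover have "m + k \<noteq> 0 \<or> coeff a j = 0"
    proof (cases "j \<ge> Suc (degree a)")
      case True
      then show ?thesis by (simp add: coeff_eq_0)
    next
      case False
      then show ?thesis using jm by auto
    qed
    ultimately show ?thesis by (auto simp: mode_comm[of "monom x j" m a k] lin_zero[OF mode_lin] pairing_monom)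
  qed
  then show ?case unfolding annihilation_bound_def by blast
next
  case (add x y)
  then obtain N M where "annihilation_bound x N" "annihilation_bound y M" by blast
  then have "annihilation_bound x (max N M)" "annihilation_bound y (max N M)"
    by (auto intro: annihilation_bound_mono)
  then have "annihilation_bound (x + y) (max N M)" by (simp add: annihilation_bound_def lin_add[OF mode_lin])
  then show ?case by blast
next
  case (scale c x)
  then obtain N where "annihilation_bound x N" by blast
  then have "annihilation_bound (c *s x) N" by (simp add: annihilation_bound_def lin_scale[OF mode_lin])
  then show ?case by blast
qed

definition quad :: "'h poly \<Rightarrow> int \<Rightarrow> int \<Rightarrow> 'v \<Rightarrow> 'v" where
  "quad b n m w = normal_ordered act [(b, n - m), (b, m)] w"

lemma quad_eq: "quad b n m w =
  (if n - m < 0 then mode act b (n - m) (mode act b m w) else mode act b m (mode act b (n - m) w))"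
  by (simp add: quad_def normal_ordered_Cons normal_ordered_Nil)

lemma quad_lin: "lin (quad b n m)"
  unfolding quad_def[abs_def] by (rule normal_ordered_lin)

text \<open>For n >= -1 the factor acting first is a nonnegative mode: n - m < 0 forces m >= 0.
  Hence the annihilation bound applies in both cases.\<close>

lemma quad_zero:
  assumes "n \<ge> -1" "annihilation_bound w N" "j \<ge> N \<or> \<bar>m\<bar> \<ge> int N + \<bar>n\<bar>"
  shows "quad (monom x j) n m w = 0"
proof (cases "n - m < 0")
  case True
  then have "mode act (monom x j) m w = 0" using assms unfolding annihilation_bound_def by auto
  then show ?thesis using True by (simp add: quad_eq lin_zero[OF mode_lin])
next
  case False
  have "mode act (monom x j) (n - m) w = 0"
    using assms False unfolding annihilation_bound_def
    by (cases "j \<ge> N") (auto simp: abs_if split: if_splits)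
  then show ?thesis using False by (simp add: quad_eq lin_zero[OF mode_lin])
qed

text \<open>The cutoffs \<open>J\<close> and \<open>R\<close> stay free so that L(n) on different
  vectors can be compared over one range.\<close>

lemma M_L_eq:
  assumes n: "n \<ge> -1" and w: "annihilation_bound w N" and J: "N \<le> J" and R: "int N + \<bar>n\<bar> \<le> R"
  shows "M_L l d u sv act n w =
    (1 / (2 * l)) *s (\<Sum>i\<in>{1..d}. \<Sum>j\<le>J. \<Sum>m\<in>{-R..R}. quad (monom (u i) j) n m w)"
proof -
  have m: "Sum_any (\<lambda>m. quad (monom x j) n m w) = (\<Sum>m\<in>{-R..R}. quad (monom x j) n m w)" for x j
  proof (rule Sum_any.expand_superset)
    show "{m. quad (monom x j) n m w \<noteq> 0} \<subseteq> {-R..R}"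
    proof
      fix m assume "m \<in> {m. quad (monom x j) n m w \<noteq> 0}"
      then have "\<not> \<bar>m\<bar> \<ge> int N + \<bar>n\<bar>" using quad_zero[OF n w] by blast
      then show "m \<in> {-R..R}" using R by auto
    qed
  qed simp
  have j: "Sum_any (\<lambda>j. \<Sum>m\<in>{-R..R}. quad (monom x j) n m w) = (\<Sum>j\<le>J. \<Sum>m\<in>{-R..R}. quad (monom x j) n m w)" for x
  proof (rule Sum_any.expand_superset)
    have "(\<Sum>m\<in>{-R..R}. quad (monom x j) n m w) = 0" if "j > J" for j
      using quad_zero[OF n w] that J by (intro sum.neutral) auto
    then show "{j. (\<Sum>m\<in>{-R..R}. quad (monom x j) n m w) \<noteq> 0} \<subseteq> {..J}"
      by (auto simp: not_less[symmetric])
  qed simp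
  show ?thesis unfolding M_L_def quad_def[symmetric] m j ..
qed

lemma M_L_vac: "n \<ge> -1 \<Longrightarrow> M_L l d u sv act n vac = 0"
proof -
  assume n: "n \<ge> -1"
  have "annihilation_bound vac 0" by (simp add: annihilation_bound_def mode_vac)
  then show ?thesis
    using M_L_eq[OF n, of vac 0 0 "\<bar>n\<bar>"] quad_zero[OF n, of vac 0] by simp
qed

lemma M_L_lin:
  assumes n: "n \<ge> -1" shows "lin (M_L l d u sv act n)"
proof -
  have "M_L l d u sv act n (x + y) = M_L l d u sv act n x + M_L l d u sv act n y" for x y
  proof -
    obtain N M where "annihilation_bound x N" "annihilation_bound y M" using ex_annihilation_bound by blast
    then have N: "annihilation_bound x (max N M)" "annihilation_bound y (max N M)"
      by (auto intro: annihilation_bound_mono)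
    then have N': "annihilation_bound (x + y) (max N M)" by (simp add: annihilation_bound_def lin_add[OF mode_lin])
    show ?thesis
      unfolding M_L_eq[OF n N(1) order_refl order_refl] M_L_eq[OF n N(2) order_refl order_refl]
        M_L_eq[OF n N' order_refl order_refl] lin_add[OF quad_lin] sum.distrib scale_right_distrib ..
  qed
  moreover have "M_L l d u sv act n (c *s x) = c *s M_L l d u sv act n x" for c x
  proof -
    obtain N where N: "annihilation_bound x N" using ex_annihilation_bound by blast
    then have N': "annihilation_bound (c *s x) N" by (simp add: annihilation_bound_def lin_scale[OF mode_lin])
    show ?thesis
      unfolding M_L_eq[OF n N order_refl order_refl]
        M_L_eq[OF n N' order_refl order_refl] lin_scale[OF quad_lin] scale_sum_right scale_scale
      by (simp add: mult.commute)
  qed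
  ultimately show ?thesis by (simp add: lin_def)
qed

text \<open>a(k) meets each of the two factors once, and both central terms leave the same mode
  b(n+k); this doubling cancels the 1/2 in L(n).\<close>

lemma quad_mode:
  "quad b n m (mode act a k w) = mode act a k (quad b n m w)
    - (if m = - k then (of_int k * pairing b a) *s mode act b (n + k) w else 0)
    - (if m = n + k then (of_int k * pairing b a) *s mode act b (n + k) w else 0)"
proof -
  have 1: "mode act b m (mode act a k w) = mode act a k (mode act b m w)
      - (if m = - k then (of_int k * pairing b a) *s w else 0)" for m w
    using mode_comm[of b m a k w] by (cases "m = - k") auto
  define p where "p = n - m"
  have 2: "n - m = p" "m = n + k \<longleftrightarrow> p = - k" "n + k = p + m + k" by (auto simp: p_def)
  show ?thesis
    unfolding quad_eq 1 lin_diff[OF mode_lin] 2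
    by (cases "m = - k"; cases "p = - k")
      (simp_all add: lin_zero[OF mode_lin] lin_scale[OF mode_lin])
qed

lemma M_L_mode:
  assumes n: "n \<ge> -1"
  shows "M_L l d u sv act n (mode act a k w) =
    mode act a k (M_L l d u sv act n w) - of_int k *s mode act a (n + k) w"
proof -
  obtain N M where "annihilation_bound w N" "annihilation_bound (mode act a k w) M" using ex_annihilation_bound by blast
  then have N: "annihilation_bound w (max N M)" "annihilation_bound (mode act a k w) (max N M)"
    by (auto intro: annihilation_bound_mono)
  \<comment> \<open>The degree of \<open>a\<close> is included for the expansion of \<open>a\<close>
    in the basis.\<close>
  define J where "J = max (max N M) (degree a)"
  \<comment> \<open>The extra |k| brings both exceptional indices, m = -k and m = n + k, into the
    range.\<close>
  define R where "R = int (max N M) + \<bar>n\<bar> + \<bar>k\<bar>"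
  have JR: "max N M \<le> J" "int (max N M) + \<bar>n\<bar> \<le> R" "degree a \<le> J" "- k \<in> {-R..R}" "n + k \<in> {-R..R}"
    by (auto simp: J_def R_def)
  have "(\<Sum>m\<in>{-R..R}. quad b n m (mode act a k w)) = mode act a k (\<Sum>m\<in>{-R..R}. quad b n m w)
      - (2 * of_int k * pairing b a) *s mode act b (n + k) w" for b
    unfolding quad_mode sum_subtractf lin_sum[OF mode_lin]
    using JR(4,5) by (simp add: algebra_simps flip: mult_2 scale_left_distrib)
  then have "M_L l d u sv act n (mode act a k w) = mode act a k (M_L l d u sv act n w)
     - (1 / (2 * l)) *s (\<Sum>i\<in>{1..d}. \<Sum>j\<le>J. (2 * of_int k * l) *s form (u i) (coeff a j) *s mode act (monom (u i) j) (n + k) w)"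
    unfolding M_L_eq[OF n N(1) JR(1,2)] M_L_eq[OF n N(2) JR(1,2)] 
    by (simp add: sum_subtractf lin_sum[OF mode_lin] lin_scale[OF mode_lin] pairing_monom scale_right_diff_distrib mult.assoc)
  also have "(1 / (2 * l)) *s (\<Sum>i\<in>{1..d}. \<Sum>j\<le>J. (2 * of_int k * l) *s form (u i) (coeff a j) *s mode act (monom (u i) j) (n + k) w)
      = of_int k *s mode act a (n + k) w"
    unfolding mode_basis_expand[OF JR(3), symmetric] scale_sum_right[symmetric] using l by simp
  finally show ?thesis .
qed

lemma M_quasi_conformal: "quasi_conformal sv vac (M_Y sv act vac) (M_L l d u sv act)"
proof -
  obtain Y where Y: "heisenberg_vertex sv (mode act) pairing vac Y" using ex_state_field_map by blast
  interpret heisenberg_vertex sv "mode act" pairing vac Y by (rule Y)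
  interpret heisenberg_quasi_conformal sv "mode act" pairing vac Y "M_L l d u sv act"
    by standard (simp_all add: M_L_lin M_L_vac M_L_mode)
  show ?thesis unfolding M_Y_eq[OF Y] by (rule quasi_conformal)
qed

end

theorem corollary3p5:
  fixes scale_h :: "complex \<Rightarrow> 'h::ab_group_add \<Rightarrow> 'h"
    and form :: "'h \<Rightarrow> 'h \<Rightarrow> complex"
    and d :: nat and u :: "nat \<Rightarrow> 'h"
    and l :: complex
    and scale_M :: "complex \<Rightarrow> 'v::ab_group_add \<Rightarrow> 'v"
    and act :: "'h affine \<Rightarrow> 'v \<Rightarrow> 'v"
    and vac :: 'v
  assumes "vector_space scale_h"
    and "nondegenerate_symmetric_form scale_h form"
    and "orthonormal_basis_for scale_h form d u"
    and "l \<noteq> 0"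
    and "is_M scale_h form l scale_M act vac"
  shows "quasi_conformal scale_M vac (M_Y scale_M act vac) (M_L l d u scale_M act)"
proof -
  interpret M_conformal scale_h form l scale_M act vac d u
    using assms by (simp add: M_conformal_def M_module_def M_conformal_axioms_def)
  show ?thesis by (rule M_quasi_conformal)
qed

end
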